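(* Let $I$ be an isotopy in $\mathrm{Homeo}_0(\mathbb{A})$ from the identity to a homeomorphism $f$. Let $\gamma^+,\gamma^-$ be two disjoint essential $f$-free Jordan curves in $\mathbb{A}$, let $A$ be the closed annulus delimited by $\gamma^+$ and $\gamma^-$, and suppose $\Theta(A)\neq\emptyset$. Then $\rho_{\Theta(A)}(I)$ is an interval of $\overline{\mathbb{R}}$.
   Context: $\mathbb{T}^1=\mathbb{R}/\mathbb{Z}$, $\mathbb{A}=\mathbb{T}^1\times\mathbb{R}$ is the open annulus with universal covering $\pi:\mathbb{R}^2\to\mathbb{A}$ and $p_1:\mathbb{R}^2\to\mathbb{R}$ the first coordinate projection. $\mathrm{Homeo}_0(\mathbb{A})$ is the set of homeomorphisms of $\mathbb{A}$ isotopic to the identity. For an isotopy $I=(f_t)_{t\in[0,1]}$ from the identity to $f=f_1$, let $(\tilde f_t)$ be its lift to $\mathbb{R}^2$ with $\tilde f_0=\mathrm{Id}$, and $\tilde f=\tilde f_1$. For $z\in\mathbb{A}$ and $n\ge1$, $\rho_n(z)=\frac1n(p_1(\tilde f^n(\tilde z))-p_1(\tilde z))$ with $\tilde z\in\pi^{-1}(z)$. For a compact $K\subset\mathbb{A}$, $\rho_K(I)=\bigcap_{m\ge1}\mathrm{Cl}\big(\bigcup_{n\ge m}\{\rho_n(z): z\in K,\ f^n(z)\in K\}\big)$, closure in $\overline{\mathbb{R}}=\mathbb{R}\cup\{\pm\infty\}$. A Jordan curve $\gamma\subset\mathbb{A}$ is essential if $\mathbb{A}\setminus\gamma$ has two unbounded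 connected components; it is $f$-free if $f(\gamma)\cap\gamma=\emptyset$. For $E\subset\mathbb{A}$, $\Theta(E)=\{x\in E: f^n(x)\in E\text{ for all }n\in\mathbb{Z}\}$ is the maximal invariant set of $E$. *)

theory Defs
  imports "HOL-Analysis.Analysis"
begin

text \<open>The open annulus T^1 x R is modelled as the set of pairs (z,y) in C x R with |z| = 1.\<close>
type_synonym apt = "complex \<times> real"

definition Ann :: "apt set" where
  "Ann = {p. cmod (fst p) = 1}"

definition cov :: "real \<times> real \<Rightarrow> apt" where
  "cov w = (cis (2 * pi * fst w), snd w)"

definition is_isotopy :: "(real \<Rightarrow> apt \<Rightarrow> apt) \<Rightarrow> (apt \<Rightarrow> apt) \<Rightarrow> bool" where
  "is_isotopy H f \<longleftrightarrow>
     continuous_on ({0..1} \<times> Ann) (\<lambda>(t, x). H t x) \<and>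
     (\<forall>t\<in>{0..1}. \<exists>g. homeomorphism Ann Ann (H t) g) \<and>
     (\<forall>x\<in>Ann. H 0 x = x) \<and> (\<forall>x\<in>Ann. H 1 x = f x)"

definition is_isotopy_lift :: "(real \<Rightarrow> real \<times> real \<Rightarrow> real \<times> real) \<Rightarrow> (real \<Rightarrow> apt \<Rightarrow> apt) \<Rightarrow> bool" where
  "is_isotopy_lift F H \<longleftrightarrow>
     continuous_on ({0..1} \<times> UNIV) (\<lambda>(t, w). F t w) \<and>
     (\<forall>w. F 0 w = w) \<and>
     (\<forall>t\<in>{0..1}. \<forall>w. cov (F t w) = H t (cov w))"

definition jordan_curve :: "apt set \<Rightarrow> bool" where
  "jordan_curve \<gamma> \<longleftrightarrow> (\<exists>g. simple_path g \<and> pathfinish g = pathstart g \<and> path_image g = \<gamma>) \<and> \<gamma> \<subseteq> Ann"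

definition essential :: "apt set \<Rightarrow> bool" where
  "essential \<gamma> \<longleftrightarrow> jordan_curve \<gamma> \<and> card {C \<in> components (Ann - \<gamma>). \<not> bounded C} = 2"

definition free_curve :: "(apt \<Rightarrow> apt) \<Rightarrow> apt set \<Rightarrow> bool" where
  "free_curve f \<gamma> \<longleftrightarrow> f ` \<gamma> \<inter> \<gamma> = {}"

definition closed_annulus_between :: "apt set \<Rightarrow> apt set \<Rightarrow> apt set" where
  "closed_annulus_between g1 g2 = closure (\<Union>{C \<in> components (Ann - (g1 \<union> g2)). bounded C})"

definition Theta :: "(apt \<Rightarrow> apt) \<Rightarrow> apt set \<Rightarrow> apt set" where
  "Theta f E = {x \<in> E. \<forall>n::nat. (f ^^ n) x \<in> E \<and> (inv_into Ann f ^^ n) x \<in> E}"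

text \<open>rho_n(z) for a lift (w) of z, with lifted map Ff.\<close>
definition rho_n :: "(real \<times> real \<Rightarrow> real \<times> real) \<Rightarrow> nat \<Rightarrow> real \<times> real \<Rightarrow> real" where
  "rho_n Ff n w = (fst ((Ff ^^ n) w) - fst w) / real n"

text \<open>rho_K(I), a subset of the extended reals; Ff is the time-one map of the lift, f the map.\<close>
definition rho_set :: "(real \<times> real \<Rightarrow> real \<times> real) \<Rightarrow> (apt \<Rightarrow> apt) \<Rightarrow> apt set \<Rightarrow> ereal set" where
  "rho_set Ff f K = (\<Inter>m\<in>{1..}. closure (\<Union>n\<in>{m..}.
       {ereal (rho_n Ff n w) | w. cov w \<in> K \<and> (f ^^ n) (cov w) \<in> K}))"

definition ereal_interval :: "ereal set \<Rightarrow> bool" where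
  "ereal_interval S \<longleftrightarrow> (\<forall>a\<in>S. \<forall>b\<in>S. \<forall>c. a \<le> c \<and> c \<le> b \<longrightarrow> c \<in> S)"

end

theory Submission
  imports Defs
begin

text \<open>
  If the rotation set had a gap, the maximal invariant set would split into two closed invariant
  parts P and Q, rotating faster, respectively slower, than some number c. When f or its inverse
  maps the closed annulus into its interior, the maximal invariant set is a decreasing
  intersection of continua, hence connected, a contradiction.

  Otherwise f pushes both curves to the same side, say up. Let S be the set of points whose forward
  orbit stays in the annulus and U the set of those whose backward orbit does. Both decompose
  according to which of P and Q the orbit converges to. Components of S reach the lower curve and
  components of U reach the upper one, so a component of S and one of U through a common
  point of Q form a barrier that bounds the width of the lifted components belonging to P, and
  conversely. Take lifts x of a point of P and y of a point of Q with x far to the left of y, and N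
  such that the N-th image of x is far to the right of that of y. The N-th preimage of the component
  of S at the image of x, together with the component of U at x, joins the bottom of the plane to the
  top; the same holds for y, and the two continua are disjoint. Their order at the top is that
  of x and y, at the bottom it is the opposite one, so by the Fashoda theorem they meet.
\<close>

section \<open>Continua in the plane\<close>

text \<open>The obstacle is that a lifted component of \<open>S\<close> or \<open>U\<close> could
  wander arbitrarily far along the strip, which would destroy any order between continua through
  different points. Hence all widths are bounded first, uniformly and independently of the number of
  iterates; only then is \<open>N\<close> chosen, so that the difference in rotation exceeds them.
  The two continua are disjoint for two unrelated reasons. Two top pieces, or two bottom pieces, are
  horizontally too far apart. A top piece of one that met a bottom piece of the other would carry an
  orbit from one part of the invariant set to the other, or against the drift. Statements about the
  upper curve are obtained from those about the lower one by reversing time, which exchanges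
  \<open>f\<close> with its inverse and the two ends.\<close>

lemma connected_UN_balls:
  fixes S :: "'a::real_normed_vector set"
  assumes "connected S" "e > 0"
  shows "connected (\<Union>x\<in>S. ball x e)"
proof (cases "S = {}")
  case False
  have "connected (\<Union>((\<lambda>x. S \<union> ball x e) ` S))"
  proof (rule connected_Union)
    show "connected T" if "T \<in> (\<lambda>x. S \<union> ball x e) ` S" for T
      using that assms by (auto intro!: connected_Un)
    show "\<Inter> ((\<lambda>x. S \<union> ball x e) ` S) \<noteq> {}"
      using False by auto
  qed
  moreover have "\<Union>((\<lambda>x. S \<union> ball x e) ` S) = (\<Union>x\<in>S. ball x e)"
    using assms by force
  ultimately show ?thesis by simp
qed auto

text \<open>The Fashoda theorem wants paths inside a box with endpoints on its sides, so the long
  coordinate of each path is clamped to the box. A common point of the clamped paths is a genuine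
  one: the other path bounds the clamped coordinate strictly, so the clamping is inactive
  there.\<close>

lemma crossing_paths:
  fixes p q :: "real \<Rightarrow> real \<times> real"
  assumes "path p" "path q"
    and q: "\<And>z. z \<in> path_image q \<Longrightarrow> \<bar>fst z\<bar> < K"
    and p: "\<And>z. z \<in> path_image p \<Longrightarrow> \<bar>snd z\<bar> < H"
    and p0: "fst (pathstart p) \<le> -K" and p1: "fst (pathfinish p) \<ge> K"
    and q0: "snd (pathstart q) \<le> -H" and q1: "snd (pathfinish q) \<ge> H"
  shows "path_image p \<inter> path_image q \<noteq> {}"
proof -
  define v :: "real \<Rightarrow> real \<Rightarrow> real^2" where "v = (\<lambda>a b. a *\<^sub>R axis 1 1 + b *\<^sub>R axis 2 1)"
  have v1: "v a b $ 1 = a" and v2: "v a b $ 2 = b" for a b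
    by (auto simp: v_def axis_def)
  define c where "c = (\<lambda>k t::real. max (-k) (min k t))"
  define p' where "p' = (\<lambda>t. v (c K (fst (p t))) (snd (p t)))"
  define q' where "q' = (\<lambda>t. v (fst (q t)) (c H (snd (q t))))"
  have K: "K > 0" using q[OF pathstart_in_path_image] by linarith
  have H: "H > 0" using p[OF pathstart_in_path_image] by linarith
  have "path p'" "path q'"
    using assms(1,2) unfolding path_def p'_def q'_def v_def c_def
    by (auto intro!: continuous_intros)
  moreover have "path_image p' \<subseteq> cbox (v (-K) (-H)) (v K H)"
  proof
    fix z assume "z \<in> path_image p'"
    then obtain t where t: "t \<in> {0..1}" "z = p' t" by (auto simp: path_image_def)
    then have "\<bar>snd (p t)\<bar> < H" by (intro p) (auto simp: path_image_def)
    then show "z \<in> cbox (v (-K) (-H)) (v K H)"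
      using K t by (auto simp: p'_def mem_box_cart forall_2 v1 v2 c_def)
  qed
  moreover have "path_image q' \<subseteq> cbox (v (-K) (-H)) (v K H)"
  proof
    fix z assume "z \<in> path_image q'"
    then obtain t where t: "t \<in> {0..1}" "z = q' t" by (auto simp: path_image_def)
    then have "\<bar>fst (q t)\<bar> < K" by (intro q) (auto simp: path_image_def)
    then show "z \<in> cbox (v (-K) (-H)) (v K H)"
      using H t by (auto simp: q'_def mem_box_cart forall_2 v1 v2 c_def)
  qed
  moreover have "pathstart p' $ 1 = v (-K) (-H) $ 1" "pathfinish p' $ 1 = v K H $ 1"
    using p0 p1 K by (auto simp: pathstart_def pathfinish_def p'_def v1 c_def)
  moreover have "pathstart q' $ 2 = v (-K) (-H) $ 2" "pathfinish q' $ 2 = v K H $ 2"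
    using q0 q1 H by (auto simp: pathstart_def pathfinish_def q'_def v2 c_def)
  ultimately obtain z where "z \<in> path_image p'" "z \<in> path_image q'"
    using fashoda by blast
  then obtain s t where st: "s \<in> {0..1}" "t \<in> {0..1}" "p' s = q' t"
    by (auto simp: path_image_def)
  then have 1: "c K (fst (p s)) = fst (q t)" and 2: "snd (p s) = c H (snd (q t))"
    using v1 v2 unfolding p'_def q'_def by metis+
  have "\<bar>fst (q t)\<bar> < K" "\<bar>snd (p s)\<bar> < H"
    using p q st by (auto simp: path_image_def)
  then have "p s = q t"
    using 1 2 by (auto simp: c_def prod_eq_iff max_def min_def split: if_splits)
  moreover have "p s \<in> path_image p" "q t \<in> path_image q" using st by (auto simp: path_image_def)
  ultimately show ?thesis by auto
qed

text \<open>Disjoint compact sets keep a positive distance, so each can be thickened to an open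
  connected, hence path connected, set without creating an intersection. The version for paths then
  applies inside the thickenings.\<close>

lemma crossing_continua:
  fixes Z1 Z2 :: "(real \<times> real) set"
  assumes "compact Z1" "compact Z2" "connected Z1" "connected Z2"
    and K: "\<And>z. z \<in> Z2 \<Longrightarrow> \<bar>fst z\<bar> \<le> K"
    and H: "\<And>z. z \<in> Z1 \<Longrightarrow> \<bar>snd z\<bar> \<le> H"
    and a1: "a1 \<in> Z1" "fst a1 \<le> -K - 1" and b1: "b1 \<in> Z1" "fst b1 \<ge> K + 1"
    and a2: "a2 \<in> Z2" "snd a2 \<le> -H - 1" and b2: "b2 \<in> Z2" "snd b2 \<ge> H + 1"
  shows "Z1 \<inter> Z2 \<noteq> {}"
proof
  assume "Z1 \<inter> Z2 = {}"
  then obtain d where d: "d > 0" "\<And>x y. x \<in> Z1 \<Longrightarrow> y \<in> Z2 \<Longrightarrow> d \<le> dist x y"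
    using separate_compact_closed[of Z1 Z2] assms compact_imp_closed by blast
  \<comment> \<open>\<open>2*e \<le> d\<close> keeps the thickenings disjoint;
    \<open>e \<le> 1\<close> keeps them within the margin of one by which the endpoints exceed
    \<open>K\<close> and \<open>H\<close>.\<close>
  define e where "e = min 1 (d/2)"
  have e: "e > 0" "e \<le> 1" "2*e \<le> d" using d by (auto simp: e_def)
  define O1 where "O1 = (\<Union>x\<in>Z1. ball x e)"
  define O2 where "O2 = (\<Union>x\<in>Z2. ball x e)"
  have "path_connected O1" "path_connected O2"
    unfolding O1_def O2_def
    by (auto intro!: connected_open_path_connected connected_UN_balls assms e)
  moreover have "a1 \<in> O1" "b1 \<in> O1" "a2 \<in> O2" "b2 \<in> O2"
    using a1 b1 a2 b2 e centre_in_ball[of _ e] unfolding O1_def O2_def by blast+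
  ultimately obtain p q where p: "path p" "path_image p \<subseteq> O1" "pathstart p = a1" "pathfinish p = b1"
    and q: "path q" "path_image q \<subseteq> O2" "pathstart q = a2" "pathfinish q = b2"
    unfolding path_connected_def by metis
  have "path_image p \<inter> path_image q \<noteq> {}"
  proof (rule crossing_paths[where K="K+1" and H="H+1"])
    show "\<bar>fst z\<bar> < K + 1" if "z \<in> path_image q" for z
    proof -
      have "z \<in> O2" using that q by blast
      then obtain x where "x \<in> Z2" "dist x z < e" unfolding O2_def by auto
      moreover have "\<bar>fst x - fst z\<bar> \<le> dist x z" using dist_fst_le[of x z] by (simp add: dist_real_def)
      ultimately show ?thesis using K[of x] e by linarith
    qed
    show "\<bar>snd z\<bar> < H + 1" if "z \<in> path_image p" for z
    proof -
      have "z \<in> O1" using that p by blast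
      then obtain x where "x \<in> Z1" "dist x z < e" unfolding O1_def by auto
      moreover have "\<bar>snd x - snd z\<bar> \<le> dist x z" using dist_snd_le[of x z] by (simp add: dist_real_def)
      ultimately show ?thesis using H[of x] e by linarith
    qed
  qed (use p q a1 b1 a2 b2 in auto)
  then obtain z where "z \<in> O1" "z \<in> O2" using p q by blast
  then obtain x y where "x \<in> Z1" "y \<in> Z2" "dist x z < e" "dist y z < e"
    by (auto simp: O1_def O2_def)
  then show False using d(2)[of x y] e dist_triangle2[of x y z] by linarith
qed

text \<open>Boundary bumping for continua that may be unbounded. If \<open>C\<close> stayed in
  \<open>P\<close>, Sura-Bura would give a compact relatively clopen part of \<open>S\<close> around
  it, hence a bounded open \<open>W\<close> inside \<open>P\<close> whose frontier misses the whole
  intersection. By compactness the frontier already misses some \<open>B n\<close>, which is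
  connected, meets \<open>W\<close> and leaves it.\<close>

lemma component_of_nested_Inter_escapes:
  fixes B :: "nat \<Rightarrow> 'a::euclidean_space set"
  assumes clo: "\<And>n. closed (B n)" and con: "\<And>n. connected (B n)" and dec: "\<And>n. B (Suc n) \<subseteq> B n"
    and esc: "\<And>n. \<not> B n \<subseteq> P" and P: "open P" "P \<inter> B 0 \<subseteq> Z" and Z: "closed Z"
    and S: "S = Z \<inter> (\<Inter>n. B n)" and C: "C \<in> components S" "compact C"
  shows "\<not> C \<subseteq> P"
proof
  assume CP: "C \<subseteq> P"
  have "closed S" using clo Z S by auto
  then have "locally compact S" by (simp add: closed_imp_locally_compact)
  then obtain K where K: "openin (top_of_set S) K" "compact K" "C \<subseteq> K" "K \<subseteq> P"
    using Sura_Bura_clopen_subset[OF _ C P(1) CP] by blast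
  obtain T where T: "open T" "K = S \<inter> T" using K(1) by (auto simp: openin_open)
  \<comment> \<open>Everything that a neighbourhood of \<open>K\<close> has to avoid: the rest of
    \<open>S\<close>, and the complement of \<open>P\<close>.\<close>
  define R where "R = (S - T) \<union> (- P)"
  have "closed R" using \<open>closed S\<close> T P by (auto simp: R_def closed_Diff closed_Compl)
  moreover have "K \<inter> R = {}" using T K by (auto simp: R_def)
  ultimately obtain d where d: "d > 0" "\<And>x y. x \<in> K \<Longrightarrow> y \<in> R \<Longrightarrow> d \<le> dist x y"
    using separate_compact_closed[of K R] K by blast
  define W where "W = (\<Union>x\<in>K. ball x (d/2))"
  have "open W" by (auto simp: W_def)
  have clW: "closure W \<subseteq> (\<Union>x\<in>K. cball x (d/2))"
  proof (rule closure_minimal)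
    show "closed (\<Union>x\<in>K. cball x (d/2))"
      by (rule compact_imp_closed[OF compact_minkowski_sum_cball[OF K(2)]])
  qed (auto simp: W_def intro: less_imp_le)
  have "bounded (\<Union>x\<in>K. cball x (d/2))"
    by (rule compact_imp_bounded[OF compact_minkowski_sum_cball[OF K(2)]])
  then have "bounded W"
    by (rule bounded_subset) (rule order_trans[OF closure_subset clW])
  have clR: "closure W \<inter> R = {}"
  proof (rule ccontr)
    assume "closure W \<inter> R \<noteq> {}"
    then obtain y where y: "y \<in> R" "y \<in> closure W" by blast
    then have "y \<in> (\<Union>x\<in>K. cball x (d/2))" using clW by (rule_tac subsetD)
    then obtain x where "x \<in> K" "dist x y \<le> d/2" by auto
    with y show False using d(2)[of x y] d(1) by auto
  qed
  have KW: "K \<subseteq> W" using d by (auto simp: W_def)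
  have fr: "frontier W \<inter> (\<Inter>n. B n) = {}"
  proof -
    have "frontier W \<subseteq> closure W - W" using \<open>open W\<close> by (simp add: frontier_def interior_open)
    \<comment> \<open>Within \<open>P\<close>, membership in all \<open>B n\<close> already gives
      membership in \<open>Z\<close>; this is the purpose of the hypothesis on
      \<open>B 0\<close>.\<close>
    moreover have "x \<in> S" if "x \<in> closure W" "x \<in> (\<Inter>n. B n)" for x
      using that clR P S by (auto simp: R_def)
    moreover have "x \<in> W" if "x \<in> closure W" "x \<in> S" for x
      using that clR KW T unfolding R_def by blast
    ultimately show ?thesis by blast
  qed
  have decr: "m \<le> n \<Longrightarrow> B n \<subseteq> B m" for m n
    using dec by (rule lift_Suc_antimono_le)
  have "\<exists>n. frontier W \<inter> B n = {}"
  proof (rule ccontr)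
    assume "\<not> ?thesis"
    then have "\<Inter>(range (\<lambda>n. frontier W \<inter> B n)) \<noteq> {}"
      using clo decr compact_frontier_bounded[OF \<open>bounded W\<close>]
      by (intro compact_nest) (blast intro: compact_Int_closed)+
    then show False using fr by auto
  qed
  then obtain n where n: "frontier W \<inter> B n = {}" ..
  have "C \<noteq> {}" using C in_components_nonempty by blast
  then obtain c where "c \<in> C" by blast
  then have "c \<in> S" "c \<in> W" using KW K in_components_subset[OF C(1)] by blast+
  then have "B n \<inter> W \<noteq> {}" using S by blast
  moreover have "W \<subseteq> P" using clR closure_subset[of W] by (auto simp: R_def)
  then have "B n - W \<noteq> {}" using esc[of n] by auto
  ultimately show False using connected_Int_frontier[OF con] n by blast
qed

section \<open>The covering of the annulus\<close>

text \<open>Polar coordinates with radius \<open>exp\<close> of the height identify the annulus with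
  the punctured plane. This gives access to the covering by \<open>exp\<close> and to the Jordan
  curve theorem.\<close>

definition em :: "apt \<Rightarrow> complex" where "em p = of_real (exp (snd p)) * fst p"
definition em_inv :: "complex \<Rightarrow> apt" where "em_inv z = (z / of_real (cmod z), ln (cmod z))"

lemma closed_Ann: "closed Ann"
proof -
  have "Ann = (\<lambda>p. cmod (fst p)) -` {1}" by (auto simp: Ann_def)
  moreover have "closed \<dots>" by (intro closed_vimage continuous_intros)
  ultimately show ?thesis by simp
qed

lemma homeomorphism_em: "homeomorphism Ann (-{0}) em em_inv"
proof (rule homeomorphismI)
  show "continuous_on Ann em" unfolding em_def by (intro continuous_intros)
  show "continuous_on (- {0}) em_inv" unfolding em_inv_def by (intro continuous_intros) auto
  show "em ` Ann \<subseteq> - {0}" by (auto simp: em_def Ann_def)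
  show "em_inv ` (- {0}) \<subseteq> Ann" by (auto simp: em_inv_def Ann_def norm_divide)
  show "em_inv (em x) = x" if "x \<in> Ann" for x
    using that by (auto simp: em_def em_inv_def Ann_def norm_mult prod_eq_iff)
  show "em (em_inv y) = y" if "y \<in> - {0}" for y
    using that by (auto simp: em_def em_inv_def)
qed

lemma cov_in_Ann [simp]: "cov w \<in> Ann"
  by (simp add: cov_def Ann_def)

lemma continuous_on_cov: "continuous_on A cov"
  unfolding cov_def by (intro continuous_intros)

lemma snd_cov [simp]: "snd (cov w) = snd w" by (simp add: cov_def)

lemma em_cov: "em (cov w) = exp (Complex (snd w) (2 * pi * fst w))"
  by (simp add: em_def cov_def exp_eq_polar)

lemma cov_eq_iff: "cov v = cov w \<longleftrightarrow> (\<exists>k::int. v = w + (of_int k, 0))"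
proof
  assume "cov v = cov w"
  then have s: "snd v = snd w" and "cis (2 * pi * fst v) = cis (2 * pi * fst w)"
    by (auto simp: cov_def)
  then have "cis (2 * pi * fst v - 2 * pi * fst w) = 1" by (simp flip: cis_divide)
  then have "cos (2 * pi * fst v - 2 * pi * fst w) = 1" by (metis cis.simps(1) one_complex.simps(1))
  then obtain k :: int where "2 * pi * fst v - 2 * pi * fst w = of_int k * (2 * pi)"
    by (auto simp: cos_one_2pi_int)
  then have "2 * pi * (fst v - fst w - of_int k) = 0" by (simp add: algebra_simps)
  then have "fst v = fst w + of_int k" by simp
  then show "\<exists>k::int. v = w + (of_int k, 0)" using s by (intro exI[of _ k]) (auto simp: prod_eq_iff)
next
  assume "\<exists>k::int. v = w + (of_int k, 0)"
  then obtain k :: int where k: "v = w + (of_int k, 0)" ..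
  have "cis (2 * pi * (fst w + of_int k)) = cis (2 * pi * fst w) * cis (2 * pi * of_int k)"
    by (simp only: cis_mult distrib_left)
  also have "\<dots> = cis (2 * pi * fst w)" by (simp add: cis_multiple_2pi)
  finally show "cov v = cov w" using k by (simp only: cov_def fst_add snd_add fst_conv snd_conv) simp
qed

lemma cov_shift [simp]: "cov (w + (of_int k, 0)) = cov w"
  using cov_eq_iff by blast

lemma cov_surj: "p \<in> Ann \<Longrightarrow> \<exists>w. cov w = p \<and> 0 \<le> fst w \<and> fst w \<le> 1"
proof -
  assume "p \<in> Ann"
  then have "cmod (fst p) = 1" by (simp add: Ann_def)
  then obtain t where t: "0 \<le> t" "t < 2*pi" "fst p = Complex (cos t) (sin t)"
    by (metis complex_unimodular_polar)
  have "fst p = cis t" using t by (simp add: complex_eq_iff)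
  then show ?thesis
    using t by (intro exI[of _ "(t / (2*pi), snd p)"]) (auto simp: cov_def prod_eq_iff)
qed

lemma range_cov: "range cov = Ann"
  by (metis cov_surj cov_in_Ann subset_antisym image_subsetI rangeI subsetI)

lemma image_cov_vimage: "X \<subseteq> Ann \<Longrightarrow> cov ` (cov -` X) = X"
  by (simp add: range_cov image_vimage_eq Int_absorb2)

text \<open>In the coordinate \<open>em\<close> the map \<open>cov\<close> is the complex
  exponential after a linear change of variables, and covering maps are open.\<close>

lemma openin_cov_image:
  assumes "open V" shows "openin (top_of_set Ann) (cov ` V)"
proof -
  define \<psi> where "\<psi> = (\<lambda>w::real\<times>real. Complex (snd w) (2 * pi * fst w))"
  define \<phi> where "\<phi> = (\<lambda>z. (Im z / (2*pi), Re z))"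
  have inv: "\<phi> (\<psi> w) = w" "\<psi> (\<phi> z) = z" for w z
    by (auto simp: \<phi>_def \<psi>_def prod_eq_iff complex_eq_iff)
  have "\<psi> ` V = \<phi> -` V" using inv by (auto simp: image_iff) metis
  moreover have "open (\<phi> -` V)"
    unfolding \<phi>_def by (intro open_vimage assms continuous_intros) auto
  ultimately have "open (\<psi> ` V)" by simp
  then have "openin (top_of_set (-{0})) (exp ` \<psi> ` V)"
    by (intro covering_space_open_map[OF covering_space_exp_punctured_plane]) simp
  then have "openin (top_of_set Ann) (Ann \<inter> em -` (exp ` \<psi> ` V))"
    using homeomorphism_em continuous_openin_preimage[of Ann em "-{0}"]
    by (auto simp: homeomorphism_def)
  moreover have "Ann \<inter> em -` (exp ` \<psi> ` V) = cov ` V"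
  proof
    have e: "em (cov w) = exp (\<psi> w)" for w by (simp add: em_cov \<psi>_def)
    show "cov ` V \<subseteq> Ann \<inter> em -` (exp ` \<psi> ` V)"
      by (intro image_subsetI IntI vimageI2 cov_in_Ann) (simp add: e)
    show "Ann \<inter> em -` (exp ` \<psi> ` V) \<subseteq> cov ` V"
    proof
      fix p assume p: "p \<in> Ann \<inter> em -` (exp ` \<psi> ` V)"
      then obtain w where w: "w \<in> V" "em p = em (cov w)" unfolding e by blast
      then have "p = cov w" using p homeomorphism_em by (metis IntD1 cov_in_Ann homeomorphism_apply1)
      then show "p \<in> cov ` V" using w by blast
    qed
  qed
  ultimately show ?thesis by simp
qed

text \<open>The reverse inclusion is continuity; this one rests on \<open>cov\<close> being
  open.\<close>

lemma vimage_cov_closure: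
  assumes XA: "X \<subseteq> Ann" shows "cov -` closure X \<subseteq> closure (cov -` X)"
proof
  fix w assume w: "w \<in> cov -` closure X"
  show "w \<in> closure (cov -` X)"
    unfolding closure_iff_nhds_not_empty
  proof (intro allI impI)
    fix A V assume V: "V \<subseteq> A" "open V" "w \<in> V"
    obtain T where T: "open T" "cov ` V = Ann \<inter> T"
      using openin_cov_image[OF V(2)] by (auto simp: openin_open)
    then have "X \<inter> T \<noteq> {}"
      using w V by (metis IntE closure_iff_nhds_not_empty imageI inf_commute order_refl vimageE)
    then obtain p where "p \<in> X" "p \<in> cov ` V" using XA T by blast
    then show "cov -` X \<inter> A \<noteq> {}" using V by auto
  qed
qed

lemma open_cov_vimage: "openin (top_of_set Ann) X \<Longrightarrow> open (cov -` X)"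
proof -
  assume "openin (top_of_set Ann) X"
  then obtain T where T: "open T" "X = Ann \<inter> T" by (auto simp: openin_open)
  then have "cov -` X = cov -` T" using cov_in_Ann by blast
  then show ?thesis using T by (auto intro!: open_vimage continuous_on_cov)
qed

lemma closed_cov_vimage: "closed X \<Longrightarrow> closed (cov -` X)"
  by (auto intro!: closed_vimage continuous_on_cov)

text \<open>Neighbourhoods of the upper end for \<open>s = 1\<close> and of the lower end for
  \<open>s = -1\<close>; the sign lets one argument serve both ends.\<close>

definition half :: "real \<Rightarrow> real \<Rightarrow> apt set" where
  "half s h = {p \<in> Ann. s * snd p \<ge> h}"

text \<open>The part of the preimage reachable from the half plane is invariant under deck
  transformations, so its image is clopen downstairs.\<close>
lemma connected_cov_vimage_between:
  assumes D: "openin (top_of_set Ann) D" and X: "connected X" "X \<subseteq> D" and h: "half s h \<subseteq> X" and s: "s \<noteq> 0"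
  obtains V0 where "open V0" "connected V0" "cov -` X \<subseteq> V0" "V0 \<subseteq> cov -` D"
proof -
  define V where "V = cov -` D"
  have oV: "open V" unfolding V_def by (rule open_cov_vimage[OF D])
  define w0 where "w0 = (0::real, h / s)"
  define P where "P = {w::real\<times>real. s * snd w \<ge> h}"
  have "convex P"
  proof -
    have "P = {w. inner (0,s) w \<ge> h}" by (auto simp: P_def inner_prod_def)
    then show ?thesis by (simp add: convex_halfspace_ge)
  qed
  then have "connected P" by (rule convex_connected)
  have PV: "P \<subseteq> V"
  proof
    fix w assume "w \<in> P"
    then have "cov w \<in> half s h" by (simp add: P_def half_def)
    then show "w \<in> V" using h X(2) by (auto simp only: V_def)
  qed
  have w0P: "w0 \<in> P" using s by (auto simp: w0_def P_def)
  define V0 where "V0 = connected_component_set V w0"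
  have V0: "open V0" "connected V0" "V0 \<subseteq> V"
    unfolding V0_def using oV by (auto simp: open_connected_component connected_component_subset)
  have PV0: "P \<subseteq> V0" unfolding V0_def using \<open>connected P\<close> PV w0P by (intro connected_component_maximal) auto
  have maxi: "T \<subseteq> V0" if "connected T" "T \<subseteq> V" "T \<inter> P \<noteq> {}" for T
  proof -
    have "connected (T \<union> P)" using that \<open>connected P\<close> by (intro connected_Un) auto
    then have "T \<union> P \<subseteq> V0" unfolding V0_def using that w0P PV by (intro connected_component_maximal) auto
    then show ?thesis by blast
  qed
  \<comment> \<open>A deck translate of \<open>V0\<close> contains a translate of \<open>w0\<close>,
    which lies in the invariant half plane \<open>P\<close>; so it stays in the same component of
    \<open>V\<close>.\<close>
  have per: "v \<in> V0" if vw: "w \<in> V0" "cov v = cov w" for v w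
  proof -
    obtain k :: int where k: "v = w + (of_int k, 0)" using vw(2) cov_eq_iff[of v w] by auto
    define T where "T = (+) (of_int k, 0) ` V0"
    have "connected T" unfolding T_def by (intro connected_continuous_image V0(2) continuous_intros)
    moreover have "T \<subseteq> V"
    proof
      fix x assume "x \<in> T"
      then obtain u where u: "u \<in> V0" "x = u + (of_int k, 0)" unfolding T_def by (metis add.commute imageE)
      then show "x \<in> V" using V0(3) by (simp only: V_def vimage_def mem_Collect_eq cov_shift) blast
    qed
    moreover have "(of_int k, 0) + w0 \<in> T" using w0P PV0 unfolding T_def by blast
    moreover have "(of_int k, 0) + w0 \<in> P" using w0P by (simp add: P_def)
    ultimately have "T \<subseteq> V0" using maxi by blast
    moreover have "v \<in> T" using vw(1) k unfolding T_def by (metis add.commute imageI)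
    ultimately show ?thesis by blast
  qed
  have "openin (top_of_set Ann) (cov ` V0)" "openin (top_of_set Ann) (cov ` (V - V0))"
  proof -
    show "openin (top_of_set Ann) (cov ` V0)" using V0 by (simp add: openin_cov_image)
    have "open (V - V0)"
    proof (subst open_subopen, intro ballI)
      fix x assume x: "x \<in> V - V0"
      have "connected_component_set V x \<inter> V0 = {}"
        using x connected_component_overlap[of V x w0] connected_component_refl_eq[of V x]
        unfolding V0_def by (metis DiffE mem_Collect_eq)
      then show "\<exists>T. open T \<and> x \<in> T \<and> T \<subseteq> V - V0"
        using x oV connected_component_subset[of V x]
        by (intro exI[of _ "connected_component_set V x"] conjI open_connected_component)
          (blast intro: connected_component_refl)+
    qed
    then show "openin (top_of_set Ann) (cov ` (V - V0))" by (simp add: openin_cov_image)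
  qed
  then obtain T0 T1 where T: "open T0" "cov ` V0 = Ann \<inter> T0" "open T1" "cov ` (V - V0) = Ann \<inter> T1"
    by (metis openin_open)
  have disj: "cov ` V0 \<inter> cov ` (V - V0) = {}"
  proof (rule ccontr)
    assume "\<not> ?thesis"
    then obtain p where p: "p \<in> cov ` V0" "p \<in> cov ` (V - V0)" by blast
    from p(1) obtain w where w: "p = cov w" "w \<in> V0" by (rule imageE)
    from p(2) obtain v where v: "p = cov v" "v \<in> V - V0" by (rule imageE)
    show False using per[of w v] v w by simp
  qed
  have XA: "X \<subseteq> Ann" using X(2) openin_imp_subset[OF D] by (rule order_trans)
  have XV: "cov -` X \<subseteq> V" using X(2) unfolding V_def by blast
  have "X \<subseteq> cov ` V0 \<union> cov ` (V - V0)"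
  proof
    fix x assume "x \<in> X"
    then obtain w where "cov w = x" "w \<in> V" using XA XV cov_surj by blast
    then show "x \<in> cov ` V0 \<union> cov ` (V - V0)" by blast
  qed
  then have "X \<subseteq> T0 \<union> T1" "T0 \<inter> T1 \<inter> X = {}" using T(2,4) disj XA by blast+
  then have "T0 \<inter> X = {} \<or> T1 \<inter> X = {}"
    using connectedD[OF X(1) T(1,3)] by blast
  moreover have "cov w0 \<in> T0 \<inter> X"
  proof
    have "cov w0 \<in> cov ` V0" using PV0 w0P by blast
    then show "cov w0 \<in> T0" using T(2) by blast
    have "cov w0 \<in> half s h" using w0P by (simp add: P_def half_def)
    then show "cov w0 \<in> X" using h by blast
  qed
  ultimately have "T1 \<inter> X = {}" by blast
  have "cov -` X \<subseteq> V0"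
  proof
    fix w assume w: "w \<in> cov -` X"
    show "w \<in> V0"
    proof (rule ccontr)
      assume "w \<notin> V0"
      then have "cov w \<in> cov ` (V - V0)" using w XV by blast
      then show False using \<open>T1 \<inter> X = {}\<close> T(4) w by blast
    qed
  qed
  with V0 show ?thesis using that unfolding V_def by blast
qed

corollary connected_cov_vimage:
  assumes "openin (top_of_set Ann) D" "connected D" "half s h \<subseteq> D" "s \<noteq> 0"
  shows "connected (cov -` D)"
  using connected_cov_vimage_between[OF assms(1,2) order_refl assms(3,4)] by (metis subset_antisym)

section \<open>Invariant continua of a drifting annulus\<close>

text \<open>What the Jordan curve theorem yields for an essential curve, in a form symmetric in the
  two sides. The closure conditions make the union of either side with the curve connected.\<close>

definition splits :: "apt set \<Rightarrow> apt set \<Rightarrow> apt set \<Rightarrow> bool" where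
  "splits \<gamma> A B \<longleftrightarrow> compact \<gamma> \<and> openin (top_of_set Ann) A \<and> openin (top_of_set Ann) B \<and>
     connected A \<and> connected B \<and> A \<union> \<gamma> \<union> B = Ann \<and> A \<inter> B = {} \<and> A \<inter> \<gamma> = {} \<and> B \<inter> \<gamma> = {} \<and>
     \<gamma> \<subseteq> closure A \<and> \<gamma> \<subseteq> closure B"

lemma splits_sym: "splits \<gamma> A B \<longleftrightarrow> splits \<gamma> B A"
  unfolding splits_def by (simp add: Un_ac Int_commute) blast

lemma closed_Ann_Diff: "openin (top_of_set Ann) A \<Longrightarrow> closed (Ann - A)"
  using closed_Ann by (metis closedin_diff closedin_closed_trans closedin_self)

lemma splits_Diff:
  assumes "splits \<gamma> A B"
  shows "Ann - A = B \<union> \<gamma>" "closed (B \<union> \<gamma>)" "connected (B \<union> \<gamma>)"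
proof -
  show *: "Ann - A = B \<union> \<gamma>" using assms unfolding splits_def by blast
  have "closed (Ann - A)" using assms closed_Ann_Diff by (simp add: splits_def)
  then show "closed (B \<union> \<gamma>)" using * by simp
  have "connected B" "B \<union> \<gamma> \<subseteq> closure B"
    using assms closure_subset unfolding splits_def by auto
  then show "connected (B \<union> \<gamma>)" by (metis Un_upper1 connected_intermediate_closure)
qed

lemma splits_cov_connected:
  assumes "splits \<gamma> A B" "half s h \<subseteq> B" "s \<noteq> 0"
  shows "connected (cov -` B)" "connected (cov -` (B \<union> \<gamma>))"
proof -
  have B: "openin (top_of_set Ann) B" "connected B" "\<gamma> \<subseteq> closure B" using assms by (auto simp: splits_def)
  show c: "connected (cov -` B)" using connected_cov_vimage[OF B(1,2) assms(2,3)] .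
  have "B \<union> \<gamma> \<subseteq> closure B" using B(3) closure_subset by simp
  then have "cov -` (B \<union> \<gamma>) \<subseteq> closure (cov -` B)"
    using vimage_cov_closure[OF openin_imp_subset[OF B(1)]] by blast
  then show "connected (cov -` (B \<union> \<gamma>))"
    by (intro connected_intermediate_closure[OF c]) blast+
qed

lemma bounded_Ann: "X \<subseteq> Ann \<Longrightarrow> (\<And>x. x \<in> X \<Longrightarrow> \<bar>snd x\<bar> \<le> k) \<Longrightarrow> bounded X"
proof (rule boundedI[of _ "1 + k"])
  fix x assume "X \<subseteq> Ann" "\<And>x. x \<in> X \<Longrightarrow> \<bar>snd x\<bar> \<le> k" "x \<in> X"
  then show "norm x \<le> 1 + k"
    using norm_Pair_le[of "fst x" "snd x"] by (fastforce simp: Ann_def)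
qed

text \<open>All that is kept of the isotopy is the lift of its time-one map; commuting with the unit
  translation says that the map has degree one around the annulus. Carrying the inverses as
  parameters makes the exchange of \<open>f\<close> and \<open>g\<close> an instance of the same
  locale.\<close>

locale annulus_lift =
  fixes f g :: "apt \<Rightarrow> apt" and F Fi :: "real \<times> real \<Rightarrow> real \<times> real"
  assumes hom: "homeomorphism Ann Ann f g"
    and contF: "continuous_on UNIV F" and contFi: "continuous_on UNIV Fi"
    and FFi [simp]: "F (Fi w) = w" and FiF [simp]: "Fi (F w) = w"
    and covF: "cov (F w) = f (cov w)"
    and shift1: "F (w + (1, 0)) = F w + (1, 0)"
begin

lemma fAnn: "x \<in> Ann \<Longrightarrow> f x \<in> Ann" and gAnn: "x \<in> Ann \<Longrightarrow> g x \<in> Ann"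
  and gf: "x \<in> Ann \<Longrightarrow> g (f x) = x" and fg: "x \<in> Ann \<Longrightarrow> f (g x) = x"
  and contf: "continuous_on Ann f" and contg: "continuous_on Ann g"
  using hom by (auto simp: homeomorphism_def)

lemma covFi: "cov (Fi w) = g (cov w)"
  by (metis FFi covF cov_in_Ann gf)

lemma shiftFi1: "Fi (w + (1, 0)) = Fi w + (1, 0)"
  by (metis FFi FiF shift1)

lemma dual: "annulus_lift g f Fi F"
  by unfold_locales (simp_all add: homeomorphism_symD[OF hom] contF contFi covFi shiftFi1)

lemma shift: "F (w + (of_int k, 0)) = F w + (of_int k, 0)"
proof (induction k arbitrary: w rule: int_induct[where k=0])
  case base
  then show ?case by (simp flip: zero_prod_def)
next
  case (step1 i)
  have "F (w + (of_int (i+1), 0)) = F ((w + (of_int i, 0)) + (1,0))" by (simp add: add.assoc)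
  then show ?case by (simp only: shift1 step1) (simp add: add.assoc)
next
  case (step2 i)
  have "F (w + (of_int i, 0)) = F ((w + (of_int (i-1), 0)) + (1,0))" by (simp add: add.assoc)
  then have "F (w + (of_int (i-1), 0)) = F w + (of_int i, 0) - (1,0)" by (simp only: shift1 step2) simp
  then show ?case by (simp add: prod_eq_iff)
qed

lemma compose:
  assumes "annulus_lift f' g' F' Fi'"
  shows "annulus_lift (f \<circ> f') (g' \<circ> g) (F \<circ> F') (Fi' \<circ> Fi)"
proof -
  interpret a: annulus_lift f' g' F' Fi' by fact
  show ?thesis
  proof
    show "homeomorphism Ann Ann (f \<circ> f') (g' \<circ> g)" using homeomorphism_compose[OF a.hom hom] .
    show "continuous_on UNIV (F \<circ> F')" "continuous_on UNIV (Fi' \<circ> Fi)"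
      using contF contFi a.contF a.contFi
      by (metis continuous_on_compose continuous_on_subset top_greatest)+
  qed (auto simp: covF a.covF shift1 a.shift1)
qed

lemma pow: "annulus_lift (f ^^ n) (g ^^ n) (F ^^ n) (Fi ^^ n)"
proof (induction n)
  case 0
  show ?case by unfold_locales (auto simp: homeomorphism_ident id_def)
next
  case (Suc n)
  have "annulus_lift (f \<circ> f ^^ n) (g ^^ n \<circ> g) (F \<circ> F ^^ n) (Fi ^^ n \<circ> Fi)" by (rule compose[OF Suc])
  then show ?case
    unfolding funpow_Suc_right[of n g] funpow_Suc_right[of n Fi] funpow.simps(2)[of n f] funpow.simps(2)[of n F] .
qed

lemma cov_vimage_image: "X \<subseteq> Ann \<Longrightarrow> cov -` (f ` X) = F ` (cov -` X)"
proof
  assume X: "X \<subseteq> Ann"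
  show "F ` (cov -` X) \<subseteq> cov -` (f ` X)" by (rule image_subsetI) (simp add: covF)
  show "cov -` (f ` X) \<subseteq> F ` (cov -` X)"
  proof
    fix w assume "w \<in> cov -` (f ` X)"
    then obtain x where "x \<in> X" "cov w = f x" by blast
    then have "cov (Fi w) = x" using X by (simp add: covFi gf subsetD)
    then show "w \<in> F ` (cov -` X)" using \<open>x \<in> X\<close> by (metis FFi imageI vimageI)
  qed
qed

lemma openin_image: "openin (top_of_set Ann) X \<Longrightarrow> openin (top_of_set Ann) (f ` X)"
  using homeomorphism_imp_open_map[OF hom] by blast

end

text \<open>For \<open>s = 1\<close>, \<open>D\<close> and \<open>V\<close> are the sides below and
  above \<open>gm\<close>, \<open>E\<close> and \<open>W\<close> the sides above and below
  \<open>gp\<close>; under \<open>f\<close>, orbits never enter \<open>D\<close> from outside and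
  never leave \<open>E\<close>. The sign is a parameter because time reversal exchanges the two
  curves and should stay within the locale.\<close>

locale drift = annulus_lift f g F Fi
  for f g F Fi +
  fixes D gm V E gp W :: "apt set" and s h :: real
  assumes spm: "splits gm D V" and spp: "splits gp E W"
    and s: "s = 1 \<or> s = -1" and h: "h > 0"
    and hD: "half (-s) h \<subseteq> D" and hE: "half s h \<subseteq> E"
    and disj: "(D \<union> gm) \<inter> (E \<union> gp) = {}"
    and gD: "g ` (D \<union> gm) \<subseteq> D" and fE: "f ` (E \<union> gp) \<subseteq> E"
begin

lemma drift_dual: "drift g f Fi F E gp W D gm V (-s) h"
proof -
  interpret a: annulus_lift g f Fi F by (rule dual)
  show ?thesis
    by unfold_locales (use spm spp s h hD hE disj gD fE in auto)
qed

lemma subsets: "D \<subseteq> Ann" "E \<subseteq> Ann" "gm \<subseteq> Ann" "gp \<subseteq> Ann" "D \<subseteq> W" "gm \<subseteq> W" "E \<subseteq> V" "gp \<subseteq> V"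
proof -
  have "D \<union> gm \<union> V = Ann" "E \<union> gp \<union> W = Ann" using spm spp unfolding splits_def by auto
  with disj show "D \<subseteq> Ann" "E \<subseteq> Ann" "gm \<subseteq> Ann" "gp \<subseteq> Ann" "D \<subseteq> W" "gm \<subseteq> W" "E \<subseteq> V" "gp \<subseteq> V"
    by fast+
qed

lemma opens: "openin (top_of_set Ann) D" "openin (top_of_set Ann) E"
  "openin (top_of_set Ann) V" "openin (top_of_set Ann) W"
  and conns: "connected D" "connected E"
  using spm spp unfolding splits_def by auto

lemma gpowD: "x \<in> D \<Longrightarrow> (g ^^ n) x \<in> D"
  by (induction n) (use gD in auto)

lemma fpowE: "x \<in> E \<Longrightarrow> (f ^^ n) x \<in> E"
  by (induction n) (use fE in auto)

lemma fpowD: "x \<in> Ann \<Longrightarrow> x \<notin> D \<Longrightarrow> (f ^^ n) x \<notin> D"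
proof
  assume x: "x \<in> Ann" "x \<notin> D" "(f ^^ n) x \<in> D"
  interpret p: annulus_lift "f ^^ n" "g ^^ n" "F ^^ n" "Fi ^^ n" by (rule pow)
  show False using x gpowD[of "(f ^^ n) x" n] by (simp add: p.gf)
qed

text \<open>\<open>S\<close> is the stable set and \<open>U\<close> below the unstable set of the maximal invariant set of the
  region between \<open>gm\<close> and \<open>gp\<close>; the two notions are exchanged by \<open>drift_dual\<close>.\<close>
definition S where "S = {x \<in> Ann. x \<notin> D \<and> (\<forall>n. (f ^^ n) x \<notin> E)}"
text \<open>Since \<open>f\<close> maps \<open>E\<close> into itself, these sets decrease. They are
  images of the connected set \<open>Ann - E\<close> under \<open>g ^^ n\<close>, and this
  connectedness is what forces the components of \<open>S\<close> to reach
  \<open>gm\<close>.\<close>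

definition B where "B n = {x \<in> Ann. (f ^^ n) x \<notin> E}"

lemma S_B: "S = (Ann - D) \<inter> (\<Inter>n. B n)"
  unfolding S_def B_def by blast

lemma B_image: "B n = (g ^^ n) ` (Ann - E)"
proof -
  interpret p: annulus_lift "f ^^ n" "g ^^ n" "F ^^ n" "Fi ^^ n" by (rule pow)
  show ?thesis
  proof
    show "B n \<subseteq> (g ^^ n) ` (Ann - E)"
      by (rule subsetI, rule image_eqI[of _ _ "(f ^^ n) _"]) (auto simp: B_def p.gf p.fAnn)
    show "(g ^^ n) ` (Ann - E) \<subseteq> B n"
      by (rule image_subsetI) (simp add: B_def p.fg p.gAnn)
  qed
qed

lemma B_dec: "B (Suc n) \<subseteq> B n"
  unfolding B_def using fE by auto

lemma B_closed: "closed (B n)"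
proof -
  interpret p: annulus_lift "f ^^ n" "g ^^ n" "F ^^ n" "Fi ^^ n" by (rule pow)
  have "closedin (top_of_set Ann) (Ann \<inter> (f ^^ n) -` (Ann - E))"
    by (intro continuous_closedin_preimage p.contf)
      (rule closed_Ann_Diff[OF opens(2)])
  moreover have "Ann \<inter> (f ^^ n) -` (Ann - E) = B n" using p.fAnn by (auto simp only: B_def)
  ultimately show ?thesis using closedin_closed_trans[OF _ closed_Ann] by metis
qed

lemma B_connected: "connected (B n)" "connected (cov -` B n)"
proof -
  interpret p: annulus_lift "f ^^ n" "g ^^ n" "F ^^ n" "Fi ^^ n" by (rule pow)
  interpret q: annulus_lift "g ^^ n" "f ^^ n" "Fi ^^ n" "F ^^ n" by (rule p.dual)
  have "connected (Ann - E)" using splits_Diff[OF spp] by simp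
  then show "connected (B n)" unfolding B_image
    by (intro connected_continuous_image continuous_on_subset[OF p.contg]) auto
  have "half (-s) h \<subseteq> W" using hD subsets by blast
  then have "connected (cov -` (Ann - E))"
    using splits_cov_connected[OF spp, of "-s" h] s splits_Diff[OF spp] by auto
  then show "connected (cov -` B n)" unfolding B_image
    by (subst q.cov_vimage_image)
      (auto intro!: connected_continuous_image continuous_on_subset[OF p.contFi])
qed

text \<open>Going backwards never leaves \<open>D\<close>, and the \<open>n\<close>-th preimage of a
  point of \<open>D\<close> is back in \<open>D\<close>, hence outside \<open>E\<close>, at time
  \<open>n\<close>.\<close>

lemma B_escapes: "\<exists>x \<in> D. x \<in> B n"
proof -
  interpret p: annulus_lift "f ^^ n" "g ^^ n" "F ^^ n" "Fi ^^ n" by (rule pow)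
  have "(1, -s*h) \<in> half (-s) h" using s by (auto simp: half_def Ann_def)
  then obtain x where x: "x \<in> D" using hD by blast
  then have "(g ^^ n) x \<in> D" "(f ^^ n) ((g ^^ n) x) = x" "(g ^^ n) x \<in> Ann"
    using gpowD subsets(1) p.fg[of x] p.gAnn[of x] by blast+
  moreover have "x \<notin> E" using x disj by blast
  ultimately show ?thesis unfolding B_def by auto
qed

lemma not_DE_bounded: "x \<in> Ann \<Longrightarrow> x \<notin> D \<Longrightarrow> x \<notin> E \<Longrightarrow> \<bar>snd x\<bar> < h"
proof -
  assume x: "x \<in> Ann" "x \<notin> D" "x \<notin> E"
  then have "x \<notin> half (-s) h" "x \<notin> half s h" using hD hE by blast+
  then show ?thesis using s x(1) by (auto simp: half_def)
qed

lemma S_props: "S \<subseteq> Ann" "S \<inter> D = {}" "S \<inter> E = {}" "x \<in> S \<Longrightarrow> \<bar>snd x\<bar> < h" "x \<in> S \<Longrightarrow> f x \<in> S"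
proof -
  show *: "S \<subseteq> Ann" "S \<inter> D = {}" "S \<inter> E = {}"
    unfolding S_def by (blast, blast, auto dest: spec[of _ 0])
  show "\<bar>snd x\<bar> < h" if "x \<in> S" for x using that * not_DE_bounded by blast
  show "f x \<in> S" if "x \<in> S" for x
  proof -
    have "(f ^^ n) (f x) \<notin> E" for n
      using that unfolding S_def by (auto dest!: spec[of _ "Suc n"] simp: funpow_swap1)
    moreover have "f x \<notin> D" using fpowD[of x 1] that unfolding S_def by auto
    ultimately show ?thesis using that fAnn unfolding S_def by auto
  qed
qed

lemma S_compact: "compact S"
proof -
  have "closed S" unfolding S_B using B_closed closed_Ann_Diff opens by (intro closed_Int closed_INT) auto
  moreover have "bounded S" using S_props by (intro bounded_Ann[of _ h]) (auto intro: less_imp_le)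
  ultimately show ?thesis by (simp add: compact_eq_bounded_closed)
qed

text \<open>Every \<open>B n\<close> reaches into \<open>D\<close>, so by boundary bumping a
  component of the intersection cannot stay away from the closed set formed by \<open>D\<close> and
  \<open>gm\<close>; being disjoint from \<open>D\<close>, it meets \<open>gm\<close>.\<close>

lemma S_component_meets:
  assumes "C \<in> components S" shows "C \<inter> gm \<noteq> {}"
proof -
  have "\<not> C \<subseteq> - (D \<union> gm)"
  proof (rule component_of_nested_Inter_escapes[OF B_closed B_connected(1) B_dec _ _ _ _ S_B assms])
    show "\<not> B n \<subseteq> - (D \<union> gm)" for n using B_escapes[of n] by blast
    have "splits gm V D" using spm splits_sym by blast
    then show "open (- (D \<union> gm))" using splits_Diff(2) by blast
    show "- (D \<union> gm) \<inter> B 0 \<subseteq> Ann - D" unfolding B_def by blast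
    show "closed (Ann - D)" using closed_Ann_Diff opens by blast
    show "compact C" using assms S_compact compact_components by blast
  qed
  then show ?thesis using S_props(2) in_components_subset[OF assms] by blast
qed

text \<open>The argument is repeated in the plane, because a component of the lift may cover only
  part of a component of \<open>S\<close>. The lift of \<open>S\<close> need not be compact, hence
  the hypothesis on \<open>C\<close>.\<close>

lemma S_lift_component_meets:
  assumes "C \<in> components (cov -` S)" "compact C" shows "C \<inter> cov -` gm \<noteq> {}"
proof -
  have "\<not> C \<subseteq> - (cov -` (D \<union> gm))"
  proof (rule component_of_nested_Inter_escapes[where B="\<lambda>n. cov -` B n" and Z="cov -` (Ann - D)" and S="cov -` S"])
    show "\<not> cov -` B n \<subseteq> - (cov -` (D \<union> gm))" for n
    proof -
      obtain x where x: "x \<in> D" "x \<in> B n" using B_escapes by blast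
      then obtain w where "cov w = x" using cov_surj subsets by blast
      then show ?thesis using x by blast
    qed
    have "splits gm V D" using spm splits_sym by blast
    then have "closed (cov -` (D \<union> gm))" using splits_Diff(2) closed_cov_vimage by blast
    then show "open (- (cov -` (D \<union> gm)))" by blast
    show "- (cov -` (D \<union> gm)) \<inter> cov -` B 0 \<subseteq> cov -` (Ann - D)" unfolding B_def by blast
    show "closed (cov -` (Ann - D))" using closed_Ann_Diff opens closed_cov_vimage by blast
    show "cov -` S = cov -` (Ann - D) \<inter> (\<Inter>n. cov -` B n)" unfolding S_B by blast
  qed (use assms B_closed closed_cov_vimage B_connected B_dec in \<open>blast+\<close>)
  then show ?thesis using S_props(2) in_components_subset[OF assms(1)] by blast
qed

end


lemma open_connected_subset_path:
  fixes X :: "'a::real_normed_vector set"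
  assumes "open X" "connected C" "C \<subseteq> X" "a \<in> C" "b \<in> C"
  obtains p where "path p" "path_image p \<subseteq> X" "pathstart p = a" "pathfinish p = b"
proof -
  have "path_connected (connected_component_set X a)"
    using assms(1) by (simp add: connected_open_path_connected open_connected_component)
  moreover have "C \<subseteq> connected_component_set X a"
    using assms by (intro connected_component_maximal)
  ultimately obtain p where p: "path p" "path_image p \<subseteq> connected_component_set X a" "pathstart p = a" "pathfinish p = b"
    using assms(4,5) unfolding path_connected_def by blast
  then show ?thesis using that connected_component_subset[of X a] by blast
qed

lemma connected_subset_closed_disjoint:
  assumes "connected C" "C \<subseteq> X \<union> Y" "closed X" "closed Y" "X \<inter> Y = {}" "C \<inter> X \<noteq> {}"
  shows "C \<subseteq> X"
proof -
  have "X \<inter> Y \<inter> C = {}" using assms(5) by blast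
  then have "Y \<inter> C = {}"
    using assms unfolding connected_closed by blast
  then show ?thesis using assms(2) by blast
qed

section \<open>Splitting the stable set, and tails attached to the curves\<close>

context drift begin

definition U where "U = {x \<in> Ann. x \<notin> E \<and> (\<forall>n. (g ^^ n) x \<notin> D)}"

lemma U_dual: "drift.S g E D = U"
  using drift.S_def[OF drift_dual] unfolding U_def .

lemma U_S_dual: "drift.U f E D = S"
proof -
  interpret du: drift g f Fi F E gp W D gm V "-s" h by (rule drift_dual)
  show ?thesis unfolding du.U_def S_def ..
qed

lemma fpow_S: "x \<in> S \<Longrightarrow> (f ^^ n) x \<in> S"
  by (induction n) (auto intro: S_props)

text \<open>A point of every forward image has its whole past in \<open>S\<close>, hence outside
  \<open>D\<close>.\<close>

lemma pow_image_S_Inter: "(\<Inter>n. (f ^^ n) ` S) \<subseteq> S \<inter> U"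
proof
  fix x assume x: "x \<in> (\<Inter>n. (f ^^ n) ` S)"
  have "(f ^^ 0) ` S = S" by simp
  then have xS: "x \<in> S" using x by blast
  have "(g ^^ n) x \<notin> D" for n
  proof -
    interpret p: annulus_lift "f ^^ n" "g ^^ n" "F ^^ n" "Fi ^^ n" by (rule pow)
    obtain y where "y \<in> S" "x = (f ^^ n) y" using x by blast
    then have "(g ^^ n) x \<in> S" using p.gf[of y] S_props(1) by (simp add: subsetD)
    then show ?thesis using S_props(2) by blast
  qed
  then show "x \<in> S \<inter> U" using xS S_props(1,3) unfolding U_def by blast
qed

text \<open>The forward images of \<open>S\<close> shrink into the invariant set, so by compactness
  one of them lies in disjoint neighbourhoods of \<open>P\<close> and \<open>Q\<close>. The two
  parts of \<open>S\<close> are the preimages of these neighbourhoods under that iterate.\<close>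

lemma S_split:
  assumes "closed P" "closed Q" "P \<inter> Q = {}" "P \<union> Q = S \<inter> U" "f ` P \<subseteq> P" "f ` Q \<subseteq> Q"
  obtains Sp Sm where "closed Sp" "closed Sm" "Sp \<inter> Sm = {}" "Sp \<union> Sm = S" "P \<subseteq> Sp" "Q \<subseteq> Sm"
proof -
  obtain Np Nm where N: "open Np" "open Nm" "P \<subseteq> Np" "Q \<subseteq> Nm" "Np \<inter> Nm = {}"
    using separation_normal[OF assms(1,2,3)] by metis
  define K where "K = (\<lambda>n. (f ^^ n) ` S - (Np \<union> Nm))"
  have cK: "compact (K n)" for n
  proof -
    interpret p: annulus_lift "f ^^ n" "g ^^ n" "F ^^ n" "Fi ^^ n" by (rule pow)
    have "compact ((f ^^ n) ` S)"
      by (intro compact_continuous_image continuous_on_subset[OF p.contf] S_compact S_props)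
    then show ?thesis unfolding K_def using N by (intro compact_diff) auto
  qed
  have "\<exists>n. K n = {}"
  proof (rule ccontr)
    assume "\<not> ?thesis"
    moreover have "K n \<subseteq> K m" if "m \<le> n" for m n
    proof -
      have "(f ^^ n) y \<in> (f ^^ m) ` S" if "y \<in> S" for y
      proof -
        have "(f ^^ n) y = (f ^^ m) ((f ^^ (n-m)) y)"
          using \<open>m \<le> n\<close> by (metis comp_apply funpow_add le_add_diff_inverse)
        then show ?thesis using fpow_S that by simp
      qed
      then show ?thesis unfolding K_def by blast
    qed
    ultimately have "\<Inter>(range K) \<noteq> {}" using cK by (intro compact_nest) blast+
    moreover have "\<Inter>(range K) \<subseteq> (\<Inter>n. (f ^^ n) ` S) - (Np \<union> Nm)" unfolding K_def by blast
    moreover have "(\<Inter>n. (f ^^ n) ` S) \<subseteq> Np \<union> Nm"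
      using pow_image_S_Inter unfolding assms(4)[symmetric]
      by (rule order_trans) (rule Un_mono[OF N(3,4)])
    ultimately show False by (metis Diff_eq_empty_iff subset_empty)
  qed
  then obtain n where n: "(f ^^ n) ` S \<subseteq> Np \<union> Nm" unfolding K_def by blast
  interpret p: annulus_lift "f ^^ n" "g ^^ n" "F ^^ n" "Fi ^^ n" by (rule pow)
  have cont: "continuous_on S (f ^^ n)" by (rule continuous_on_subset[OF p.contf S_props(1)])
  \<comment> \<open>Removing the opposite open neighbourhood makes the pieces closed; by the choice
    of \<open>n\<close> they are also the preimages of \<open>Np\<close> and \<open>Nm\<close> in
    \<open>S\<close>.\<close>
  define Sp where "Sp = S \<inter> (f ^^ n) -` (- Nm)"
  define Sm where "Sm = S \<inter> (f ^^ n) -` (- Np)"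
  have "closed Sp" "closed Sm"
    unfolding Sp_def Sm_def using N cont S_compact
    by (auto intro!: continuous_closed_preimage simp: compact_imp_closed)
  moreover have "Sp \<inter> Sm = {}" using n unfolding Sp_def Sm_def by blast
  moreover have "Sp \<union> Sm = S" using N(5) unfolding Sp_def Sm_def by blast
  moreover have "P \<subseteq> Sp" "Q \<subseteq> Sm"
  proof -
    have "(f ^^ n) x \<in> P" if "x \<in> P" for x using that assms(5) by (induction n) auto
    moreover have "(f ^^ n) x \<in> Q" if "x \<in> Q" for x using that assms(6) by (induction n) auto
    ultimately show "P \<subseteq> Sp" "Q \<subseteq> Sm" unfolding Sp_def Sm_def using N(3,4,5) assms(4) by blast+
  qed
  ultimately show ?thesis using that by blast
qed

text \<open>Joining inside \<open>f ` D\<close>, which contains the compact curve \<open>gm\<close> in its interior, instead of \<open>D\<close>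
  is what makes the width bound uniform.\<close>
lemma gm_tails:
  "\<exists>M. \<forall>p. cov p \<in> gm \<longrightarrow> (\<exists>K. compact K \<and> connected K \<and> p \<in> K \<and> K \<subseteq> cov -` (f ` D) \<and>
      (\<exists>q\<in>K. snd q = -s*h) \<and> (\<forall>w\<in>K. \<bar>fst w - fst p\<bar> \<le> M))"
proof -
  define Dt where "Dt = cov -` (f ` D)"
  have Dt: "Dt = F ` (cov -` D)" unfolding Dt_def by (rule cov_vimage_image[OF subsets(1)])
  have oDt: "open Dt" unfolding Dt_def by (rule open_cov_vimage[OF openin_image[OF opens(1)]])
  have "connected (cov -` D)" using connected_cov_vimage[OF opens(1) conns(1) hD] s by auto
  then have cDt: "connected Dt" unfolding Dt by (intro connected_continuous_image continuous_on_subset[OF contF]) auto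
  define w0 where "w0 = (0::real, -s*h)"
  have DfD: "D \<union> gm \<subseteq> f ` D"
  proof
    fix x assume x: "x \<in> D \<union> gm"
    then have "g x \<in> D" "x = f (g x)" using gD fg[of x] subsets(1,3) by (blast, metis UnE subsetD)
    then show "x \<in> f ` D" by blast
  qed
  have "cov w0 \<in> half (-s) h" using s by (auto simp: half_def w0_def)
  then have w0: "w0 \<in> Dt" using hD DfD unfolding Dt_def by blast
  \<comment> \<open>The part of \<open>Dt\<close> reachable from \<open>w0\<close> without leaving
    the strip of half-width \<open>n\<close>. These open sets increase to \<open>Dt\<close>, so one
    of them contains a whole period of the lifted curve.\<close>
  define Om where "Om = (\<lambda>n::nat. connected_component_set (Dt \<inter> {w. \<bar>fst w\<bar> < real n}) w0)"
  have oo: "open (Dt \<inter> {w. \<bar>fst w\<bar> < real n})" for n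
    using oDt by (intro open_Int open_Collect_less continuous_intros)
  have oOm: "open (Om n)" for n unfolding Om_def by (rule open_connected_component[OF oo])
  have mono: "Om m \<subseteq> Om n" if "m \<le> n" for m n
    unfolding Om_def using that by (intro connected_component_mono) auto
  have cover: "\<exists>n. p \<in> Om n" if p: "p \<in> Dt" for p
  proof -
    obtain c where c: "path c" "path_image c \<subseteq> Dt" "pathstart c = w0" "pathfinish c = p"
      using open_connected_subset_path[OF oDt cDt order_refl w0 p] by blast
    have "bounded (fst ` path_image c)"
      using c(1) by (intro compact_imp_bounded compact_continuous_image continuous_intros compact_path_image)
    then obtain b where b: "\<forall>x\<in>fst ` path_image c. \<bar>x\<bar> \<le> b" by (auto simp: bounded_iff)
    obtain n :: nat where n: "b < real n" using reals_Archimedean2 by blast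
    have "path_image c \<subseteq> Dt \<inter> {w. \<bar>fst w\<bar> < real n}" using c(2) b n by force
    then have "path_image c \<subseteq> Om n" unfolding Om_def
      using c pathstart_in_path_image[of c] by (intro connected_component_maximal connected_path_image) auto
    then show ?thesis using c(4) pathfinish_in_path_image[of c] by blast
  qed
  define K where "K = cov -` gm \<inter> cbox (0, -h) (1, h)"
  have "compact K" unfolding K_def
    using spm by (intro closed_Int_compact closed_cov_vimage compact_imp_closed) (auto simp: splits_def)
  moreover have "K \<subseteq> (\<Union>n. Om n)" unfolding K_def using DfD cover by (fastforce simp: Dt_def)
  ultimately obtain I where I: "finite I" "K \<subseteq> (\<Union>n\<in>I. Om n)"
    by (metis compactE_image[of K UNIV Om] oOm)
  define n where "n = Max (insert 0 I)"
  have KOm: "K \<subseteq> Om n"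
  proof
    fix x assume "x \<in> K"
    then obtain m where "m \<in> I" "x \<in> Om m" using I by blast
    moreover have "m \<le> n" using I \<open>m \<in> I\<close> by (simp add: n_def)
    ultimately show "x \<in> Om n" using mono by blast
  qed
  show ?thesis
  \<comment> \<open>A tail inside \<open>Om n\<close> has abscissas below \<open>n\<close> in
    absolute value and starts over the unit interval; hence \<open>n + 1\<close>.\<close>
  proof (intro exI[of _ "real n + 1"] allI impI)
    fix p assume p: "cov p \<in> gm"
    define k where "k = \<lfloor>fst p\<rfloor>"
    define p' where "p' = p + (of_int (-k), 0)"
    have cp': "cov p' = cov p" unfolding p'_def by (rule cov_shift)
    have "\<bar>snd p\<bar> < h"
    proof -
      have "cov p \<notin> D" using p spm unfolding splits_def by blast
      moreover have "cov p \<notin> E" using p disj by blast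
      ultimately show ?thesis using not_DE_bounded[of "cov p"] by simp
    qed
    moreover have fp': "0 \<le> fst p'" "fst p' \<le> 1" unfolding p'_def k_def fst_add fst_conv by linarith+
    moreover have "snd p' = snd p" by (simp add: p'_def)
    ultimately have "p' \<in> cbox (0, -h) (1, h)"
      by (cases p') (auto simp: cbox_Pair_eq)
    then have "p' \<in> Om n" using KOm p cp' unfolding K_def by auto
    moreover have "w0 \<in> Om n" unfolding Om_def
      using \<open>p' \<in> Om n\<close> unfolding Om_def by (metis connected_component_in connected_component_refl mem_Collect_eq)
    moreover have "connected (Om n)" unfolding Om_def by simp
    ultimately obtain c where c: "path c" "path_image c \<subseteq> Om n" "pathstart c = p'" "pathfinish c = w0"
      using open_connected_subset_path[OF oOm] by blast
    have OD: "Om n \<subseteq> Dt \<inter> {w. \<bar>fst w\<bar> < real n}" unfolding Om_def by (rule connected_component_subset)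
    define K' where "K' = (\<lambda>w. w + (of_int k, 0)) ` path_image c"
    have "compact K'" "connected K'" unfolding K'_def using c(1)
      by (auto intro!: compact_continuous_image connected_continuous_image continuous_intros compact_path_image connected_path_image)
    moreover have "p \<in> K'"
    proof -
      have "p = p' + (of_int k, 0)" by (simp add: p'_def prod_eq_iff)
      then show ?thesis unfolding K'_def using c(3) pathstart_in_path_image[of c] by blast
    qed
    moreover have "K' \<subseteq> cov -` (f ` D)"
    proof
      fix w assume "w \<in> K'"
      then obtain v where "v \<in> path_image c" "w = v + (of_int k, 0)" unfolding K'_def by blast
      then have "cov v \<in> f ` D" "cov w = cov v" using c(2) OD unfolding Dt_def by (blast, metis cov_shift)
      then show "w \<in> cov -` (f ` D)" by simp
    qed
    moreover have "w0 + (of_int k, 0) \<in> K'" unfolding K'_def using c(4) pathfinish_in_path_image[of c] by blast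
    moreover have "snd (w0 + (of_int k, 0)) = -s*h" by (simp add: w0_def)
    moreover have "\<bar>fst w - fst p\<bar> \<le> real n + 1" if w: "w \<in> K'" for w
    proof -
      obtain v where v: "v \<in> path_image c" "w = v + (of_int k, 0)" using w unfolding K'_def by blast
      then have "\<bar>fst v\<bar> < real n" using c(2) OD by blast
      moreover have "fst w - fst p = fst v - fst p'" using v(2) by (simp add: p'_def)
      ultimately show ?thesis using fp' by linarith
    qed
    ultimately show "\<exists>K. compact K \<and> connected K \<and> p \<in> K \<and> K \<subseteq> cov -` (f ` D) \<and>
      (\<exists>q\<in>K. snd q = -s*h) \<and> (\<forall>w\<in>K. \<bar>fst w - fst p\<bar> \<le> real n + 1)" by blast
  qed
qed

end


section \<open>Uniform bounds on the width of lifted components\<close>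

definition narrow :: "real \<Rightarrow> apt set \<Rightarrow> bool" where
  "narrow M Z \<longleftrightarrow> (\<forall>C. connected C \<longrightarrow> C \<subseteq> cov -` Z \<longrightarrow> (\<forall>p\<in>C. \<forall>q\<in>C. fst q - fst p \<le> M))"

lemma narrow_mono: "narrow M' Z' \<Longrightarrow> M' \<le> M \<Longrightarrow> Z \<subseteq> Z' \<Longrightarrow> narrow M Z"
  unfolding narrow_def by (meson order_trans vimage_mono)

context drift begin

text \<open>A continuum of points that are attracted to one part of the invariant set, followed by a
  continuum of points repelled from it, joins the two boundary curves; lifted to the plane it
  is a barrier for the sets attracted to or repelled from the other part.\<close>
lemma width_bound:
  assumes Sp: "closed Sp" "closed Sm" "Sp \<inter> Sm = {}" "Sp \<union> Sm = S"
    and Up: "closed Up" "closed Um" "Up \<inter> Um = {}" "Up \<union> Um = U"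
    and Q: "y \<in> Sm" "y \<in> Um" and cross: "Sp \<inter> Um = {}" "Sm \<inter> Up = {}"
  shows "\<exists>M. narrow M (Sp \<union> Up)"
proof -
  interpret du: drift g f Fi F E gp W D gm V "-s" h by (rule drift_dual)
  note US = U_dual
  define CS where "CS = connected_component_set S y"
  define CU where "CU = connected_component_set U y"
  have yS: "y \<in> S" "y \<in> U" using assms by blast+
  have CS: "CS \<in> components S" "y \<in> CS" "connected CS" "CS \<subseteq> S"
    unfolding CS_def using yS by (auto simp: components_def connected_component_refl connected_component_subset)
  have CU: "CU \<in> components U" "y \<in> CU" "connected CU" "CU \<subseteq> U"
    unfolding CU_def using yS by (auto simp: components_def connected_component_refl connected_component_subset)
  have "CS \<subseteq> Sm" using connected_subset_closed_disjoint[OF CS(3), of Sm Sp] Sp CS Q by blast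
  have "CU \<subseteq> Um" using connected_subset_closed_disjoint[OF CU(3), of Um Up] Up CU Q by blast
  have mS: "CS \<inter> gm \<noteq> {}" by (rule S_component_meets[OF CS(1)])
  have mU: "CU \<inter> gp \<noteq> {}" using du.S_component_meets CU(1) unfolding US by blast
  define K where "K = Sp \<union> Up"
  have "closed K" unfolding K_def using Sp Up by blast
  have U_props: "U \<subseteq> Ann" "U \<inter> E = {}" "U \<inter> D = {}" "\<And>x. x \<in> U \<Longrightarrow> \<bar>snd x\<bar> < h"
    using du.S_props unfolding US by blast+
  have conD: "connected (D \<union> CS)"
  proof -
    obtain a where a: "a \<in> CS" "a \<in> gm" using mS by blast
    have "gm \<subseteq> closure D" using spm unfolding splits_def by blast
    then have "insert a D \<subseteq> closure D" using a closure_subset by blast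
    then have "connected (insert a D)" by (intro connected_intermediate_closure[OF conns(1)]) blast+
    then have "connected (insert a D \<union> CS)" using CS(3) a by (intro connected_Un) blast+
    moreover have "insert a D \<union> CS = D \<union> CS" using a by blast
    ultimately show ?thesis by simp
  qed
  have conE: "connected (E \<union> CU)"
  proof -
    obtain a where a: "a \<in> CU" "a \<in> gp" using mU by blast
    have "gp \<subseteq> closure E" using spp unfolding splits_def by blast
    then have "insert a E \<subseteq> closure E" using a closure_subset by blast
    then have "connected (insert a E)" by (intro connected_intermediate_closure[OF conns(2)]) blast+
    then have "connected (insert a E \<union> CU)" using CU(3) a by (intro connected_Un) blast+
    moreover have "insert a E \<union> CU = E \<union> CU" using a by blast
    ultimately show ?thesis by simp
  qed
  \<comment> \<open>\<open>CS\<close> and \<open>CU\<close> share \<open>y\<close>;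
    \<open>CS\<close> is attached to \<open>D\<close> through \<open>gm\<close>, and
    \<open>CU\<close> to \<open>E\<close> through \<open>gp\<close>. So \<open>X\<close> joins the
    two ends of the annulus while avoiding \<open>K\<close>.\<close>
  define X where "X = (D \<union> CS) \<union> (E \<union> CU)"
  have cX: "connected X" unfolding X_def using CS(2) CU(2) by (intro connected_Un[OF conD conE]) blast
  have XK: "X \<subseteq> Ann - K"
  proof -
    have "K \<inter> D = {}" "K \<inter> E = {}" unfolding K_def using S_props(2,3) U_props(2,3) Sp(4) Up(4) by blast+
    moreover have "K \<inter> CS = {}" "K \<inter> CU = {}" unfolding K_def
      using \<open>CS \<subseteq> Sm\<close> \<open>CU \<subseteq> Um\<close> cross Sp(3) Up(3) by blast+
    moreover have "X \<subseteq> Ann" unfolding X_def using subsets(1,2) CS(4) CU(4) S_props(1) U_props(1) by blast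
    ultimately show ?thesis unfolding X_def by blast
  qed
  have "openin (top_of_set Ann) (Ann - K)"
    using \<open>closed K\<close> by (metis Diff_eq openin_open_Int open_Compl)
  moreover have "half s h \<subseteq> X" "s \<noteq> 0" using hE s unfolding X_def by auto
  ultimately obtain V0 where V0: "open V0" "connected V0" "cov -` X \<subseteq> V0" "V0 \<subseteq> cov -` (Ann - K)"
    using connected_cov_vimage_between[OF _ cX XK] by blast
  have halfX: "half 1 h \<subseteq> X" "half (-1) h \<subseteq> X" using hD hE s unfolding X_def by auto
  have "(0,h) \<in> V0"
  proof -
    have "cov (0,h) \<in> half 1 h" by (simp add: half_def)
    then show ?thesis using halfX V0(3) by blast
  qed
  moreover have "(0,-h) \<in> V0"
  proof -
    have "cov (0,-h) \<in> half (-1) h" by (simp add: half_def)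
    then show ?thesis using halfX V0(3) by blast
  qed
  ultimately obtain c where c: "path c" "path_image c \<subseteq> V0" "pathstart c = (0,-h)" "pathfinish c = (0,h)"
    using open_connected_subset_path[OF V0(1,2) order_refl] by blast
  have "bounded (fst ` path_image c)"
    using c(1) by (intro compact_imp_bounded compact_continuous_image continuous_intros compact_path_image)
  then obtain b where b: "\<forall>x\<in>fst ` path_image c. \<bar>x\<bar> \<le> b" by (auto simp: bounded_iff)
  then have b0: "b \<ge> 0" using c(3) pathstart_in_path_image[of c] by fastforce
  \<comment> \<open>The horizontal path found below is confined to heights less than
    \<open>h+1\<close> in absolute value, so the barrier is prolonged vertically to
    \<open>h+2\<close> on either side.\<close>
  define Z2 where "Z2 = path_image c \<union> closed_segment (0,-h-2) (0,-h) \<union> closed_segment (0,h) (0,h+2)"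
  have seg: "fst w = 0 \<and> (snd w \<le> -h \<or> h \<le> snd w)" if wseg: "w \<in> closed_segment (0,-h-2) (0,-h) \<union> closed_segment (0,h) (0,h+2)" for w :: "real \<times> real"
  proof -
    consider u where "w = (1-u) *\<^sub>R (0,-h-2) + u *\<^sub>R (0,-h)" "0 \<le> u" "u \<le> 1"
      | u where "w = (1-u) *\<^sub>R (0,h) + u *\<^sub>R (0,h+2)" "0 \<le> u" "u \<le> 1"
      using wseg unfolding closed_segment_def by blast
    then show ?thesis by cases (auto simp: algebra_simps)
  qed
  have Z2: "compact Z2" "connected Z2"
  proof -
    show "compact Z2" unfolding Z2_def using c(1) by (simp add: compact_Un compact_path_image compact_segment)
    have "(0,-h) \<in> path_image c" "(0,h) \<in> path_image c" using c by (metis pathstart_in_path_image, metis pathfinish_in_path_image)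
    then show "connected Z2" unfolding Z2_def using c(1)
      by (intro connected_Un connected_path_image connected_segment) auto
  qed
  show ?thesis
    unfolding narrow_def
  \<comment> \<open>The abscissas of the barrier lie within \<open>b\<close>. A wider set than
    \<open>2*b+4\<close>, moved by a suitable integer, sticks out by at least one on both sides,
    even after rounding the translation.\<close>
  proof (intro exI[of _ "2*b+4"] allI impI ballI, rule ccontr)
    fix C p q assume C: "connected C" "C \<subseteq> cov -` (Sp \<union> Up)" "p \<in> C" "q \<in> C" and "\<not> fst q - fst p \<le> 2*b+4"
    then have lt: "fst q - fst p > 2*b+4" by simp
    define k where "k = \<lceil>fst p + b + 1\<rceil>"
    have k: "fst p - of_int k \<le> -b-1" "fst q - of_int k \<ge> b+1" using lt unfolding k_def by linarith+
    define t where "t = (\<lambda>w::real\<times>real. w + (of_int (-k), 0))"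
    have ct: "cov (t w) = cov w" for w unfolding t_def by (rule cov_shift)
    have "connected (t ` C)" unfolding t_def by (intro connected_continuous_image C continuous_intros)
    define X' where "X' = {w::real\<times>real. \<bar>snd w\<bar> < h+1} - Z2"
    have "open X'" unfolding X'_def
      using Z2(1) by (intro open_Diff open_Collect_less continuous_intros compact_imp_closed)
    moreover have "t ` C \<subseteq> X'"
    proof
      fix w assume "w \<in> t ` C"
      then have cw: "cov w \<in> K" using C(2) ct unfolding K_def by force
      then have sw: "\<bar>snd w\<bar> < h" unfolding K_def using S_props(4)[of "cov w"] U_props(4)[of "cov w"] Sp(4) Up(4) by auto
      have "w \<notin> path_image c" using cw c(2) V0(4) by blast
      then have "w \<notin> Z2" unfolding Z2_def using seg[of w] sw by auto
      then show "w \<in> X'" using sw unfolding X'_def by auto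
    qed
    ultimately obtain r where r: "path r" "path_image r \<subseteq> X'" "pathstart r = t p" "pathfinish r = t q"
      using open_connected_subset_path[OF _ \<open>connected (t ` C)\<close>] C(3,4) by blast
    have "path_image r \<inter> Z2 \<noteq> {}"
    proof (rule crossing_continua[where K=b and H="h+1"])
      show "\<bar>fst z\<bar> \<le> b" if "z \<in> Z2" for z using that b b0 seg[of z] unfolding Z2_def by auto
      show "\<bar>snd z\<bar> \<le> h+1" if "z \<in> path_image r" for z using that r(2) unfolding X'_def by auto
      show "t p \<in> path_image r" "t q \<in> path_image r" using r by (metis pathstart_in_path_image, metis pathfinish_in_path_image)
      show "fst (t p) \<le> -b-1" "fst (t q) \<ge> b+1" using k unfolding t_def by auto
      show "(0,-h-2) \<in> Z2" "(0,h+2) \<in> Z2" unfolding Z2_def by auto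
    qed (use r Z2 in \<open>auto simp: compact_path_image connected_path_image\<close>)
    then show False using r(2) unfolding X'_def by blast
  qed
qed

text \<open>The width bound makes the lifted component through \<open>x\<close> bounded, hence
  compact, as boundary bumping in the plane requires.\<close>

lemma S_tails:
  assumes Sp: "closed Sp" "closed Sm" "Sp \<inter> Sm = {}" "Sp \<union> Sm = S"
    and M: "narrow M Sp"
    and x: "cov x \<in> Sp"
  shows "\<exists>C. compact C \<and> connected C \<and> x \<in> C \<and> C \<subseteq> cov -` Sp \<and> (\<exists>a\<in>C. cov a \<in> gm) \<and> (\<forall>w\<in>C. \<bar>fst w - fst x\<bar> \<le> M)"
proof -
  define C where "C = connected_component_set (cov -` S) x"
  have xS: "x \<in> cov -` S" using x Sp by blast
  then have C: "C \<in> components (cov -` S)" "x \<in> C" "connected C" "C \<subseteq> cov -` S"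
    unfolding C_def by (auto simp: components_def connected_component_refl connected_component_subset)
  have CSp: "C \<subseteq> cov -` Sp"
  proof (rule connected_subset_closed_disjoint[OF C(3), of _ "cov -` Sm"])
    show "closed (cov -` Sp)" "closed (cov -` Sm)" using Sp closed_cov_vimage by blast+
    show "C \<subseteq> cov -` Sp \<union> cov -` Sm" "cov -` Sp \<inter> cov -` Sm = {}" "C \<inter> cov -` Sp \<noteq> {}"
      using C Sp x by blast+
  qed
  have bd: "\<bar>fst w - fst x\<bar> \<le> M" if "w \<in> C" for w
  proof -
    have "fst x - fst w \<le> M" "fst w - fst x \<le> M"
      using M C(2,3) CSp that unfolding narrow_def by blast+
    then show ?thesis by linarith
  qed
  have "compact C"
  proof -
    have "closed (cov -` S)" using S_compact compact_imp_closed closed_cov_vimage by blast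
    then have "closed C" using C(1) closed_components by blast
    moreover have "bounded C"
    proof (rule bounded_subset)
      show "C \<subseteq> cbox (fst x - M, -h) (fst x + M, h)"
      proof
        fix w assume w: "w \<in> C"
        then have "\<bar>snd w\<bar> < h" using C(4) S_props(4)[of "cov w"] by auto
        then show "w \<in> cbox (fst x - M, -h) (fst x + M, h)" using bd[OF w]
          by (cases w) (auto simp: cbox_Pair_eq abs_le_iff)
      qed
    qed (rule bounded_cbox)
    ultimately show ?thesis by (simp add: compact_eq_bounded_closed)
  qed
  moreover have "C \<inter> cov -` gm \<noteq> {}" by (rule S_lift_component_meets[OF C(1) \<open>compact C\<close>])
  ultimately show ?thesis using C(2,3) CSp bd by (intro exI[of _ C]) blast
qed

text \<open>Top pieces lie over \<open>X\<close> and the preimage of \<open>E\<close>, bottom pieces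
  over \<open>Y\<close> and the image of \<open>D\<close>. Both ends have been enlarged by one
  iterate, so the drift separates them only from \<open>N = 2\<close> on: \<open>f x\<close> is in
  \<open>E\<close>, while the last point before the image would have to be in
  \<open>D\<close>.\<close>

lemma images_disjoint:
  assumes N: "N \<ge> 2" and X: "X \<subseteq> U" and Y: "Y \<subseteq> S"
    and XY: "\<And>z. z \<in> X \<Longrightarrow> z \<in> S \<Longrightarrow> (f ^^ N) z \<notin> Y"
    and x: "x \<in> X \<union> g ` E"
  shows "(f ^^ N) x \<notin> Y \<union> f ` D"
proof
  assume fx: "(f ^^ N) x \<in> Y \<union> f ` D"
  obtain m where m: "N = Suc (Suc m)" using N by (metis add_2_eq_Suc le_Suc_ex)
  interpret p: annulus_lift "f ^^ Suc m" "g ^^ Suc m" "F ^^ Suc m" "Fi ^^ Suc m" by (rule pow)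
  have xA: "x \<in> Ann" using x X subsets(2) gAnn unfolding U_def by blast
  have fD: "(f ^^ Suc m) x \<in> D" if fxD: "(f ^^ N) x \<in> f ` D"
  proof -
    obtain d where d: "d \<in> D" "(f ^^ N) x = f d" using fxD by blast
    then have "f ((f ^^ Suc m) x) = f d" unfolding m by simp
    then have "(f ^^ Suc m) x = d" using gf p.fAnn xA d subsets(1) by (metis subsetD)
    then show ?thesis using d by simp
  qed
  consider "x \<in> X" "(f ^^ N) x \<in> Y" | "x \<in> X" "(f ^^ N) x \<in> f ` D" | "x \<in> g ` E" "(f ^^ N) x \<in> Y" | "x \<in> g ` E" "(f ^^ N) x \<in> f ` D"
    using x fx by blast
  then show False
  proof cases
    case 1
    have fS: "(f ^^ N) x \<in> S" using 1 Y by blast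
    \<comment> \<open>\<open>E\<close> is absorbing and the orbit is in \<open>S\<close> at time
      \<open>N\<close>, so it cannot have entered \<open>E\<close> earlier.\<close>
    have "(f ^^ n) x \<notin> E" for n
    proof (cases "n \<le> N")
      case True
      then have "(f ^^ N) x = (f ^^ (N-n)) ((f ^^ n) x)" by (metis add.commute comp_apply funpow_add le_add_diff_inverse)
      then show ?thesis using fpowE[of "(f ^^ n) x" "N-n"] fS S_props(3) by (metis IntI empty_iff)
    next
      case False
      then have "(f ^^ n) x = (f ^^ (n-N)) ((f ^^ N) x)" by (metis add.commute comp_apply funpow_add le_add_diff_inverse nat_le_linear)
      then show ?thesis using fpow_S[OF fS, of "n-N"] S_props(3) by (metis IntI empty_iff)
    qed
    moreover have "x \<notin> D"
    proof -
      have "(g ^^ 0) x \<notin> D" using 1 X unfolding U_def by blast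
      then show ?thesis by simp
    qed
    ultimately have "x \<in> S" using xA unfolding S_def by blast
    then show False using XY 1 by blast
  next
    case 2
    have "(g ^^ 0) x \<notin> D" using 2 X unfolding U_def by blast
    then show False using fD[OF 2(2)] fpowD[OF xA, of "Suc m"] by simp
  next
    case 3
    then have "f x \<in> E" using fg subsets(2) by (metis imageE subsetD)
    then have "(f ^^ Suc m) (f x) \<in> E" by (rule fpowE)
    then have "(f ^^ N) x \<in> E" unfolding m by (simp add: funpow_swap1)
    then show False using 3 Y S_props(3) by blast
  next
    case 4
    then have "f x \<in> E" using fg subsets(2) by (metis imageE subsetD)
    then have "(f ^^ m) (f x) \<in> E" by (rule fpowE)
    then have "(f ^^ Suc m) x \<in> E" by (simp add: funpow_swap1)
    then show False using fD[OF 4(2)] disj by blast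
  qed
qed

end


section \<open>The two crossing continua\<close>

context drift begin

text \<open>\<open>rot\<close> says that lifts of \<open>P\<close> overtake lifts of
  \<open>Q\<close> by any prescribed distance, uniformly in the points. Both continua are assembled
  in the plane before iteration: \<open>Z2\<close> passes through \<open>x\<close> and is made tall,
  \<open>Z1\<close> passes through \<open>y\<close> and is made wide, and their lower parts are
  built at the images and pulled back by \<open>Gi\<close>.\<close>

lemma no_opposite_rotation:
  assumes s1: "s = 1"
    and PQ: "closed P" "closed Q" "P \<inter> Q = {}" "P \<union> Q = S \<inter> U"
    and inv: "f ` P \<subseteq> P" "f ` Q \<subseteq> Q" "g ` P \<subseteq> P" "g ` Q \<subseteq> Q"
    and ne: "P \<noteq> {}" "Q \<noteq> {}"
    and rot: "\<And>b. \<exists>N\<ge>2. \<forall>x y. cov x \<in> P \<longrightarrow> cov y \<in> Q \<longrightarrow>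
        fst ((F ^^ N) x) - fst x - (fst ((F ^^ N) y) - fst y) \<ge> b"
  shows False
proof -
  interpret du: drift g f Fi F E gp W D gm V "-s" h by (rule drift_dual)
  obtain Sp Sm where Sp: "closed Sp" "closed Sm" "Sp \<inter> Sm = {}" "Sp \<union> Sm = S" "P \<subseteq> Sp" "Q \<subseteq> Sm"
    using S_split[OF PQ inv(1,2)] by blast
  have PQ': "P \<union> Q = drift.S g E D \<inter> drift.U f E D" unfolding U_dual U_S_dual using PQ(4) by blast
  obtain Up Um where Up: "closed Up" "closed Um" "Up \<inter> Um = {}" "Up \<union> Um = U" "P \<subseteq> Up" "Q \<subseteq> Um"
    using du.S_split[OF PQ(1-3) PQ' inv(3,4)] unfolding U_dual by blast
  \<comment> \<open>A point of \<open>Sp\<close> and \<open>Um\<close> is in the maximal invariant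
    set, but neither in \<open>P\<close>, which avoids \<open>Um\<close>, nor in \<open>Q\<close>,
    which avoids \<open>Sp\<close>.\<close>
  have cross: "Sp \<inter> Um = {}" "Sm \<inter> Up = {}"
  proof -
    have "x \<notin> Um" if "x \<in> Sp" for x
    proof
      assume "x \<in> Um"
      then have "x \<in> P \<union> Q" using PQ(4) Sp(4) Up(4) that by blast
      then show False using that \<open>x \<in> Um\<close> Sp Up by blast
    qed
    then show "Sp \<inter> Um = {}" by blast
    have "x \<notin> Up" if "x \<in> Sm" for x
    proof
      assume "x \<in> Up"
      then have "x \<in> P \<union> Q" using PQ(4) Sp(4) Up(4) that by blast
      then show False using that \<open>x \<in> Up\<close> Sp Up by blast
    qed
    then show "Sm \<inter> Up = {}" by blast
  qed
  obtain xd yd where xyd: "xd \<in> P" "yd \<in> Q" using ne by blast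
  have PQA: "P \<subseteq> Ann" "Q \<subseteq> Ann" using PQ(4) S_props(1) by blast+
  obtain M1 where M1: "narrow M1 (Sp \<union> Up)"
    using width_bound[OF Sp(1-4) Up(1-4) _ _ cross, of yd] xyd(2) Sp(6) Up(6) by blast
  have comm: "Sm \<inter> Sp = {}" "Sm \<union> Sp = S" "Um \<inter> Up = {}" "Um \<union> Up = U" using Sp Up by blast+
  obtain M2 where M2: "narrow M2 (Sm \<union> Um)"
    using width_bound[OF Sp(2,1) comm(1,2) Up(2,1) comm(3,4) _ _ cross(2,1), of xd] xyd(1) Sp(5) Up(5) by blast
  have "\<exists>M3. \<forall>p. cov p \<in> gm \<longrightarrow> (\<exists>K. compact K \<and> connected K \<and> p \<in> K \<and> K \<subseteq> cov -` (f ` D) \<and>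
      (\<exists>q\<in>K. snd q = -h) \<and> (\<forall>w\<in>K. \<bar>fst w - fst p\<bar> \<le> M3))"
    using gm_tails unfolding s1 by simp
  then obtain M3 where M3': "\<forall>p. cov p \<in> gm \<longrightarrow> (\<exists>K. compact K \<and> connected K \<and> p \<in> K \<and> K \<subseteq> cov -` (f ` D) \<and>
      (\<exists>q\<in>K. snd q = -h) \<and> (\<forall>w\<in>K. \<bar>fst w - fst p\<bar> \<le> M3))" ..
  note M3 = M3'[THEN spec, THEN mp]
  have "\<exists>M4. \<forall>p. cov p \<in> gp \<longrightarrow> (\<exists>K. compact K \<and> connected K \<and> p \<in> K \<and> K \<subseteq> cov -` (g ` E) \<and>
      (\<exists>q\<in>K. snd q = h) \<and> (\<forall>w\<in>K. \<bar>fst w - fst p\<bar> \<le> M4))"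
    using du.gm_tails unfolding s1 by simp
  then obtain M4 where M4': "\<forall>p. cov p \<in> gp \<longrightarrow> (\<exists>K. compact K \<and> connected K \<and> p \<in> K \<and> K \<subseteq> cov -` (g ` E) \<and>
      (\<exists>q\<in>K. snd q = h) \<and> (\<forall>w\<in>K. \<bar>fst w - fst p\<bar> \<le> M4))" ..
  note M4 = M4'[THEN spec, THEN mp]
  define M where "M = max 1 (max (max M1 M2) (max M3 M4))"
  have M: "M1 \<le> M" "M2 \<le> M" "M3 \<le> M" "M4 \<le> M" "M \<ge> 1" unfolding M_def by auto

  have lower: "\<exists>A q. compact A \<and> connected A \<and> x \<in> A \<and> A \<subseteq> cov -` (Z \<union> f ` D) \<and> q \<in> A \<and> snd q = -h \<and>
      (\<forall>w\<in>A. \<bar>fst w - fst x\<bar> \<le> 2*M)"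
    if Z: "closed Z" "closed Z'" "Z \<inter> Z' = {}" "Z \<union> Z' = S"
      and b: "narrow M Z"
      and x: "cov x \<in> Z" for x Z Z'
  proof -
    obtain C a where C: "compact C" "connected C" "x \<in> C" "C \<subseteq> cov -` Z" "a \<in> C" "cov a \<in> gm" "\<forall>w\<in>C. \<bar>fst w - fst x\<bar> \<le> M"
      using S_tails[OF Z b x] by (elim exE conjE bexE) (rule that; assumption)
    obtain K q where K: "compact K" "connected K" "a \<in> K" "K \<subseteq> cov -` (f ` D)" "q \<in> K" "snd q = -h" "\<forall>w\<in>K. \<bar>fst w - fst a\<bar> \<le> M3"
      using M3[OF C(6)] by (elim exE conjE bexE) (rule that; assumption)
    have "connected (C \<union> K)" using C K by (intro connected_Un) blast+
    moreover have "\<bar>fst w - fst x\<bar> \<le> 2*M" if wCK: "w \<in> C \<union> K" for w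
    proof -
      consider "w \<in> C" | "w \<in> K" using wCK by blast
      then show ?thesis
      proof cases
        case 1 then show ?thesis using bspec[OF C(7), of w] M by linarith
      next
        case 2 then show ?thesis using bspec[OF C(7) C(5)] bspec[OF K(7), of w] M by linarith
      qed
    qed
    ultimately show ?thesis using C K by (intro exI[of _ "C \<union> K"] exI[of _ q] conjI compact_Un) blast+
  qed
  have upper: "\<exists>A q. compact A \<and> connected A \<and> x \<in> A \<and> A \<subseteq> cov -` (Z \<union> g ` E) \<and> q \<in> A \<and> snd q = h \<and>
      (\<forall>w\<in>A. \<bar>fst w - fst x\<bar> \<le> 2*M)"
    if Z: "closed Z" "closed Z'" "Z \<inter> Z' = {}" "Z \<union> Z' = U"
      and b: "narrow M Z"
      and x: "cov x \<in> Z" for x Z Z'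
  proof -
    have Z4: "Z \<union> Z' = drift.S g E D" using Z(4) unfolding U_dual .
    obtain C a where C: "compact C" "connected C" "x \<in> C" "C \<subseteq> cov -` Z" "a \<in> C" "cov a \<in> gp" "\<forall>w\<in>C. \<bar>fst w - fst x\<bar> \<le> M"
      using du.S_tails[OF Z(1-3) Z4 b x] by (elim exE conjE bexE) (rule that; assumption)
    obtain K q where K: "compact K" "connected K" "a \<in> K" "K \<subseteq> cov -` (g ` E)" "q \<in> K" "snd q = h" "\<forall>w\<in>K. \<bar>fst w - fst a\<bar> \<le> M4"
      using M4[OF C(6)] by (elim exE conjE bexE) (rule that; assumption)
    have "connected (C \<union> K)" using C K by (intro connected_Un) blast+
    moreover have "\<bar>fst w - fst x\<bar> \<le> 2*M" if wCK: "w \<in> C \<union> K" for w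
    proof -
      consider "w \<in> C" | "w \<in> K" using wCK by blast
      then show ?thesis
      proof cases
        case 1 then show ?thesis using bspec[OF C(7), of w] M by linarith
      next
        case 2 then show ?thesis using bspec[OF C(7) C(5)] bspec[OF K(7), of w] M by linarith
      qed
    qed
    ultimately show ?thesis using C K by (intro exI[of _ "C \<union> K"] exI[of _ q] conjI compact_Un) blast+
  qed
  \<comment> \<open>A continuum through a base point extends at most \<open>M\<close> along a
    component and another \<open>M\<close> along its tail, so base points at distance
    \<open>2*R = 4*M+2\<close> have disjoint continua.\<close>
  define R where "R = 2*M + 1"
  obtain x where x: "cov x = xd" using cov_surj xyd PQA by blast
  obtain y0 where y0: "cov y0 = yd" using cov_surj xyd PQA by blast
  define k where "k = \<lceil>fst x + 2*R - fst y0\<rceil>"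
  define y where "y = y0 + (of_int k, 0)"
  have y: "cov y = yd" unfolding y_def using y0 by (simp only: cov_shift)
  have xy: "fst y - fst x \<ge> 2*R" "fst y - fst x \<le> 2*R + 1"
    unfolding y_def k_def fst_add fst_conv by linarith+
  \<comment> \<open>\<open>4*R+1\<close> makes up for the initial lead of \<open>y\<close>, which is
    at most \<open>2*R+1\<close>, and leaves the image of \<open>x\<close> ahead by
    \<open>2*R\<close>.\<close>
  obtain N where N: "N \<ge> 2" and rN: "\<forall>x y. cov x \<in> P \<longrightarrow> cov y \<in> Q \<longrightarrow>
        fst ((F ^^ N) x) - fst x - (fst ((F ^^ N) y) - fst y) \<ge> 4*R+1" using rot by blast
  interpret p: annulus_lift "f ^^ N" "g ^^ N" "F ^^ N" "Fi ^^ N" by (rule pow)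
  interpret q: annulus_lift "g ^^ N" "f ^^ N" "Fi ^^ N" "F ^^ N" by (rule p.dual)
  define G where "G = F ^^ N"
  define Gi where "Gi = Fi ^^ N"
  have GGi: "G (Gi w) = w" "Gi (G w) = w" for w unfolding G_def Gi_def by (rule p.FFi, rule p.FiF)
  have covG: "cov (G w) = (f ^^ N) (cov w)" for w unfolding G_def by (rule p.covF)
  have contGi: "continuous_on A Gi" for A unfolding Gi_def by (rule continuous_on_subset[OF p.contFi]) simp
  have shiftGi: "Gi (w + (of_int k, 0)) = Gi w + (of_int k, 0)" for w k unfolding Gi_def by (rule q.shift)
  have far: "fst (G x) - fst (G y) \<ge> 2*R" using rN xyd x y xy unfolding G_def by fastforce
  have fP: "(f ^^ n) z \<in> P" if "z \<in> P" for z n using that inv(1) by (induction n) auto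
  have fQ: "(f ^^ n) z \<in> Q" if "z \<in> Q" for z n using that inv(2) by (induction n) auto
  have Gx: "cov (G x) \<in> Sp" and Gy: "cov (G y) \<in> Sm"
    unfolding covG x y using fP fQ xyd Sp(5,6) by blast+
  have b1: "narrow M Sp" and b3: "narrow M Up" by (rule narrow_mono[OF M1 M(1)], blast)+
  have b2: "narrow M Sm" and b4: "narrow M Um" by (rule narrow_mono[OF M2 M(2)], blast)+
  obtain Ax qx where Ax: "compact Ax" "connected Ax" "G x \<in> Ax" "Ax \<subseteq> cov -` (Sp \<union> f ` D)" "qx \<in> Ax" "snd qx = -h"
      "\<forall>w\<in>Ax. \<bar>fst w - fst (G x)\<bar> \<le> 2*M"
    using lower[OF Sp(1-4) b1 Gx] by (elim exE conjE bexE) (rule that; assumption)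
  obtain Ay qy where Ay: "compact Ay" "connected Ay" "G y \<in> Ay" "Ay \<subseteq> cov -` (Sm \<union> f ` D)" "qy \<in> Ay" "snd qy = -h"
      "\<forall>w\<in>Ay. \<bar>fst w - fst (G y)\<bar> \<le> 2*M"
    using lower[OF Sp(2,1) comm(1,2) b2 Gy] by (elim exE conjE bexE) (rule that; assumption)
  have "cov x \<in> Up" "cov y \<in> Um" unfolding x y using xyd Up(5,6) by blast+
  obtain Bx rx where Bx: "compact Bx" "connected Bx" "x \<in> Bx" "Bx \<subseteq> cov -` (Up \<union> g ` E)" "rx \<in> Bx" "snd rx = h"
      "\<forall>w\<in>Bx. \<bar>fst w - fst x\<bar> \<le> 2*M"
    using upper[OF Up(1-4) b3 \<open>cov x \<in> Up\<close>] by (elim exE conjE bexE) (rule that; assumption)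
  obtain By ry where By: "compact By" "connected By" "y \<in> By" "By \<subseteq> cov -` (Um \<union> g ` E)" "ry \<in> By" "snd ry = h"
      "\<forall>w\<in>By. \<bar>fst w - fst y\<bar> \<le> 2*M"
    using upper[OF Up(2,1) comm(3,4) b4 \<open>cov y \<in> Um\<close>] by (elim exE conjE bexE) (rule that; assumption)

  have DfD: "D \<subseteq> f ` D"
  proof
    fix z assume "z \<in> D"
    then show "z \<in> f ` D" using gD fg[of z] subsets(1) by (metis UnI1 image_eqI image_subset_iff subsetD)
  qed
  have EgE: "E \<subseteq> g ` E"
  proof
    fix z assume "z \<in> E"
    then show "z \<in> g ` E" using fE gf[of z] subsets(2) by (metis UnI1 image_eqI image_subset_iff subsetD)
  qed
  have low: "cov w \<in> f ` D" if "snd w \<le> -h" for w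
  proof -
    have "cov w \<in> half (-s) h" using that unfolding half_def s1 by simp
    then show ?thesis using hD DfD by blast
  qed
  have high: "cov w \<in> g ` E" if "snd w \<ge> h" for w
  proof -
    have "cov w \<in> half s h" using that unfolding half_def s1 by simp
    then show ?thesis using hE EgE by blast
  qed

  \<comment> \<open>The lengths of the horizontal arms are fixed only once \<open>K\<close> is
    known, and \<open>K\<close> depends on \<open>H\<close>. So \<open>H\<close> must bound the
    preimage of the entire line at height \<open>-h\<close>, which periodicity reduces to one
    period.\<close>
  obtain H where H: "H \<ge> h" "\<And>w. w \<in> Gi ` Ay \<union> By \<Longrightarrow> \<bar>snd w\<bar> \<le> H" "\<And>t. \<bar>snd (Gi (t, -h))\<bar> \<le> H"
  proof -
    define T where "T = snd ` (Gi ` Ay \<union> By \<union> Gi ` ({0..1} \<times> {-h}))"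
    have "compact T" unfolding T_def
      using Ay By by (intro compact_continuous_image continuous_intros compact_Un contGi compact_Times) auto
    then obtain H0 where H0: "\<forall>u\<in>T. \<bar>u\<bar> \<le> H0" by (auto simp: bounded_iff dest!: compact_imp_bounded)
    define H where "H = max h H0"
    have "\<bar>snd w\<bar> \<le> H" if "w \<in> Gi ` Ay \<union> By" for w
    proof -
      have "snd w \<in> T" unfolding T_def using that by blast
      then show ?thesis using H0 unfolding H_def by fastforce
    qed
    moreover have "\<bar>snd (Gi (t, -h))\<bar> \<le> H" for t
    proof -
      have fr: "(frac t, -h) \<in> {0..1} \<times> {-h}" by (auto simp: frac_ge_0 frac_lt_1 less_imp_le)
      have "snd (Gi (frac t, -h)) \<in> T" unfolding T_def by (intro imageI UnI2 fr)
      moreover have "(t, -h) = (frac t, -h) + (of_int \<lfloor>t\<rfloor>, 0)" by (simp add: frac_def)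
      then have "snd (Gi (t, -h)) = snd (Gi (frac t, -h))" by (simp only: shiftGi snd_add snd_conv)
      ultimately show ?thesis using H0 unfolding H_def by fastforce
    qed
    moreover have "H \<ge> h" unfolding H_def by simp
    ultimately show ?thesis using that by blast
  qed
  \<comment> \<open>The \<open>N\<close>-th iterate is bounded on compact sets, so a point far
    enough down has its preimage at a height beyond \<open>H+1\<close> in absolute value; backward
    invariance of \<open>D\<close> rules out the upper end.\<close>
  obtain t0 where t0: "t0 \<ge> h" "snd (Gi (fst qx, -t0)) \<le> -H-1"
  proof -
    define K where "K = {z \<in> Ann. \<bar>snd z\<bar> \<le> H + 1}"
    have "closed K"
    proof -
      have "K = Ann \<inter> {z. \<bar>snd z\<bar> \<le> H + 1}" unfolding K_def by blast
      then show ?thesis using closed_Ann by (auto intro!: closed_Int closed_Collect_le continuous_intros)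
    qed
    moreover have "bounded K" by (rule bounded_Ann[of _ "H+1"]) (auto simp: K_def)
    ultimately have "compact K" by (simp add: compact_eq_bounded_closed)
    then have "compact (snd ` (f ^^ N) ` K)"
      by (intro compact_continuous_image continuous_intros continuous_on_subset[OF p.contf]) (auto simp: K_def)
    then obtain b where b: "\<forall>u\<in>snd ` (f ^^ N) ` K. \<bar>u\<bar> \<le> b" by (auto simp: bounded_iff dest!: compact_imp_bounded)
    define t0 where "t0 = max (b+1) h"
    define w where "w = Gi (fst qx, -t0)"
    have Gw: "G w = (fst qx, -t0)" unfolding w_def by (rule GGi)
    have "cov w \<notin> K"
    proof
      assume "cov w \<in> K"
      then have "\<bar>snd ((f ^^ N) (cov w))\<bar> \<le> b" using b by blast
      then have "\<bar>snd (cov (G w))\<bar> \<le> b" unfolding covG .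
      then show False unfolding Gw t0_def by auto
    qed
    then have big: "\<bar>snd w\<bar> > H + 1" unfolding K_def by auto
    have "cov (fst qx, -t0) \<in> half (-s) h" unfolding half_def s1 t0_def by auto
    then have "(g ^^ N) (cov (fst qx, -t0)) \<in> D" using hD gpowD by blast
    then have "cov w \<in> D" unfolding w_def Gi_def by (simp only: q.covF)
    then have "cov w \<notin> half s h" using hE disj by blast
    then have "snd w < h" unfolding half_def s1 by auto
    then have "snd w \<le> -H-1" using big H(1) by linarith
    moreover have "t0 \<ge> h" unfolding t0_def by simp
    ultimately show ?thesis using that unfolding w_def by blast
  qed
  \<comment> \<open>Straight arms prolong the four pieces: vertical ones make \<open>Z2\<close>
    taller than \<open>Z1\<close>, horizontal ones make \<open>Z1\<close> wider than
    \<open>Z2\<close>. Each horizontal arm points away from the other continuum: to the left at the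
    bottom, where the image of \<open>y\<close> is on the left, and to the right at the top. The
    bottom arms are drawn before \<open>Gi\<close> is applied.\<close>
  define down where "down = {fst qx} \<times> {-t0..-h}"
  define up where "up = {fst rx} \<times> {h..H+1}"
  define A2 where "A2 = Ax \<union> down"
  define B2 where "B2 = Bx \<union> up"
  have qd: "qx \<in> down" "rx \<in> up" unfolding down_def up_def using Ax(6) Bx(6) t0 H h by (auto simp: mem_Times_iff)
  have A2: "compact A2" "connected A2" unfolding A2_def using Ax qd
    by (auto intro!: compact_Un connected_Un compact_Times connected_Times simp: down_def)
  have B2: "compact B2" "connected B2" unfolding B2_def using Bx qd
    by (auto intro!: compact_Un connected_Un compact_Times connected_Times simp: up_def)
  define Z2 where "Z2 = Gi ` A2 \<union> B2"
  have Z2: "compact Z2" "connected Z2"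
  proof -
    show "compact Z2" unfolding Z2_def by (intro compact_Un compact_continuous_image contGi A2 B2)
    have "x \<in> Gi ` A2" unfolding A2_def using Ax(3) GGi(2)[of x] by (metis UnI1 image_eqI)
    moreover have "x \<in> B2" unfolding B2_def using Bx by blast
    ultimately show "connected Z2" unfolding Z2_def
      by (intro connected_Un connected_continuous_image contGi A2 B2) blast
  qed
  obtain K where K: "\<And>w. w \<in> Z2 \<Longrightarrow> \<bar>fst w\<bar> \<le> K"
  proof -
    have "compact (fst ` Z2)" by (intro compact_continuous_image continuous_intros Z2)
    then have "\<exists>K. \<forall>u\<in>fst ` Z2. \<bar>u\<bar> \<le> K" by (auto simp: bounded_iff dest!: compact_imp_bounded)
    then show ?thesis using that by blast
  qed
  define kl where "kl = \<lceil>\<bar>fst (Gi qy)\<bar> + \<bar>K\<bar> + 1\<rceil>"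
  have kl: "fst (Gi qy) - of_int kl \<le> -K-1" "of_int kl \<ge> (0::real)" unfolding kl_def by linarith+
  define left where "left = {fst qy - of_int kl..fst qy} \<times> {-h}"
  define right where "right = {fst ry..fst ry + \<bar>fst ry\<bar> + \<bar>K\<bar> + 1} \<times> {h}"
  define A1 where "A1 = Ay \<union> left"
  define B1 where "B1 = By \<union> right"
  have ql: "qy \<in> left" "ry \<in> right" unfolding left_def right_def using Ay(6) By(6) kl by (auto simp: mem_Times_iff)
  have A1: "compact A1" "connected A1" unfolding A1_def using Ay ql
    by (auto intro!: compact_Un connected_Un compact_Times connected_Times simp: left_def)
  have B1: "compact B1" "connected B1" unfolding B1_def using By ql
    by (auto intro!: compact_Un connected_Un compact_Times connected_Times simp: right_def)
  define Z1 where "Z1 = Gi ` A1 \<union> B1"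
  have Z1: "compact Z1" "connected Z1"
  proof -
    show "compact Z1" unfolding Z1_def by (intro compact_Un compact_continuous_image contGi A1 B1)
    have "y \<in> Gi ` A1" unfolding A1_def using Ay(3) GGi(2)[of y] by (metis UnI1 image_eqI)
    moreover have "y \<in> B1" unfolding B1_def using By by blast
    ultimately show "connected Z1" unfolding Z1_def
      by (intro connected_Un connected_continuous_image contGi A1 B1) blast
  qed
  have covA1: "cov w \<in> Sm \<union> f ` D" if "w \<in> A1" for w
    using that Ay(4) low[of w] unfolding A1_def left_def by (auto simp: mem_Times_iff)
  have covA2: "cov w \<in> Sp \<union> f ` D" if "w \<in> A2" for w
    using that Ax(4) low[of w] unfolding A2_def down_def by (auto simp: mem_Times_iff)
  have covB1: "cov w \<in> Um \<union> g ` E" if "w \<in> B1" for w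
    using that By(4) high[of w] unfolding B1_def right_def by (auto simp: mem_Times_iff)
  have covB2: "cov w \<in> Up \<union> g ` E" if "w \<in> B2" for w
    using that Bx(4) high[of w] unfolding B2_def up_def by (auto simp: mem_Times_iff)
  have fstA1: "fst w \<le> fst (G y) + 2*M" if "w \<in> A1" for w
    using that bspec[OF Ay(7), of w] bspec[OF Ay(7) Ay(5)] unfolding A1_def left_def by (auto simp: mem_Times_iff)
  have fstA2: "fst w \<ge> fst (G x) - 2*M" if "w \<in> A2" for w
    using that bspec[OF Ax(7), of w] bspec[OF Ax(7) Ax(5)] unfolding A2_def down_def by (auto simp: mem_Times_iff)
  have fstB1: "fst w \<ge> fst y - 2*M" if "w \<in> B1" for w
    using that bspec[OF By(7), of w] bspec[OF By(7) By(5)] unfolding B1_def right_def by (auto simp: mem_Times_iff)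
  have fstB2: "fst w \<le> fst x + 2*M" if "w \<in> B2" for w
    using that bspec[OF Bx(7), of w] bspec[OF Bx(7) Bx(5)] unfolding B2_def up_def by (auto simp: mem_Times_iff)
  have sub: "Um \<subseteq> U" "Up \<subseteq> U" "Sm \<subseteq> S" "Sp \<subseteq> S" using Sp Up by blast+
  \<comment> \<open>Such a point is in the maximal invariant set and not in \<open>P\<close>, so it
    is in \<open>Q\<close>, whose orbits stay off \<open>Sp\<close>.\<close>
  have UmSp: "(f ^^ N) z \<notin> Sp" if "z \<in> Um" "z \<in> S" for z
  proof -
    have "z \<in> Q" using that sub PQ(4) Up(3,5) by blast
    then show ?thesis using fQ[of z N] Sp(3,6) by blast
  qed
  have UpSm: "(f ^^ N) z \<notin> Sm" if "z \<in> Up" "z \<in> S" for z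
  proof -
    have "z \<in> P" using that sub PQ(4) Up(3,6) by blast
    then show ?thesis using fP[of z N] Sp(3,5) by blast
  qed
  \<comment> \<open>Two bottom pieces are compared after \<open>G\<close>, two top pieces directly,
    both by their abscissas; a top piece and a bottom piece are separated by
    \<open>images_disjoint\<close>.\<close>
  have d1: "Gi v \<noteq> Gi w" if "v \<in> A1" "w \<in> A2" for v w
  proof
    assume "Gi v = Gi w"
    then have "fst v = fst w" using GGi(1) by metis
    moreover have "fst (G x) - fst (G y) \<ge> 4*M + 2" using far unfolding R_def by simp
    ultimately show False using fstA1[OF that(1)] fstA2[OF that(2)] by linarith
  qed
  have d2: "v \<noteq> w" if "v \<in> B1" "w \<in> B2" for v w
    using fstB1[OF that(1)] fstB2[OF that(2)] xy unfolding R_def by auto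
  have d3: "Gi v \<noteq> w" if "v \<in> A1" "w \<in> B2" for v w
  proof
    assume "Gi v = w"
    then have "v = G w" using GGi(1) by metis
    then have "cov v = (f ^^ N) (cov w)" using covG by simp
    then show False using images_disjoint[OF N sub(2,3) UpSm covB2[OF that(2)]] covA1[OF that(1)] by metis
  qed
  have d4: "v \<noteq> Gi w" if "v \<in> B1" "w \<in> A2" for v w
  proof
    assume "v = Gi w"
    then have "w = G v" using GGi(1) by metis
    then have "cov w = (f ^^ N) (cov v)" using covG by simp
    then show False using images_disjoint[OF N sub(1,4) UmSp covB1[OF that(1)]] covA2[OF that(2)] by metis
  qed
  have "Z1 \<inter> Z2 = {}"
  proof (rule ccontr)
    assume "Z1 \<inter> Z2 \<noteq> {}"
    then obtain z where "z \<in> Gi ` A1 \<or> z \<in> B1" "z \<in> Gi ` A2 \<or> z \<in> B2" unfolding Z1_def Z2_def by blast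
    then show False using d1 d2 d3 d4 by (elim disjE imageE) metis+
  qed
  moreover have "Z1 \<inter> Z2 \<noteq> {}"
  proof (rule crossing_continua[OF Z1(1) Z2(1) Z1(2) Z2(2) K])
    show "\<bar>snd z\<bar> \<le> H" if z: "z \<in> Z1" for z
    proof -
      consider "z \<in> Gi ` Ay \<union> By" | "z \<in> Gi ` left" | "z \<in> right" using z unfolding Z1_def A1_def B1_def by blast
      then show ?thesis
      proof cases
        case 2
        then obtain v where v: "v \<in> left" "z = Gi v" by blast
        then have "v = (fst v, -h)" unfolding left_def by (simp add: mem_Times_iff prod_eq_iff)
        then show ?thesis using H(3)[of "fst v"] v(2) by simp
      next
        case 3
        then show ?thesis using H(1) h unfolding right_def by (auto simp: mem_Times_iff)
      qed (rule H(2))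
    qed
    define u where "u = qy + (of_int (-kl), 0)"
    have "u \<in> left" unfolding left_def u_def using Ay(6) kl by (simp add: mem_Times_iff)
    then show "Gi u \<in> Z1" unfolding Z1_def A1_def by blast
    show "fst (Gi u) \<le> -K-1" unfolding u_def shiftGi using kl by simp
    define v where "v = (fst ry + \<bar>fst ry\<bar> + \<bar>K\<bar> + 1, h)"
    have "v \<in> right" unfolding v_def right_def by simp
    then show "v \<in> Z1" unfolding Z1_def B1_def by blast
    show "fst v \<ge> K+1" unfolding v_def fst_conv by linarith
    have "(fst qx, -t0) \<in> down" unfolding down_def using t0 by simp
    then show "Gi (fst qx, -t0) \<in> Z2" unfolding Z2_def A2_def by blast
    show "snd (Gi (fst qx, -t0)) \<le> -H-1" by (rule t0)
    have "(fst rx, H+1) \<in> up" unfolding up_def using H(1) by simp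
    then show "(fst rx, H+1) \<in> Z2" unfolding Z2_def B2_def by blast
    show "snd (fst rx, H+1) \<ge> H+1" by simp
  qed
  ultimately show False by blast
qed

end

section \<open>Lifting the isotopy\<close>

text \<open>The horizontal difference is continuous and integer valued, hence constant on a
  connected set.\<close>

lemma lifts_differ_by_shift:
  fixes \<phi> \<psi> :: "'a::topological_space \<Rightarrow> real \<times> real"
  assumes "connected X" "continuous_on X \<phi>" "continuous_on X \<psi>"
    and cov: "\<And>x. x \<in> X \<Longrightarrow> cov (\<phi> x) = cov (\<psi> x)"
  shows "\<exists>k::int. \<forall>x\<in>X. \<phi> x = \<psi> x + (of_int k, 0)"
proof (cases "X = {}")
  case False
  then obtain a where a: "a \<in> X" by blast
  define d where "d = (\<lambda>x. fst (\<phi> x) - fst (\<psi> x))"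
  have ex: "\<exists>k::int. d x = of_int k \<and> snd (\<phi> x) = snd (\<psi> x)" if "x \<in> X" for x
  proof -
    have "\<exists>k::int. \<phi> x = \<psi> x + (of_int k, 0)" using cov[OF that] cov_eq_iff by metis
    then show ?thesis unfolding d_def by auto
  qed
  have "d constant_on X"
  proof (rule continuous_discrete_range_constant[OF assms(1)])
    show "continuous_on X d" unfolding d_def using assms by (intro continuous_intros)
    fix x assume x: "x \<in> X"
    show "\<exists>e>0. \<forall>y. y \<in> X \<and> d y \<noteq> d x \<longrightarrow> e \<le> norm (d y - d x)"
    proof (intro exI[of _ 1] conjI allI impI)
      fix y assume y: "y \<in> X \<and> d y \<noteq> d x"
      obtain j k :: int where jk: "d x = of_int j" "d y = of_int k" using ex x y by metis
      then have "j \<noteq> k" using y by auto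
      then have "\<bar>real_of_int k - real_of_int j\<bar> \<ge> 1" by linarith
      then show "1 \<le> norm (d y - d x)" unfolding jk by simp
    qed simp
  qed
  then obtain c where c: "\<And>x. x \<in> X \<Longrightarrow> d x = c" unfolding constant_on_def by blast
  obtain k :: int where k: "c = of_int k" using ex[OF a] c[OF a] by auto
  have "\<phi> x = \<psi> x + (of_int k, 0)" if "x \<in> X" for x
    using c[OF that] ex[OF that] unfolding d_def k by (simp add: prod_eq_iff)
  then show ?thesis by blast
qed auto

lemma isotopy_annulus_lift:
  assumes "is_isotopy H f" "is_isotopy_lift F H"
  obtains g Fi where "annulus_lift f g (F 1) Fi"
proof -
  have contF: "continuous_on ({0..1} \<times> UNIV) (\<lambda>(t, w). F t w)" and F0: "\<And>w. F 0 w = w"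
    and covF: "\<And>t w. t \<in> {0..1} \<Longrightarrow> cov (F t w) = H t (cov w)"
    using assms(2) unfolding is_isotopy_lift_def by auto
  have H1: "\<And>x. x \<in> Ann \<Longrightarrow> H 1 x = f x" and "\<exists>g. homeomorphism Ann Ann (H 1) g"
    using assms(1) unfolding is_isotopy_def by auto
  then obtain g where "homeomorphism Ann Ann (H 1) g" by blast
  then have hom: "homeomorphism Ann Ann f g" by (rule homeomorphism_cong) (simp_all add: H1)
  have contg: "continuous_on Ann g" and gA: "\<And>x. x \<in> Ann \<Longrightarrow> g x \<in> Ann"
    using hom unfolding homeomorphism_def by auto
  have cF1: "continuous_on UNIV (F 1)"
  proof -
    have "continuous_on UNIV ((\<lambda>(t, w). F t w) \<circ> (\<lambda>w. (1, w)))"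
      by (intro continuous_on_compose continuous_intros continuous_on_subset[OF contF]) auto
    then show ?thesis by (simp add: o_def)
  qed
  have covF1: "cov (F 1 w) = f (cov w)" for w using covF[of 1 w] H1 by simp
  \<comment> \<open>The integer separating the lifted trajectories of \<open>w + (1, 0)\<close> and
    \<open>w\<close> is constant along the isotopy, and it is one at time zero.\<close>
  have shift: "F 1 (w + (1, 0)) = F 1 w + (1, 0)" for w
  proof -
    have c: "continuous_on {0..1} (\<lambda>t. F t v)" for v
    proof -
      have "continuous_on {0..1} ((\<lambda>(t, w). F t w) \<circ> (\<lambda>t. (t, v)))"
        by (intro continuous_on_compose continuous_intros continuous_on_subset[OF contF]) auto
      then show ?thesis by (simp add: o_def)
    qed
    have cs: "cov (w + (1,0)) = cov w" using cov_shift[of w 1] by simp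
    have "\<exists>k::int. \<forall>t\<in>{0..1}. F t (w + (1,0)) = F t w + (of_int k, 0)"
      by (rule lifts_differ_by_shift[OF _ c c]) (simp_all add: covF cs)
    then obtain k :: int where k: "\<And>t. t \<in> {0..1} \<Longrightarrow> F t (w + (1,0)) = F t w + (of_int k, 0)" by blast
    have "k = 1" using k[of 0] unfolding F0 by auto
    then show ?thesis using k[of 1] by simp
  qed
  \<comment> \<open>The plane is contractible, so this nowhere vanishing function has a continuous
    logarithm, whose coordinates give a lift \<open>L\<close> of \<open>g\<close>.\<close>
  have "continuous_on UNIV (\<lambda>w. em (g (cov w)))"
  proof -
    have e: "continuous_on Ann em" using homeomorphism_em by (simp add: homeomorphism_def)
    have "continuous_on UNIV (em \<circ> (g \<circ> cov))"
      by (intro continuous_on_compose continuous_on_cov continuous_on_subset[OF contg] continuous_on_subset[OF e])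
        (use gA[OF cov_in_Ann] cov_in_Ann in \<open>fastforce+\<close>)
    then show ?thesis by (simp add: o_def)
  qed
  moreover have "em (g (cov w)) \<noteq> 0" for w
    using homeomorphism_em gA[of "cov w"] unfolding homeomorphism_def by auto
  ultimately obtain l where l: "continuous_on UNIV l" "\<And>w. em (g (cov w)) = exp (l w)"
    using continuous_logarithm_on_contractible[of UNIV "\<lambda>w::real\<times>real. em (g (cov w))"]
    by (metis UNIV_I contractible_UNIV)
  define L where "L = (\<lambda>w. (Im (l w) / (2*pi), Re (l w)))"
  have contL: "continuous_on UNIV L" unfolding L_def by (intro continuous_intros l) auto
  have covL: "cov (L w) = g (cov w)" for w
  proof -
    have "em (cov (L w)) = em (g (cov w))" unfolding em_cov l(2) L_def by (simp add: complex_eq_iff)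
    then show ?thesis using homeomorphism_apply1[OF homeomorphism_em] gA cov_in_Ann by metis
  qed
  have fg: "\<And>x. x \<in> Ann \<Longrightarrow> f (g x) = x" and gf: "\<And>x. x \<in> Ann \<Longrightarrow> g (f x) = x"
    using hom by (auto simp: homeomorphism_def)
  \<comment> \<open>\<open>L\<close> is an arbitrary lift of \<open>g\<close>: it inverts
    \<open>F 1\<close> up to a single deck translation, which \<open>Fi\<close> corrects.\<close>
  have "continuous_on UNIV (F 1 \<circ> L)"
    by (intro continuous_on_compose contL continuous_on_subset[OF cF1]) auto
  then have "\<exists>k::int. \<forall>w\<in>UNIV. (F 1 \<circ> L) w = w + (of_int k, 0)"
    by (intro lifts_differ_by_shift continuous_on_id connected_UNIV) (simp_all add: covF1 covL fg)
  then obtain k :: int where k: "\<And>w. F 1 (L w) = w + (of_int k, 0)" by auto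
  define Fi where "Fi = (\<lambda>w. L (w + (of_int (-k), 0)))"
  have FFi: "F 1 (Fi w) = w" for w unfolding Fi_def k by (simp add: prod_eq_iff)
  have covFi: "cov (Fi w) = g (cov w)" for w unfolding Fi_def covL by (simp only: cov_shift)
  have contFi: "continuous_on UNIV Fi"
  proof -
    have "continuous_on UNIV (L \<circ> (\<lambda>w. w + (of_int (-k), 0)))"
      by (intro continuous_on_compose continuous_intros continuous_on_subset[OF contL]) auto
    then show ?thesis by (simp add: o_def Fi_def)
  qed
  have shiftn: "F 1 (w + (of_nat n, 0)) = F 1 w + (of_nat n, 0)" for w n
  proof (induction n)
    case (Suc n)
    have "w + (of_nat (Suc n), 0) = (w + (of_nat n, 0)) + (1, 0)" by (simp add: prod_eq_iff)
    then have "F 1 (w + (of_nat (Suc n), 0)) = F 1 w + (of_nat n, 0) + (1, 0)" by (simp only: shift Suc)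
    then show ?case by (simp add: prod_eq_iff)
  qed (simp flip: zero_prod_def)
  have FiF: "Fi (F 1 w) = w" for w
  proof -
    have "cov (Fi (F 1 w)) = cov w" unfolding covFi covF1 by (simp add: gf)
    then obtain j :: int where j: "Fi (F 1 w) = w + (of_int j, 0)" using cov_eq_iff by blast
    then have e: "F 1 (w + (of_int j, 0)) = F 1 w" using FFi by metis
    \<comment> \<open>As \<open>F 1\<close> commutes with integer translations, \<open>F 1 w\<close>
      would otherwise differ from itself by \<open>j\<close>.\<close>
    have "j = 0"
    proof (cases "j \<ge> 0")
      case True
      then show ?thesis using e shiftn[of w "nat j"] by (simp add: prod_eq_iff)
    next
      case False
      have "F 1 ((w + (of_int j, 0)) + (of_nat (nat (-j)), 0)) = F 1 (w + (of_int j, 0)) + (of_nat (nat (-j)), 0)"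
        by (rule shiftn)
      moreover have "(w + (of_int j, 0)) + (of_nat (nat (-j)), 0) = w" using False by (simp add: prod_eq_iff)
      ultimately have "F 1 w = F 1 w + (of_nat (nat (-j)), 0)" using e by simp
      then show ?thesis using False by (simp add: prod_eq_iff)
    qed
    then show ?thesis using j by (simp add: prod_eq_iff)
  qed
  have "annulus_lift f g (F 1) Fi"
    by unfold_locales (fact hom cF1 contFi FFi FiF covF1 shift)+
  then show ?thesis using that by blast
qed

section \<open>Behaviour of an isotopy at the ends\<close>

lemma half_eq_image: "s \<noteq> 0 \<Longrightarrow> half s h = cov ` {w. s * snd w \<ge> h}"
proof
  show "half s h \<subseteq> cov ` {w. s * snd w \<ge> h}"
  proof
    fix x assume x: "x \<in> half s h"
    then obtain w where "cov w = x" using cov_surj unfolding half_def by blast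
    then show "x \<in> cov ` {w. s * snd w \<ge> h}" using x unfolding half_def by (intro image_eqI[of _ _ w]) auto
  qed
  show "cov ` {w. s * snd w \<ge> h} \<subseteq> half s h"
    by (rule image_subsetI) (simp add: half_def)
qed

lemma connected_half: "s \<noteq> 0 \<Longrightarrow> connected (half s h)"
proof -
  assume "s \<noteq> 0"
  have "{w::real\<times>real. s * snd w \<ge> h} = {w. inner (0,s) w \<ge> h}" by (auto simp: inner_prod_def)
  then have "convex {w::real\<times>real. s * snd w \<ge> h}" by (simp add: convex_halfspace_ge)
  then show ?thesis unfolding half_eq_image[OF \<open>s \<noteq> 0\<close>]
    by (intro connected_continuous_image continuous_on_cov convex_connected)
qed

lemma half_antimono: "h \<le> h' \<Longrightarrow> half s h' \<subseteq> half s h"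
  unfolding half_def by auto

lemma half_nonempty: "s = 1 \<or> s = -1 \<Longrightarrow> cov (0, s*h) \<in> half s h"
  by (auto simp: half_def)

text \<open>Both ``the end goes up'' and ``the end goes down'' are open conditions on the time
  parameter, because they are detected by one point and the image of a compact circle.\<close>
lemma isotopy_preserves_end:
  assumes iso: "is_isotopy H f" and s: "s = 1 \<or> s = -1"
  obtains h' where "half s h' \<subseteq> f ` {x \<in> Ann. s * snd x > 0}"
proof -
  have contH: "continuous_on ({0..1} \<times> Ann) (\<lambda>(t, x). H t x)"
    and homH: "\<And>t. t \<in> {0..1} \<Longrightarrow> \<exists>g. homeomorphism Ann Ann (H t) g"
    and H0: "\<And>x. x \<in> Ann \<Longrightarrow> H 0 x = x" and H1: "\<And>x. x \<in> Ann \<Longrightarrow> H 1 x = f x"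
    using iso unfolding is_isotopy_def by auto
  have s0: "s \<noteq> 0" using s by auto
  define C0 where "C0 = {x \<in> Ann. snd x = 0}"
  \<comment> \<open>\<open>Q 1\<close> is the side of the middle circle \<open>C0\<close> facing the
    end \<open>s\<close>, and \<open>Q (-1)\<close> the opposite side.\<close>
  define Q where "Q = (\<lambda>r::real. {x \<in> Ann. r * (s * snd x) > 0})"
  have oQ: "openin (top_of_set Ann) (Q r)" for r
  proof -
    have "Q r = Ann \<inter> {x. r * (s * snd x) > 0}" unfolding Q_def by blast
    moreover have "open {x::apt. r * (s * snd x) > 0}" by (intro open_Collect_less continuous_intros)
    ultimately show ?thesis by auto
  qed
  have cC0: "compact C0"
  proof -
    have "closed C0"
    proof -
      have "C0 = Ann \<inter> {x. snd x = 0}" unfolding C0_def by blast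
      then show ?thesis using closed_Ann by (auto intro!: closed_Int closed_Collect_eq continuous_intros)
    qed
    moreover have "bounded C0"
    proof (rule boundedI[of _ 1])
      fix x assume "x \<in> C0"
      then show "norm x \<le> 1" unfolding C0_def Ann_def by (simp add: norm_prod_def)
    qed
    ultimately show ?thesis by (simp add: compact_eq_bounded_closed)
  qed
  have part: "Q 1 \<union> Q (-1) \<union> C0 = Ann" "Q 1 \<inter> Q (-1) = {}" "C0 \<subseteq> Ann"
    using s unfolding Q_def C0_def by (auto simp del: split_paired_All)
  have QA: "Q r \<subseteq> Ann" for r unfolding Q_def by blast
  \<comment> \<open>A half annulus missing the image of the circle is connected and covered by the
    disjoint open images of the two sides, so one point decides which of them contains it.\<close>
  have claim1: "half s h' \<subseteq> H t ` Q r" if t: "t \<in> {0..1}" and r: "r = 1 \<or> r = -1"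
      and dis: "H t ` C0 \<inter> half s h' = {}" and p: "p \<in> Q r" "H t p \<in> half s h'" for t r h' p
  proof -
    obtain gt where gt: "homeomorphism Ann Ann (H t) gt" using homH[OF t] by blast
    have inj: "inj_on (H t) Ann" using homeomorphism_apply1[OF gt] by (rule inj_on_inverseI)
    obtain T1 T2 where T: "open T1" "H t ` Q r = Ann \<inter> T1" "open T2" "H t ` Q (-r) = Ann \<inter> T2"
      using homeomorphism_imp_open_map[OF gt oQ] by (metis openin_open)
    have dj: "H t ` Q r \<inter> H t ` Q (-r) = {}"
    proof -
      have "Q r \<inter> Q (-r) = {}" using part(2) r by (elim disjE) (simp_all add: Int_commute)
      then show ?thesis using inj_on_image_Int[OF inj QA QA, of r "-r"] by (metis image_empty)
    qed
    have cover: "half s h' \<subseteq> H t ` Q r \<union> H t ` Q (-r)"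
    proof
      fix x assume x: "x \<in> half s h'"
      then have "x \<in> H t ` Ann" using gt unfolding half_def homeomorphism_def by blast
      then obtain z where z: "z \<in> Ann" "x = H t z" by blast
      then have "z \<notin> C0" using dis x by blast
      then have "z \<in> Q r \<union> Q (-r)" using z part(1) r by auto
      then show "x \<in> H t ` Q r \<union> H t ` Q (-r)" using z by blast
    qed
    have hA: "half s h' \<subseteq> Ann" unfolding half_def by blast
    have "T1 \<inter> half s h' = {} \<or> T2 \<inter> half s h' = {}"
    proof (rule connectedD[OF connected_half[OF s0] T(1,3)])
      show "T1 \<inter> T2 \<inter> half s h' = {}" using dj T(2,4) hA by blast
      show "half s h' \<subseteq> T1 \<union> T2" using cover T(2,4) by blast
    qed
    moreover have "H t p \<in> T1 \<inter> half s h'" using p T(2) by blast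
    ultimately have "T2 \<inter> half s h' = {}" by blast
    then show ?thesis using cover T(4) by blast
  qed
  \<comment> \<open>\<open>A 1\<close> collects the times at which the end is preserved,
    \<open>A (-1)\<close> those at which the opposite side of the circle is sent to it. They are
    disjoint, relatively open and cover the interval, and time zero is in
    \<open>A 1\<close>.\<close>
  define A where "A = (\<lambda>r. {t \<in> {0..1}. \<exists>h'. half s h' \<subseteq> H t ` Q r})"
  have cHt: "continuous_on ({0..1} \<times> C0) (\<lambda>(t, x). H t x)"
    by (rule continuous_on_subset[OF contH]) (use part(3) in blast)
  have bnd: "\<exists>b. \<forall>c\<in>C0. s * snd (H t c) < b" if t: "t \<in> {0..1}" for t
  proof -
    have "continuous_on C0 (H t)"
      using homH[OF t] part(3) by (meson continuous_on_subset homeomorphism_def)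
    then have "compact ((\<lambda>c. s * snd (H t c)) ` C0)"
      by (intro compact_continuous_image continuous_intros cC0)
    then have "bounded ((\<lambda>c. s * snd (H t c)) ` C0)" by (rule compact_imp_bounded)
    then obtain b where b: "\<forall>u\<in>(\<lambda>c. s * snd (H t c)) ` C0. \<bar>u\<bar> \<le> b" unfolding bounded_iff real_norm_def by blast
    have "\<forall>c\<in>C0. s * snd (H t c) < b + 1"
    proof
      fix c assume "c \<in> C0"
      then have "\<bar>s * snd (H t c)\<bar> \<le> b" using b by blast
      then show "s * snd (H t c) < b + 1" by linarith
    qed
    then show ?thesis by blast
  qed
  have openA: "openin (top_of_set {0..1}) (A r)" if r: "r = 1 \<or> r = -1" for r
  proof (subst openin_subopen, intro ballI)
    fix t0 assume "t0 \<in> A r"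
    then obtain h' where t0: "t0 \<in> {0..1}" and h': "half s h' \<subseteq> H t0 ` Q r" unfolding A_def by blast
    obtain b where b: "\<forall>c\<in>C0. s * snd (H t0 c) < b" using bnd[OF t0] by blast
    define h1 where "h1 = max h' b"
    have "cov (0, s*(h1+1)) \<in> half s (h1+1)" by (rule half_nonempty[OF s])
    moreover have "half s (h1+1) \<subseteq> half s h'" by (rule half_antimono) (simp add: h1_def)
    ultimately obtain p where p: "p \<in> Q r" "H t0 p = cov (0, s*(h1+1))" using h' by (metis imageE subsetD)
    have pA: "p \<in> Ann" using p(1) QA by blast
    \<comment> \<open>The times at which the image of the circle reaches height \<open>h1\<close>
      are a projection of this compact set, hence closed; avoiding them is an open
      condition.\<close>
    define Bad where "Bad = ({0..1} \<times> C0) \<inter> (\<lambda>(t,c). s * snd (H t c)) -` {h1..}"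
    have "compact ({0..1::real} \<times> C0)" using cC0 by (intro compact_Times) auto
    moreover have "continuous_on ({0..1} \<times> C0) (\<lambda>(t,c). s * snd (H t c))"
      using cHt unfolding case_prod_beta by (intro continuous_intros)
    then have "closedin (top_of_set ({0..1} \<times> C0)) Bad"
      unfolding Bad_def by (rule continuous_closedin_preimage) simp
    ultimately have "compact Bad" by (rule closedin_compact)
    then have "closed (fst ` Bad)" by (intro compact_imp_closed compact_continuous_image continuous_intros)
    define G where "G = ({0..1} \<inter> (\<lambda>t. s * snd (H t p)) -` {h1<..}) \<inter> (- (fst ` Bad))"
    have cp: "continuous_on {0..1} (\<lambda>t. H t p)"
    proof -
      have "continuous_on {0..1} ((\<lambda>(t, x). H t x) \<circ> (\<lambda>t. (t, p)))"
        by (intro continuous_on_compose continuous_intros continuous_on_subset[OF contH]) (use pA in auto)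
      then show ?thesis by (simp add: o_def)
    qed
    have "openin (top_of_set {0..1}) ({0..1} \<inter> (\<lambda>t. s * snd (H t p)) -` {h1<..})"
      by (intro continuous_openin_preimage_gen continuous_intros cp)
    then have "openin (top_of_set {0..1}) G"
      unfolding G_def by (rule openin_Int_open) (use \<open>closed (fst ` Bad)\<close> in blast)
    moreover have "t0 \<in> G"
    proof -
      have "s * snd (H t0 p) = h1 + 1" unfolding p(2) using s by auto
      moreover have "t0 \<notin> fst ` Bad"
      proof
        assume "t0 \<in> fst ` Bad"
        then obtain c where "c \<in> C0" "s * snd (H t0 c) \<ge> h1" unfolding Bad_def by auto
        then show False using b unfolding h1_def by fastforce
      qed
      ultimately show ?thesis using t0 unfolding G_def by auto
    qed
    moreover have "G \<subseteq> A r"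
    proof
      fix t assume t: "t \<in> G"
      then have t01: "t \<in> {0..1}" and tp: "s * snd (H t p) > h1" and tB: "t \<notin> fst ` Bad" unfolding G_def by auto
      have HtA: "H t x \<in> Ann" if "x \<in> Ann" for x using homH[OF t01] that unfolding homeomorphism_def by blast
      have "half s h1 \<subseteq> H t ` Q r"
      proof (rule claim1[OF t01 r _ p(1)])
        show "H t ` C0 \<inter> half s h1 = {}"
        proof (rule ccontr)
          assume "H t ` C0 \<inter> half s h1 \<noteq> {}"
          then obtain c where c: "c \<in> C0" "H t c \<in> half s h1" by blast
          then have "(t, c) \<in> Bad" using t01 unfolding Bad_def half_def by simp
          then show False using tB by (metis fst_conv imageI)
        qed
        show "H t p \<in> half s h1" using tp HtA[OF pA] unfolding half_def by simp
      qed
      then show "t \<in> A r" using t01 unfolding A_def by blast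
    qed
    ultimately show "\<exists>T. openin (top_of_set {0..1}) T \<and> t0 \<in> T \<and> T \<subseteq> A r" by blast
  qed
  have "A 1 \<union> A (-1) = {0..1}"
  proof
    show "{0..1} \<subseteq> A 1 \<union> A (-1)"
    proof
      fix t :: real assume t: "t \<in> {0..1}"
      obtain b where b: "\<forall>c\<in>C0. s * snd (H t c) < b" using bnd[OF t] by blast
      have dis: "H t ` C0 \<inter> half s b = {}" using b unfolding half_def by fastforce
      obtain z where z: "z \<in> Ann" "H t z = cov (0, s*b)"
        using homH[OF t] cov_in_Ann unfolding homeomorphism_def by (metis imageE)
      have zh: "H t z \<in> half s b" unfolding z(2) by (rule half_nonempty[OF s])
      then have "z \<notin> C0" using dis by blast
      then consider "z \<in> Q 1" | "z \<in> Q (-1)" using z(1) part(1) by blast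
      then show "t \<in> A 1 \<union> A (-1)"
      proof cases
        case 1
        have "half s b \<subseteq> H t ` Q 1" by (rule claim1[OF t _ dis 1 zh]) simp
        then show ?thesis using t unfolding A_def by blast
      next
        case 2
        have "half s b \<subseteq> H t ` Q (-1)" by (rule claim1[OF t _ dis 2 zh]) simp
        then show ?thesis using t unfolding A_def by blast
      qed
    qed
  qed (auto simp: A_def)
  moreover have "A 1 \<inter> A (-1) = {}"
  proof (rule ccontr)
    assume "A 1 \<inter> A (-1) \<noteq> {}"
    then obtain t h1 h2 where t: "t \<in> {0..1}" and hh: "half s h1 \<subseteq> H t ` Q 1" "half s h2 \<subseteq> H t ` Q (-1)"
      unfolding A_def by blast
    obtain gt where gt: "homeomorphism Ann Ann (H t) gt" using homH[OF t] by blast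
    have inj: "inj_on (H t) Ann" using homeomorphism_apply1[OF gt] by (rule inj_on_inverseI)
    have "cov (0, s * max h1 h2) \<in> half s (max h1 h2)" by (rule half_nonempty[OF s])
    then have "cov (0, s * max h1 h2) \<in> H t ` Q 1 \<inter> H t ` Q (-1)"
      using hh half_antimono[of h1 "max h1 h2" s] half_antimono[of h2 "max h1 h2" s] by auto
    then show False using inj_on_image_Int[OF inj QA QA, of 1 "-1"] part(2) by (metis empty_iff image_empty)
  qed
  moreover have "0 \<in> A 1"
  proof -
    have "half s 1 \<subseteq> H 0 ` Q 1"
    proof
      fix x assume "x \<in> half s 1"
      then have "x \<in> Q 1" "x \<in> Ann" unfolding half_def Q_def by auto
      then show "x \<in> H 0 ` Q 1" using H0 by (metis imageI)
    qed
    then show ?thesis unfolding A_def by auto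
  qed
  moreover have "connected {0..1::real}" by simp
  ultimately have "A (-1) = {}"
    using openA[of 1] openA[of "-1"] unfolding connected_openin_eq by blast
  then have "1 \<in> A 1" using \<open>A 1 \<union> A (-1) = {0..1}\<close> by auto
  then obtain h' where h': "half s h' \<subseteq> H 1 ` Q 1" unfolding A_def by blast
  have "H 1 ` Q 1 = f ` Q 1" using H1 QA by (intro image_cong refl) blast
  then show ?thesis using h' that unfolding Q_def by auto
qed

section \<open>Essential curves\<close>

lemma em_inv_closure:
  assumes "X \<subseteq> -{0}" "z \<noteq> 0" "z \<in> closure X"
  shows "em_inv z \<in> closure (em_inv ` X)"
proof -
  obtain x where x: "\<And>n. x n \<in> X" "x \<longlonglongrightarrow> z" using assms(3) closure_sequential by blast
  have "continuous_on (-{0}) em_inv" using homeomorphism_em by (simp add: homeomorphism_def)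
  then have "(\<lambda>n. em_inv (x n)) \<longlonglongrightarrow> em_inv z"
  proof (rule continuous_on_tendsto_compose[OF _ x(2)])
    show "z \<in> -{0}" using assms(2) by simp
    show "\<forall>\<^sub>F n in sequentially. x n \<in> -{0}" by (rule always_eventually) (use x(1) assms(1) in blast)
  qed
  then show ?thesis
    unfolding closure_sequential using x(1) by (intro exI[of _ "\<lambda>n. em_inv (x n)"]) simp
qed

text \<open>Transported by \<open>em\<close>, the curve is a Jordan curve of the plane missing the
  origin, and the count of unbounded components forces it to surround the origin. Otherwise whatever
  lies over the inside keeps away from both ends, and the outside minus the origin is connected, so
  at most one unbounded component is left.\<close>

lemma essential_splits:
  assumes "essential \<gamma>"
  obtains D V h where "splits \<gamma> D V" "half (-1) h \<subseteq> D" "half 1 h \<subseteq> V" "h > 0" "connected \<gamma>"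
proof -
  obtain c where c: "simple_path c" "pathfinish c = pathstart c" "path_image c = \<gamma>" and \<gamma>A: "\<gamma> \<subseteq> Ann"
    and card2: "card {C \<in> components (Ann - \<gamma>). \<not> bounded C} = 2"
    using assms unfolding essential_def jordan_curve_def by blast
  have cont: "continuous_on Ann em" and conti: "continuous_on (-{0}) em_inv"
    and ei: "\<And>x. x \<in> Ann \<Longrightarrow> em_inv (em x) = x" and ie: "\<And>z. z \<noteq> 0 \<Longrightarrow> em (em_inv z) = z"
    and eA: "\<And>x. x \<in> Ann \<Longrightarrow> em x \<noteq> 0" and iA: "\<And>z. z \<noteq> 0 \<Longrightarrow> em_inv z \<in> Ann"
    using homeomorphism_em unfolding homeomorphism_def by auto
  define \<Gamma> where "\<Gamma> = path_image (em \<circ> c)"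
  have \<Gamma>: "\<Gamma> = em ` \<gamma>" unfolding \<Gamma>_def path_image_compose c(3) ..
  have "simple_path (em \<circ> c)"
    using c \<gamma>A ei by (intro simple_path_continuous_image continuous_on_subset[OF cont])
      (auto intro!: inj_on_inverseI[of _ em_inv])
  moreover have "pathfinish (em \<circ> c) = pathstart (em \<circ> c)" using c by (simp add: pathfinish_compose pathstart_compose)
  ultimately have J: "open (inside \<Gamma>)" "connected (inside \<Gamma>)" "open (outside \<Gamma>)" "connected (outside \<Gamma>)"
    "bounded (inside \<Gamma>)" "inside \<Gamma> \<inter> outside \<Gamma> = {}" "inside \<Gamma> \<union> outside \<Gamma> = -\<Gamma>"
    "frontier (inside \<Gamma>) = \<Gamma>" "frontier (outside \<Gamma>) = \<Gamma>"
    using Jordan_inside_outside[of "em \<circ> c"] unfolding \<Gamma>_def by auto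
  have "compact \<gamma>" "connected \<gamma>" using c by (auto simp: simple_path_imp_path compact_path_image connected_path_image)
  have "compact \<Gamma>" unfolding \<Gamma> by (intro compact_continuous_image continuous_on_subset[OF cont] \<gamma>A \<open>compact \<gamma>\<close>)
  have em\<Gamma>: "em x \<in> \<Gamma> \<longleftrightarrow> x \<in> \<gamma>" if "x \<in> Ann" for x
  proof
    assume "em x \<in> \<Gamma>"
    then obtain y where "y \<in> \<gamma>" "em x = em y" unfolding \<Gamma> by blast
    then show "x \<in> \<gamma>" using ei that \<gamma>A by (metis subsetD)
  qed (simp add: \<Gamma>)
  have 0: "0 \<notin> \<Gamma>" using eA \<gamma>A unfolding \<Gamma> by (metis imageE subsetD)
  have pre: "em_inv ` X = Ann \<inter> em -` X" if X: "X \<subseteq> -{0}" for X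
  proof
    show "em_inv ` X \<subseteq> Ann \<inter> em -` X"
    proof (rule image_subsetI)
      fix z assume z: "z \<in> X"
      then have "z \<noteq> 0" using X by blast
      then show "em_inv z \<in> Ann \<inter> em -` X" using z iA ie by simp
    qed
    show "Ann \<inter> em -` X \<subseteq> em_inv ` X"
    proof
      fix x assume "x \<in> Ann \<inter> em -` X"
      then show "x \<in> em_inv ` X" using ei[of x] by (intro image_eqI[of _ _ "em x"]) auto
    qed
  qed
  have opre: "openin (top_of_set Ann) (em_inv ` X)" if "X \<subseteq> -{0}" "open X" for X
    unfolding pre[OF that(1)] using that(2) cont by (intro continuous_openin_preimage_gen)
  have cpre: "connected (em_inv ` X)" if "X \<subseteq> -{0}" "connected X" for X
    using that by (intro connected_continuous_image continuous_on_subset[OF conti])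
  have norm_em: "cmod (em x) = exp (snd x)" if "x \<in> Ann" for x
    using that unfolding em_def Ann_def by (simp add: norm_mult)
  obtain b where b: "b > 0" "\<forall>z\<in>inside \<Gamma> \<union> \<Gamma>. cmod z \<le> b"
    using bounded_Un[of "inside \<Gamma>" \<Gamma>] J(5) compact_imp_bounded[OF \<open>compact \<Gamma>\<close>] bounded_pos by metis
  show ?thesis
  proof (cases "0 \<in> outside \<Gamma>")
    case True
    define Y where "Y = em_inv ` (outside \<Gamma> - {0})"
    have cY: "connected Y" unfolding Y_def using J by (intro cpre connected_open_delete) auto
    have Yeq: "Y = Ann \<inter> em -` (outside \<Gamma> - {0})" unfolding Y_def by (rule pre) blast
    have YA: "Y \<subseteq> Ann - \<gamma>"
      unfolding Yeq using em\<Gamma> J(7) by blast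
    obtain r where r: "r > 0" "ball 0 r \<subseteq> outside \<Gamma>" using True J(3) open_contains_ball by blast
    have "C = Y" if C: "C \<in> components (Ann - \<gamma>)" "\<not> bounded C" for C
    proof -
      have CA: "C \<subseteq> Ann - \<gamma>" using C in_components_subset by blast
      then have "continuous_on C em" using continuous_on_subset[OF cont] by blast
      then have "connected (em ` C)" using C in_components_connected connected_continuous_image by blast
      moreover have "em ` C \<subseteq> inside \<Gamma> \<union> outside \<Gamma>" unfolding J(7) using CA em\<Gamma> by blast
      ultimately have "inside \<Gamma> \<inter> em ` C = {} \<or> outside \<Gamma> \<inter> em ` C = {}"
        using connectedD[OF _ J(1,3)] J(6) by blast
      moreover have "outside \<Gamma> \<inter> em ` C \<noteq> {}"
      proof
        assume "outside \<Gamma> \<inter> em ` C = {}"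
        then have CI: "em ` C \<subseteq> inside \<Gamma>" using \<open>em ` C \<subseteq> inside \<Gamma> \<union> outside \<Gamma>\<close> by blast
        have "\<bar>snd x\<bar> \<le> \<bar>ln b\<bar> + \<bar>ln r\<bar>" if "x \<in> C" for x
        proof -
          have "x \<in> Ann" "em x \<in> inside \<Gamma>" using that CA CI by blast+
          then have 1: "exp (snd x) \<le> b" using b norm_em by (metis UnI1)
          have "em x \<notin> ball 0 r" using \<open>em x \<in> inside \<Gamma>\<close> r J(6) by blast
          then have 2: "exp (snd x) \<ge> r" using norm_em[OF \<open>x \<in> Ann\<close>] by simp
          have "snd x \<le> ln b" using 1 b by (simp add: ln_ge_iff)
          moreover have "ln r \<le> snd x" using 2 r by (metis exp_gt_zero ln_exp ln_le_cancel_iff)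
          ultimately show ?thesis by linarith
        qed
        then have "bounded C" using CA bounded_Ann by blast
        then show False using C by blast
      qed
      ultimately have "em ` C \<subseteq> outside \<Gamma>" using \<open>em ` C \<subseteq> inside \<Gamma> \<union> outside \<Gamma>\<close> by blast
      then have "C \<subseteq> Y" unfolding Yeq using CA eA by blast
      moreover have "C \<noteq> {}" using C in_components_nonempty by blast
      ultimately show ?thesis using components_maximal[OF C(1) cY YA] by blast
    qed
    then have "{C \<in> components (Ann - \<gamma>). \<not> bounded C} \<subseteq> {Y}" by blast
    then have "card {C \<in> components (Ann - \<gamma>). \<not> bounded C} \<le> card {Y}" by (intro card_mono) auto
    then show ?thesis using card2 by simp
  next
    case False
    then have 0: "0 \<in> inside \<Gamma>" "0 \<notin> outside \<Gamma>" using 0 J(7) by blast+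
    define D where "D = em_inv ` (inside \<Gamma> - {0})"
    define V where "V = em_inv ` (outside \<Gamma>)"
    have sub: "inside \<Gamma> - {0} \<subseteq> -{0}" "outside \<Gamma> \<subseteq> -{0}" using 0 by auto
    have DV: "D = Ann \<inter> em -` (inside \<Gamma> - {0})" "V = Ann \<inter> em -` (outside \<Gamma>)"
      unfolding D_def V_def by (rule pre[OF sub(1)], rule pre[OF sub(2)])
    have "splits \<gamma> D V" unfolding splits_def
    proof (intro conjI)
      show "openin (top_of_set Ann) D" "openin (top_of_set Ann) V"
        unfolding D_def V_def using J by (auto intro!: opre[OF sub(1)] opre[OF sub(2)] open_delete)
      show "connected D" "connected V"
        unfolding D_def V_def using J by (auto intro!: cpre[OF sub(1)] cpre[OF sub(2)] connected_open_delete)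
      show "D \<union> \<gamma> \<union> V = Ann"
      proof
        show "D \<union> \<gamma> \<union> V \<subseteq> Ann" using \<gamma>A unfolding DV by blast
        show "Ann \<subseteq> D \<union> \<gamma> \<union> V"
        proof
          fix x assume x: "x \<in> Ann"
          then have "em x \<noteq> 0" by (rule eA)
          then have "em x \<in> (inside \<Gamma> - {0}) \<union> \<Gamma> \<union> outside \<Gamma>" using J(7) by blast
          then show "x \<in> D \<union> \<gamma> \<union> V" using x em\<Gamma>[OF x] unfolding DV by blast
        qed
      qed
      show "D \<inter> V = {}" unfolding DV using J(6) by blast
      show "D \<inter> \<gamma> = {}" "V \<inter> \<gamma> = {}" unfolding DV using em\<Gamma> J(7) by blast+
      show "\<gamma> \<subseteq> closure D"
      proof
        fix x assume x: "x \<in> \<gamma>"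
        then have xA: "x \<in> Ann" and "em x \<in> frontier (inside \<Gamma>)" using \<gamma>A em\<Gamma> J(8) by blast+
        then have "em x \<in> closure (inside \<Gamma>)" by (simp add: frontier_def)
        moreover have "closure (inside \<Gamma>) \<subseteq> closure (insert 0 (inside \<Gamma> - {0}))" by (intro closure_mono) blast
        ultimately have "em x \<in> closure (inside \<Gamma> - {0})" using eA[OF xA] unfolding closure_insert by blast
        then have "em_inv (em x) \<in> closure D" unfolding D_def using eA[OF xA] by (intro em_inv_closure) auto
        then show "x \<in> closure D" using ei xA by simp
      qed
      show "\<gamma> \<subseteq> closure V"
      proof
        fix x assume x: "x \<in> \<gamma>"
        then have xA: "x \<in> Ann" and "em x \<in> frontier (outside \<Gamma>)" using \<gamma>A em\<Gamma> J(9) by blast+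
        then have "em x \<in> closure (outside \<Gamma>)" by (simp add: frontier_def)
        then have "em_inv (em x) \<in> closure V" unfolding V_def using eA[OF xA] sub by (intro em_inv_closure) auto
        then show "x \<in> closure V" using ei xA by simp
      qed
    qed (rule \<open>compact \<gamma>\<close>)
    moreover obtain r where r: "r > 0" "ball 0 r \<subseteq> inside \<Gamma>" using 0 J(1) open_contains_ball by blast
    \<comment> \<open>Heights below \<open>ln r\<close> are sent into a disc inside the curve,
      heights above \<open>ln b\<close> beyond the curve.\<close>
    define h where "h = 1 + \<bar>ln b\<bar> + \<bar>ln r\<bar>"
    have "half (-1) h \<subseteq> D"
    proof
      fix x assume "x \<in> half (-1) h"
      then have x: "x \<in> Ann" "snd x \<le> -h" unfolding half_def by auto
      then have "snd x < ln r" unfolding h_def by linarith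
      then have "exp (snd x) < r" using r by (metis exp_less_cancel_iff exp_ln)
      then have "em x \<in> ball 0 r" using norm_em[OF x(1)] by simp
      then show "x \<in> D" unfolding DV using r x eA by blast
    qed
    moreover have "half 1 h \<subseteq> V"
    proof
      fix x assume "x \<in> half 1 h"
      then have x: "x \<in> Ann" "snd x \<ge> h" unfolding half_def by auto
      then have "ln b < snd x" unfolding h_def by linarith
      then have "b < exp (snd x)" using b by (metis exp_less_cancel_iff exp_ln)
      then have "em x \<notin> inside \<Gamma> \<union> \<Gamma>" using norm_em[OF x(1)] b(2) by (metis not_le)
      then show "x \<in> V" unfolding DV using x J(7) by blast
    qed
    moreover have "h > 0" unfolding h_def by linarith
    ultimately show ?thesis using that \<open>connected \<gamma>\<close> by blast
  qed
qed

lemma connected_subset_split: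
  assumes "connected X" "X \<subseteq> A \<union> B" "openin (top_of_set Ann) A" "openin (top_of_set Ann) B" "A \<inter> B = {}" "X \<inter> A \<noteq> {}"
  shows "X \<subseteq> A"
proof -
  obtain T1 T2 where T: "open T1" "A = Ann \<inter> T1" "open T2" "B = Ann \<inter> T2"
    using assms(3,4) by (metis openin_open)
  have "T1 \<inter> X = {} \<or> T2 \<inter> X = {}"
    by (rule connectedD[OF assms(1) T(1,3)]) (use assms(2,5) T(2,4) in blast)+
  then show ?thesis using assms(2,6) T(2,4) by blast
qed

text \<open>\<open>A1\<close> together with its curve is connected, avoids the second curve and
  meets \<open>A2\<close>, so it lies in \<open>A2\<close>.\<close>

lemma splits_nested:
  assumes sp: "splits \<gamma>1 A1 B1" "splits \<gamma>2 A2 B2" and "\<gamma>2 \<subseteq> B1" "A1 \<inter> A2 \<noteq> {}"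
  shows "(A1 \<union> \<gamma>1) \<inter> (B2 \<union> \<gamma>2) = {}"
proof -
  have 1: "connected (A1 \<union> \<gamma>1)" using splits_Diff(3)[of \<gamma>1 B1 A1] sp splits_sym by blast
  have s1: "A1 \<union> \<gamma>1 \<subseteq> Ann" "B1 \<inter> (A1 \<union> \<gamma>1) = {}" using sp(1) unfolding splits_def by auto
  have s2: "A2 \<union> \<gamma>2 \<union> B2 = Ann" "openin (top_of_set Ann) A2" "openin (top_of_set Ann) B2" "A2 \<inter> B2 = {}" "A2 \<inter> \<gamma>2 = {}"
    using sp(2) unfolding splits_def by auto
  have "A1 \<union> \<gamma>1 \<subseteq> A2"
    by (rule connected_subset_split[OF 1 _ s2(2,3,4)]) (use s1 s2(1) assms(3,4) in blast)+
  then show ?thesis using s2(4,5) by blast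
qed

text \<open>\<open>D\<close> and \<open>E\<close> are connected and unbounded, so a bounded
  component meets neither; a component meeting \<open>V\<close> and \<open>W\<close> in a common
  point stays in their intersection, whose heights are bounded.\<close>

lemma closed_annulus_between_eq:
  assumes spm: "splits gm D V" and spp: "splits gp E W" and disj: "(D \<union> gm) \<inter> (E \<union> gp) = {}"
    and hD: "half (-1) h \<subseteq> D" and hE: "half 1 h \<subseteq> E"
  shows "closed_annulus_between gp gm = closure (V \<inter> W)"
proof -
  have m: "D \<union> gm \<union> V = Ann" "D \<inter> V = {}" "D \<inter> gm = {}" "V \<inter> gm = {}" "openin (top_of_set Ann) D" "openin (top_of_set Ann) V" "connected D"
    using spm unfolding splits_def by auto
  have p: "E \<union> gp \<union> W = Ann" "E \<inter> W = {}" "E \<inter> gp = {}" "W \<inter> gp = {}" "openin (top_of_set Ann) E" "openin (top_of_set Ann) W" "connected E"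
    using spp unfolding splits_def by auto
  define X where "X = Ann - (gp \<union> gm)"
  have Xeq: "X = D \<union> E \<union> (V \<inter> W)" using m p disj unfolding X_def by blast
  have oVW: "openin (top_of_set Ann) (V \<inter> W)" "openin (top_of_set Ann) (D \<union> E)" using m p by auto
  have dj: "(V \<inter> W) \<inter> (D \<union> E) = {}" using m p by blast
  have ubd: "\<not> bounded D" "\<not> bounded E"
  proof -
    have *: "\<not> bounded Y" if s: "s = 1 \<or> s = -1" and Y: "half s h \<subseteq> Y" for Y s
    proof
      assume "bounded Y"
      then obtain b where b: "\<forall>y\<in>Y. norm y \<le> b" unfolding bounded_iff by blast
      define k where "k = \<bar>b\<bar> + \<bar>h\<bar> + 1"
      have "half s k \<subseteq> half s h" by (rule half_antimono) (simp add: k_def)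
      then have "norm (cov (0, s*k)) \<le> b" using half_nonempty[OF s, of k] Y b by blast
      moreover have "\<bar>snd (cov (0, s*k))\<bar> \<le> norm (cov (0, s*k))" by (metis norm_snd_le prod.collapse real_norm_def)
      ultimately show False using s unfolding k_def by (auto simp: abs_mult)
    qed
    show "\<not> bounded D" by (rule *[of "-1"]) (use hD in auto)
    show "\<not> bounded E" by (rule *[of 1]) (use hE in auto)
  qed
  have "\<Union>{C \<in> components X. bounded C} = V \<inter> W"
  proof
    show "\<Union>{C \<in> components X. bounded C} \<subseteq> V \<inter> W"
    proof (rule Union_least)
      fix C assume "C \<in> {C \<in> components X. bounded C}"
      then have C: "C \<in> components X" "bounded C" by auto
      have "D \<inter> C = {}"
      proof (rule ccontr)
        assume "D \<inter> C \<noteq> {}"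
        then have "D \<subseteq> C" using components_maximal[OF C(1) m(7)] Xeq by blast
        then show False using ubd C bounded_subset by blast
      qed
      moreover have "E \<inter> C = {}"
      proof (rule ccontr)
        assume "E \<inter> C \<noteq> {}"
        then have "E \<subseteq> C" using components_maximal[OF C(1) p(7)] Xeq by blast
        then show False using ubd C bounded_subset by blast
      qed
      ultimately show "C \<subseteq> V \<inter> W" using in_components_subset[OF C(1)] Xeq by blast
    qed
    show "V \<inter> W \<subseteq> \<Union>{C \<in> components X. bounded C}"
    proof
      fix x assume x: "x \<in> V \<inter> W"
      then have "x \<in> X" using Xeq by blast
      then obtain C where C: "C \<in> components X" "x \<in> C" using Union_components[of X] by blast
      have "C \<subseteq> V \<inter> W"
        by (rule connected_subset_split[OF in_components_connected[OF C(1)] _ oVW dj])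
          (use in_components_subset[OF C(1)] Xeq x C(2) in blast)+
      moreover have "bounded (V \<inter> W)"
      proof (rule bounded_Ann[of _ h])
        show "V \<inter> W \<subseteq> Ann" using m(1) by blast
        fix x assume x: "x \<in> V \<inter> W"
        then have "x \<notin> half (-1) h" "x \<notin> half 1 h" "x \<in> Ann" using hD hE m p by blast+
        then show "\<bar>snd x\<bar> \<le> h" unfolding half_def by auto
      qed
      ultimately show "x \<in> \<Union>{C \<in> components X. bounded C}" using C bounded_subset by blast
    qed
  qed
  then show ?thesis unfolding closed_annulus_between_def X_def by simp
qed

section \<open>Free curves and the maximal invariant set\<close>

context annulus_lift begin

text \<open>The maximal invariant set described by what is avoided: symmetric in \<open>f\<close>
  and \<open>g\<close>, and matching the definitions of \<open>S\<close> and
  \<open>U\<close>.\<close>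

definition Inv :: "apt set \<Rightarrow> apt set" where
  "Inv Y = {x \<in> Ann. \<forall>n. (f ^^ n) x \<notin> Y \<and> (g ^^ n) x \<notin> Y}"

lemma Inv_dual: "annulus_lift.Inv g f Y = Inv Y"
  using annulus_lift.Inv_def[OF dual, of Y] unfolding Inv_def by auto

text \<open>\<open>A\<close> with its curve is connected and avoids the image of the curve, so it
  lies in the image of one side. The hypothesis \<open>ne\<close> selects the image of
  \<open>A\<close>; it excludes a map that interchanges the two ends.\<close>

lemma free_curve_pushed:
  assumes sp: "splits \<gamma> A B" and \<gamma>: "f ` \<gamma> \<subseteq> B" and ne: "A \<inter> f ` A \<noteq> {}"
  shows "f ` (B \<union> \<gamma>) \<subseteq> B" "g ` (A \<union> \<gamma>) \<subseteq> A"
proof -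
  have p: "A \<union> \<gamma> \<union> B = Ann" "openin (top_of_set Ann) A" "openin (top_of_set Ann) B" "A \<inter> B = {}" "A \<inter> \<gamma> = {}" "B \<inter> \<gamma> = {}"
    using sp unfolding splits_def by auto
  have con: "connected (A \<union> \<gamma>)" using splits_Diff(3)[of \<gamma> B A] sp splits_sym by blast
  have inj: "inj_on f Ann" using gf by (rule inj_on_inverseI)
  have fim: "f ` Ann = Ann" using hom by (simp add: homeomorphism_def)
  have sub: "A \<subseteq> Ann" "B \<subseteq> Ann" "\<gamma> \<subseteq> Ann" using p(1) by blast+
  have dj: "f ` A \<inter> f ` B = {}" "f ` A \<inter> f ` \<gamma> = {}" "f ` B \<inter> f ` \<gamma> = {}"
    using inj_on_image_Int[OF inj sub(1,2)] inj_on_image_Int[OF inj sub(1,3)] inj_on_image_Int[OF inj sub(2,3)] p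
    by (metis image_empty)+
  have un: "f ` A \<union> f ` \<gamma> \<union> f ` B = Ann" using fim p(1) by (metis image_Un)
  have "A \<union> \<gamma> \<subseteq> f ` A"
  proof (rule connected_subset_split[OF con _ openin_image[OF p(2)] openin_image[OF p(3)] dj(1)])
    have *: "A \<union> \<gamma> \<subseteq> X \<union> Y" if "X \<union> Z \<union> Y = Ann" "Z \<subseteq> B" for X Y Z
      using that sub p(4,6) by blast
    show "A \<union> \<gamma> \<subseteq> f ` A \<union> f ` B" by (rule *[OF un \<gamma>])
    show "(A \<union> \<gamma>) \<inter> f ` A \<noteq> {}" using ne by blast
  qed
  show "g ` (A \<union> \<gamma>) \<subseteq> A"
  proof (rule image_subsetI)
    fix x assume "x \<in> A \<union> \<gamma>"
    then obtain a where a: "a \<in> A" "x = f a" using \<open>A \<union> \<gamma> \<subseteq> f ` A\<close> by (metis imageE subsetD)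
    then show "g x \<in> A" using gf[of a] sub(1) by (simp add: subsetD)
  qed
  have *: "(Y \<union> Z) \<inter> (A \<union> \<gamma>) = {}" if "A \<union> \<gamma> \<subseteq> X" "X \<inter> Y = {}" "X \<inter> Z = {}" for X Y Z
    using that by blast
  have "f ` (B \<union> \<gamma>) \<inter> (A \<union> \<gamma>) = {}" unfolding image_Un
    by (rule *[OF \<open>A \<union> \<gamma> \<subseteq> f ` A\<close> dj(1,2)])
  moreover have "f ` (B \<union> \<gamma>) \<subseteq> Ann" using image_mono[of "B \<union> \<gamma>" Ann f] sub unfolding fim by simp
  ultimately show "f ` (B \<union> \<gamma>) \<subseteq> B" using p(1) by blast
qed

text \<open>A point very close to the end has a preimage on the side of the middle circle facing
  that end. The preimage is above height \<open>h\<close>, since \<open>f\<close> is bounded on the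
  compact part between the circle and \<open>h\<close>.\<close>

lemma end_image:
  assumes s: "s = 1 \<or> s = -1" and h': "half s h' \<subseteq> f ` {x \<in> Ann. s * snd x > 0}" and X: "half s h \<subseteq> X"
  shows "X \<inter> f ` X \<noteq> {}"
proof -
  define K where "K = {x \<in> Ann. 0 \<le> s * snd x \<and> s * snd x \<le> h}"
  have "K = Ann \<inter> {x. 0 \<le> s * snd x} \<inter> {x. s * snd x \<le> h}" unfolding K_def by blast
  then have "closed K" using closed_Ann by (auto intro!: closed_Int closed_Collect_le continuous_intros)
  moreover have "bounded K" by (rule bounded_Ann[of _ "\<bar>h\<bar>"]) (use s in \<open>auto simp: K_def\<close>)
  ultimately have "compact K" by (simp add: compact_eq_bounded_closed)
  then have "compact ((\<lambda>x. snd (f x)) ` K)"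
    by (intro compact_continuous_image continuous_intros continuous_on_subset[OF contf]) (auto simp: K_def)
  then have "bounded ((\<lambda>x. snd (f x)) ` K)" by (rule compact_imp_bounded)
  then obtain b where b: "\<forall>u\<in>(\<lambda>x. snd (f x)) ` K. \<bar>u\<bar> \<le> b" unfolding bounded_iff real_norm_def by blast
  define k where "k = \<bar>h\<bar> + \<bar>h'\<bar> + \<bar>b\<bar> + 1"
  define q where "q = cov (0, s*k)"
  have qk: "q \<in> half s k" unfolding q_def by (rule half_nonempty[OF s])
  have "half s k \<subseteq> half s h'" "half s k \<subseteq> half s h" by (rule half_antimono, simp add: k_def)+
  then obtain z where z: "z \<in> Ann" "s * snd z > 0" "f z = q" "q \<in> X" using qk h' X by blast
  have "\<not> s * snd z \<le> h"
  proof
    assume "s * snd z \<le> h"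
    then have "z \<in> K" using z unfolding K_def by simp
    then have "\<bar>snd q\<bar> \<le> b" using b z(3) by blast
    then show False using s unfolding q_def k_def by (auto simp: abs_mult)
  qed
  then have "z \<in> half s h" using z unfolding half_def by simp
  then show ?thesis using z X by blast
qed

text \<open>The closed annulus and the complement of \<open>D\<close> and \<open>E\<close> could
  only differ along the curves. An orbit avoiding \<open>D\<close> and \<open>E\<close> never
  touches a curve, since its next or previous point would then be in \<open>D\<close> or
  \<open>E\<close>.\<close>

lemma Theta_eq:
  assumes spm: "splits gm D V" and spp: "splits gp E W"
    and Dm: "g ` (D \<union> gm) \<subseteq> D \<or> f ` (D \<union> gm) \<subseteq> D" and Ep: "g ` (E \<union> gp) \<subseteq> E \<or> f ` (E \<union> gp) \<subseteq> E"
  shows "Theta f (closure (V \<inter> W)) = Inv (D \<union> E)"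
proof -
  have m: "D \<union> gm \<union> V = Ann" "D \<inter> V = {}" "openin (top_of_set Ann) D"
    using spm unfolding splits_def by auto
  have p: "E \<union> gp \<union> W = Ann" "E \<inter> W = {}" "openin (top_of_set Ann) E"
    using spp unfolding splits_def by auto
  \<comment> \<open>\<open>inv_into Ann f\<close> is only known to agree with \<open>g\<close> on
    \<open>Ann\<close>, so the induction carries membership in \<open>Ann\<close> along.\<close>
  have inv: "(inv_into Ann f ^^ n) x = (g ^^ n) x \<and> (g ^^ n) x \<in> Ann" if "x \<in> Ann" for x n
  proof (induction n)
    case (Suc n)
    define y where "y = (g ^^ n) x"
    have y: "y \<in> Ann" "(inv_into Ann f ^^ n) x = y" using Suc unfolding y_def by auto
    have "inj_on f Ann" using gf by (rule inj_on_inverseI)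
    then have "inv_into Ann f y = g y" using y(1) by (metis inv_into_f_f fg gAnn)
    then show ?case using y gAnn[OF y(1)] by (simp add: y_def)
  qed (simp add: that)
  have finv: "(f ^^ n) x \<in> Ann" if "x \<in> Ann" for x n by (induction n) (use that fAnn in auto)
  have "closed (Ann - (D \<union> E))" using m p closed_Ann_Diff openin_Un by blast
  then have cl: "closure (V \<inter> W) \<subseteq> Ann - (D \<union> E)"
    by (intro closure_minimal) (use m p in blast)+
  have sub: "Theta f (closure (V \<inter> W)) \<subseteq> Inv (D \<union> E)"
  proof
    fix x assume x: "x \<in> Theta f (closure (V \<inter> W))"
    then have xA: "x \<in> Ann" using cl unfolding Theta_def by blast
    have "(f ^^ n) x \<in> closure (V \<inter> W) \<and> (inv_into Ann f ^^ n) x \<in> closure (V \<inter> W)" for n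
      using x unfolding Theta_def by blast
    then have "(f ^^ n) x \<in> closure (V \<inter> W) \<and> (g ^^ n) x \<in> closure (V \<inter> W)" for n
      using inv[OF xA, of n] by metis
    then show "x \<in> Inv (D \<union> E)" unfolding Inv_def using xA cl by blast
  qed
  moreover have "Inv (D \<union> E) \<subseteq> Theta f (closure (V \<inter> W))"
  proof
    fix x assume x: "x \<in> Inv (D \<union> E)"
    then have xA: "x \<in> Ann" unfolding Inv_def by blast
    have key: "y \<in> V \<inter> W" if y: "y \<in> Ann" "y \<notin> D \<union> E" "f y \<notin> D \<union> E" "g y \<notin> D \<union> E" for y
    proof -
      have "y \<notin> gm" "y \<notin> gp" using y Dm Ep by blast+
      then show ?thesis using y m(1) p(1) by blast
    qed
    have nb: "(f ^^ n) x \<notin> D \<union> E" "(g ^^ n) x \<notin> D \<union> E" for n using x unfolding Inv_def by blast+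
    have "(f ^^ n) x \<in> V \<inter> W" for n
    proof (rule key[OF finv[OF xA] nb(1)])
      show "f ((f ^^ n) x) \<notin> D \<union> E" using nb(1)[of "Suc n"] by simp
      show "g ((f ^^ n) x) \<notin> D \<union> E"
      proof (cases n)
        case 0 then show ?thesis using nb(2)[of 1] by simp
      next
        case (Suc k) then show ?thesis using nb(1)[of k] gf finv[OF xA] by simp
      qed
    qed
    moreover have "(g ^^ n) x \<in> V \<inter> W" for n
    proof (rule key[OF _ nb(2)])
      show "(g ^^ n) x \<in> Ann" using inv[OF xA] by blast
      show "g ((g ^^ n) x) \<notin> D \<union> E" using nb(2)[of "Suc n"] by simp
      show "f ((g ^^ n) x) \<notin> D \<union> E"
      proof (cases n)
        case 0 then show ?thesis using nb(1)[of 1] by simp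
      next
        case (Suc k) then show ?thesis using nb(2)[of k] fg inv[OF xA, of k] by simp
      qed
    qed
    ultimately have *: "(f ^^ n) x \<in> closure (V \<inter> W) \<and> (inv_into Ann f ^^ n) x \<in> closure (V \<inter> W)" for n
      using inv[OF xA, of n] closure_subset by (metis subsetD)
    have "(f ^^ 0) x \<in> closure (V \<inter> W)" using *[of 0] by (rule conjunct1)
    then have "x \<in> closure (V \<inter> W)" by simp
    then show "x \<in> Theta f (closure (V \<inter> W))" unfolding Theta_def using * by simp
  qed
  ultimately show ?thesis by blast
qed

text \<open>Both curves are pushed into the annulus \<open>Z\<close>, so the forward images of
  \<open>Z\<close> are nested continua with intersection the maximal invariant set. That
  \<open>Z\<close> is connected comes from unicoherence of the plane: two closed connected sets
  covering it have a connected intersection.\<close>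

lemma Inv_connected:
  assumes spm: "splits gm D V" and spp: "splits gp E W" and disj: "(D \<union> gm) \<inter> (E \<union> gp) = {}"
    and hD: "half (-1) h \<subseteq> D" and hE: "half 1 h \<subseteq> E"
    and V: "f ` (V \<union> gm) \<subseteq> V" and W: "f ` (W \<union> gp) \<subseteq> W"
  shows "connected (Inv (D \<union> E))"
proof -
  have m: "D \<union> gm \<union> V = Ann" "D \<inter> V = {}" using spm unfolding splits_def by auto
  have p: "E \<union> gp \<union> W = Ann" "E \<inter> W = {}" using spp unfolding splits_def by auto
  define Z where "Z = Ann - (D \<union> E)"
  have Zeq: "Z = (V \<union> gm) \<inter> (W \<union> gp)" using splits_Diff(1)[OF spm] splits_Diff(1)[OF spp] unfolding Z_def by blast
  have "half 1 h \<subseteq> V" "half (-1) h \<subseteq> W" using hD hE m p disj by blast+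
  then have con: "connected (cov -` (V \<union> gm))" "connected (cov -` (W \<union> gp))"
    using splits_cov_connected(2)[OF spm, of 1 h] splits_cov_connected(2)[OF spp, of "-1" h] by auto
  have clo: "closed (cov -` (V \<union> gm))" "closed (cov -` (W \<union> gp))"
    using splits_Diff(2)[OF spm] splits_Diff(2)[OF spp] closed_cov_vimage by blast+
  have "cov -` (V \<union> gm) \<union> cov -` (W \<union> gp) = UNIV"
  proof -
    have "Ann \<subseteq> (V \<union> gm) \<union> (W \<union> gp)" using m p disj by blast
    then show ?thesis using cov_in_Ann by blast
  qed
  then have "connected (cov -` (V \<union> gm) \<inter> cov -` (W \<union> gp))"
    using clo by (intro unicoherentD[OF unicoherent_UNIV con]) simp_all
  then have "connected (cov -` Z)" unfolding Zeq by (simp add: vimage_Int)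
  then have "connected (cov ` (cov -` Z))" by (intro connected_continuous_image continuous_on_cov)
  moreover have "Z \<subseteq> Ann" unfolding Z_def by blast
  ultimately have cZ: "connected Z" using image_cov_vimage[of Z] by metis
  have "closed Z" unfolding Zeq using splits_Diff(2)[OF spm] splits_Diff(2)[OF spp] by blast
  moreover have "bounded Z"
  proof (rule bounded_Ann[OF \<open>Z \<subseteq> Ann\<close>, of h])
    fix x assume "x \<in> Z"
    then have "x \<notin> half (-1) h" "x \<notin> half 1 h" "x \<in> Ann" using hD hE unfolding Z_def by blast+
    then show "\<bar>snd x\<bar> \<le> h" unfolding half_def by auto
  qed
  ultimately have kZ: "compact Z" by (simp add: compact_eq_bounded_closed)
  have fZ: "f ` Z \<subseteq> Z" using V W unfolding Zeq by blast
  have fnZ: "(f ^^ n) x \<in> Z" if "x \<in> Z" for n x by (induction n) (use that fZ in auto)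
  define K where "K = (\<lambda>n. (f ^^ n) ` Z)"
  have "compact (K n) \<and> connected (K n)" for n
  proof -
    interpret q: annulus_lift "f ^^ n" "g ^^ n" "F ^^ n" "Fi ^^ n" by (rule pow)
    have "continuous_on Z (f ^^ n)" by (rule continuous_on_subset[OF q.contf \<open>Z \<subseteq> Ann\<close>])
    then show ?thesis unfolding K_def using kZ cZ by (simp add: compact_continuous_image connected_continuous_image)
  qed
  moreover have "K n \<subseteq> K k" if "k \<le> n" for k n
  proof -
    have "(f ^^ n) y \<in> (f ^^ k) ` Z" if "y \<in> Z" for y
    proof -
      have "(f ^^ n) y = (f ^^ k) ((f ^^ (n-k)) y)"
        using \<open>k \<le> n\<close> by (metis comp_apply funpow_add le_add_diff_inverse)
      then show ?thesis using fnZ that by simp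
    qed
    then show ?thesis unfolding K_def by blast
  qed
  ultimately have "connected (\<Inter>(range K))" by (intro connected_nest) auto
  moreover have "\<Inter>(range K) = Inv (D \<union> E)"
  proof
    show "Inv (D \<union> E) \<subseteq> \<Inter>(range K)"
    proof
      fix x assume x: "x \<in> Inv (D \<union> E)"
      have "x \<in> K n" for n
      proof -
        interpret q: annulus_lift "f ^^ n" "g ^^ n" "F ^^ n" "Fi ^^ n" by (rule pow)
        have xA: "x \<in> Ann" using x unfolding Inv_def by blast
        then have "(g ^^ n) x \<in> Z" using x q.gAnn unfolding Inv_def Z_def by blast
        moreover have "x = (f ^^ n) ((g ^^ n) x)" using q.fg xA by simp
        ultimately show ?thesis unfolding K_def by blast
      qed
      then show "x \<in> \<Inter>(range K)" by blast
    qed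
    show "\<Inter>(range K) \<subseteq> Inv (D \<union> E)"
    proof
      fix x assume x: "x \<in> \<Inter>(range K)"
      have "K 0 = Z" unfolding K_def by simp
      then have xZ: "x \<in> Z" using x by blast
      have "(g ^^ n) x \<in> Z" for n
      proof -
        interpret q: annulus_lift "f ^^ n" "g ^^ n" "F ^^ n" "Fi ^^ n" by (rule pow)
        obtain y where y: "y \<in> Z" "x = (f ^^ n) y" using x unfolding K_def by blast
        then have "(g ^^ n) x = y" using q.gf[of y] \<open>Z \<subseteq> Ann\<close> by blast
        then show ?thesis using y by simp
      qed
      then show "x \<in> Inv (D \<union> E)" using fnZ[OF xZ] xZ unfolding Inv_def Z_def by blast
    qed
  qed
  ultimately show ?thesis by simp
qed

end

section \<open>The rotation set\<close>

context annulus_lift begin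

lemma Inv_f: "x \<in> Inv Y \<Longrightarrow> f x \<in> Inv Y"
proof -
  assume x: "x \<in> Inv Y"
  then have xA: "x \<in> Ann" unfolding Inv_def by blast
  have "(f ^^ n) (f x) \<notin> Y" for n
    using x unfolding Inv_def by (metis (mono_tags, lifting) funpow_swap1 funpow.simps(2) comp_apply mem_Collect_eq)
  moreover have "(g ^^ n) (f x) \<notin> Y" for n
  proof (cases n)
    case 0
    have "(f ^^ 1) x \<notin> Y" using x unfolding Inv_def by blast
    then show ?thesis using 0 by simp
  next
    case (Suc k)
    have "(g ^^ n) (f x) = (g ^^ k) x" unfolding Suc funpow_Suc_right by (simp add: gf[OF xA])
    then show ?thesis using x unfolding Inv_def by simp
  qed
  ultimately show "f x \<in> Inv Y" unfolding Inv_def using fAnn[OF xA] by blast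
qed

lemma Inv_g: "x \<in> Inv Y \<Longrightarrow> g x \<in> Inv Y"
  using annulus_lift.Inv_f[OF dual] unfolding Inv_dual .

text \<open>A gap in the limit set gives a uniform gap around \<open>c0\<close> for all averages
  from some time on. The deviation from speed \<open>c0\<close> then has size growing linearly,
  while one step changes it by a bounded amount; so its sign stops changing, and this sign splits
  \<open>K\<close>.\<close>

lemma rotation_split:
  assumes K: "compact K" "K \<subseteq> Ann" and fK: "f ` K \<subseteq> K" and gK: "g ` K \<subseteq> K"
    and gap: "\<not> ereal_interval (rho_set F f K)"
  obtains P Q where "closed P" "closed Q" "P \<inter> Q = {}" "P \<union> Q = K"
    "f ` P \<subseteq> P" "f ` Q \<subseteq> Q" "g ` P \<subseteq> P" "g ` Q \<subseteq> Q" "P \<noteq> {}" "Q \<noteq> {}"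
    "\<And>b. \<exists>N\<ge>2. \<forall>x y. cov x \<in> P \<longrightarrow> cov y \<in> Q \<longrightarrow>
        fst ((F ^^ N) x) - fst x - (fst ((F ^^ N) y) - fst y) \<ge> b"
proof -
  define X where "X = (\<lambda>m. \<Union>n\<in>{m..}. {ereal (rho_n F n w) | w. cov w \<in> K \<and> (f ^^ n) (cov w) \<in> K})"
  have rho: "rho_set F f K = (\<Inter>m\<in>{1..}. closure (X m))" unfolding rho_set_def X_def ..
  obtain a b c where abc: "a \<in> rho_set F f K" "b \<in> rho_set F f K" "a \<le> c" "c \<le> b" "c \<notin> rho_set F f K"
    using gap unfolding ereal_interval_def by blast
  \<comment> \<open>Lying strictly between two points, \<open>c\<close> is finite even if
    \<open>a\<close> or \<open>b\<close> is not.\<close>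
  then have "a < c" "c < b" by (metis order.not_eq_order_implies_strict)+
  then obtain c0 where c0: "c = ereal c0" by (cases c) auto
  obtain m where m: "m \<ge> 1" "c \<notin> closure (X m)" using abc(5) unfolding rho by auto
  have "open (ereal -` (- closure (X m)))" by (intro open_ereal_vimage) auto
  moreover have "c0 \<in> ereal -` (- closure (X m))" using m c0 by simp
  ultimately obtain e where e: "e > 0" "ball c0 e \<subseteq> ereal -` (- closure (X m))" using open_contains_ball by blast
  have fnK: "(f ^^ n) x \<in> K" if "x \<in> K" for n x by (induction n) (use that fK in auto)
  have gapn: "\<bar>rho_n F n w - c0\<bar> \<ge> e" if "n \<ge> m" "cov w \<in> K" for n w
  proof (rule ccontr)
    assume "\<not> \<bar>rho_n F n w - c0\<bar> \<ge> e"
    then have "rho_n F n w \<in> ball c0 e" by (simp add: dist_real_def abs_minus_commute)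
    then have "ereal (rho_n F n w) \<notin> closure (X m)" using e by blast
    moreover have "ereal (rho_n F n w) \<in> X m" unfolding X_def using that fnK by blast
    ultimately show False using closure_subset by blast
  qed
  \<comment> \<open>Displacement relative to uniform motion at speed \<open>c0\<close>; the gap
    bounds its size from below by \<open>n * e\<close>.\<close>
  define d where "d = (\<lambda>n w. fst ((F ^^ n) w) - fst w - real n * c0)"
  have rd: "rho_n F n w - c0 = d n w / real n" if "n \<ge> 1" for n w
    using that unfolding rho_n_def d_def by (simp add: field_simps)
  have gapd: "\<bar>d n w\<bar> \<ge> real n * e" if "n \<ge> m" "cov w \<in> K" for n w
  proof -
    have n: "n \<ge> 1" using that m by simp
    then have "\<bar>d n w\<bar> / real n \<ge> e" using gapn[OF that] unfolding rd[OF n] by (simp add: abs_divide)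
    then show ?thesis using n by (simp add: field_simps)
  qed
  have Fsh: "(F ^^ n) (w + (of_int k, 0)) = (F ^^ n) w + (of_int k, 0)" for n w k
    by (rule annulus_lift.shift[OF pow])
  have dper: "d n v = d n w" if vw: "cov v = cov w" for n v w
  proof -
    obtain k :: int where k: "v = w + (of_int k, 0)" using vw cov_eq_iff[of v w] by auto
    show ?thesis unfolding d_def k Fsh by simp
  qed
  have contFn: "continuous_on A (F ^^ n)" for A n
    using annulus_lift.contF[OF pow, of n] continuous_on_subset by blast
  have contd: "continuous_on A (d n)" for A n unfolding d_def by (intro continuous_intros contFn)
  obtain hb where hb: "\<And>x. x \<in> K \<Longrightarrow> \<bar>snd x\<bar> \<le> hb"
  proof -
    have "bounded (snd ` K)" by (intro compact_imp_bounded compact_continuous_image K continuous_intros)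
    then have "\<exists>hb. \<forall>u\<in>snd ` K. \<bar>u\<bar> \<le> hb" unfolding bounded_iff real_norm_def .
    then show ?thesis using that by blast
  qed
  define KL where "KL = cov -` K \<inter> cbox (0, -hb) (1, hb)"
  have cKL: "compact KL" unfolding KL_def
    using K by (intro closed_Int_compact closed_cov_vimage compact_imp_closed) auto
  have KL: "\<exists>w\<in>KL. cov w = x" if xK: "x \<in> K" for x
  proof -
    obtain w where w: "cov w = x" "0 \<le> fst w" "fst w \<le> 1" using xK K(2) cov_surj[of x] by blast
    have "\<bar>snd w\<bar> \<le> hb" using hb[OF xK] w(1) by (metis snd_cov)
    then have "w \<in> cbox (0, -hb) (1, hb)" using w(2,3) by (cases w) (auto simp: cbox_Pair_eq)
    then show ?thesis unfolding KL_def using w xK by blast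
  qed
  obtain C where C: "\<And>w. cov w \<in> K \<Longrightarrow> \<bar>d 1 w\<bar> \<le> C"
  proof -
    have "bounded (d 1 ` KL)" by (intro compact_imp_bounded compact_continuous_image cKL contd)
    then obtain C where C: "\<forall>u\<in>d 1 ` KL. \<bar>u\<bar> \<le> C" unfolding bounded_iff real_norm_def by blast
    have "\<bar>d 1 w\<bar> \<le> C" if w: "cov w \<in> K" for w
    proof -
      obtain v where "v \<in> KL" "cov v = cov w" using KL[OF w] by blast
      then show ?thesis using C dper[of v w 1] by auto
    qed
    then show ?thesis using that by blast
  qed
  have covFn: "cov ((F ^^ n) w) = (f ^^ n) (cov w)" for n w by (rule annulus_lift.covF[OF pow])
  have dSuc: "d (Suc n) w = d n w + d 1 ((F ^^ n) w)" for n w unfolding d_def by (simp add: algebra_simps)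
  \<comment> \<open>Splitting off the first step instead of the last compares \<open>w\<close> with
    \<open>F w\<close>, which gives the invariance of \<open>P\<close> and \<open>Q\<close>.\<close>
  have dSuc2: "d (Suc n) w = d 1 w + d n (F w)" for n w
    unfolding d_def by (simp add: algebra_simps funpow_swap1)
  \<comment> \<open>From \<open>m1\<close> on, the forbidden zone around zero is wider than a single
    step, whose size is at most \<open>C\<close>, so the sign of \<open>d n w\<close> is
    frozen.\<close>
  obtain k0 :: nat where k0: "real k0 * e > C" using reals_Archimedean3[OF e(1)] by blast
  define m1 where "m1 = m + k0"
  have m1: "m1 \<ge> m" "m1 \<ge> 1" unfolding m1_def using m by auto
  have big: "real n * e > C" if "n \<ge> m1" for n
  proof -
    have "real k0 * e \<le> real n * e" using that e by (intro mult_right_mono) (auto simp: m1_def)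
    then show ?thesis using k0 by linarith
  qed
  have Cpos: "\<bar>d 1 ((F ^^ n) w)\<bar> \<le> C" if "cov w \<in> K" for n w
    using C[of "(F ^^ n) w"] fnK[OF that] unfolding covFn by blast
  have pos: "d n w \<ge> real n * e" if w: "cov w \<in> K" "d m1 w > 0" and n: "n \<ge> m1" for n w
    using n
  proof (induction n rule: dec_induct)
    case base
    show ?case using gapd[OF m1(1) w(1)] w(2) by linarith
  next
    case (step n)
    have "d (Suc n) w > 0" using step.IH dSuc[of n w] Cpos[OF w(1), of n] big[OF step.hyps(1)] by linarith
    then show ?case using gapd[OF _ w(1), of "Suc n"] step.hyps(1) m1 by linarith
  qed
  have neg: "d n w \<le> - (real n * e)" if w: "cov w \<in> K" "\<not> d m1 w > 0" and n: "n \<ge> m1" for n w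
    using n
  proof (induction n rule: dec_induct)
    case base
    show ?case using gapd[OF m1(1) w(1)] w(2) by linarith
  next
    case (step n)
    have "d (Suc n) w < 0" using step.IH dSuc[of n w] Cpos[OF w(1), of n] big[OF step.hyps(1)] by linarith
    then show ?case using gapd[OF _ w(1), of "Suc n"] step.hyps(1) m1 by linarith
  qed
  have e1: "real m1 * e > 0" using m1 e by simp
  define P where "P = cov ` {w. cov w \<in> K \<and> d m1 w > 0}"
  define Q where "Q = cov ` {w. cov w \<in> K \<and> \<not> d m1 w > 0}"
  have inP: "cov w \<in> P \<longleftrightarrow> cov w \<in> K \<and> d m1 w > 0" for w
  proof
    assume "cov w \<in> P"
    then obtain v where v: "cov w = cov v" "cov v \<in> K" "d m1 v > 0" unfolding P_def by blast
    then show "cov w \<in> K \<and> d m1 w > 0" using dper[OF v(1)] by simp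
  qed (unfold P_def, blast)
  have inQ: "cov w \<in> Q \<longleftrightarrow> cov w \<in> K \<and> \<not> d m1 w > 0" for w
  proof
    assume "cov w \<in> Q"
    then obtain v where v: "cov w = cov v" "cov v \<in> K" "\<not> d m1 v > 0" unfolding Q_def by blast
    then show "cov w \<in> K \<and> \<not> d m1 w > 0" using dper[OF v(1)] by simp
  qed (unfold Q_def, blast)
  have lift: "\<exists>w. cov w = x" if "x \<in> K" for x using KL[OF that] by blast
  have PQK: "P \<union> Q = K"
  proof
    show "K \<subseteq> P \<union> Q"
    proof
      fix x assume "x \<in> K"
      then obtain w where w: "cov w = x" "cov w \<in> K" using lift by blast
      then have "cov w \<in> P \<union> Q" using inP inQ by blast
      then show "x \<in> P \<union> Q" using w by simp
    qed
  qed (unfold P_def Q_def, blast)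
  have disjPQ: "P \<inter> Q = {}"
  proof (rule ccontr)
    assume "P \<inter> Q \<noteq> {}"
    then obtain x where x: "x \<in> P" "x \<in> Q" by blast
    then obtain w where w: "cov w = x" using PQK lift by blast
    then have "cov w \<in> P" "cov w \<in> Q" using x by simp_all
    then show False using inP inQ by blast
  qed
  have "closed P"
  proof -
    \<comment> \<open>Over \<open>K\<close> a positive \<open>d m1\<close> is at least
      \<open>m1 * e\<close>, so the open condition is also a closed one.\<close>
    have "P = cov ` (KL \<inter> d m1 -` {real m1 * e..})"
    proof
      show "P \<subseteq> cov ` (KL \<inter> d m1 -` {real m1 * e..})"
      proof
        fix x assume x: "x \<in> P"
        then obtain w where w: "w \<in> KL" "cov w = x" using PQK KL by blast
        then have "cov w \<in> K" "d m1 w > 0" using x inP[of w] by simp_all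
        then have "d m1 w \<ge> real m1 * e" using pos[of w m1] by simp
        then show "x \<in> cov ` (KL \<inter> d m1 -` {real m1 * e..})" using w by blast
      qed
      show "cov ` (KL \<inter> d m1 -` {real m1 * e..}) \<subseteq> P"
      proof (rule image_subsetI)
        fix w assume w: "w \<in> KL \<inter> d m1 -` {real m1 * e..}"
        then have "cov w \<in> K" "d m1 w \<ge> real m1 * e" unfolding KL_def by auto
        then show "cov w \<in> P" unfolding inP using e1 by simp
      qed
    qed
    moreover have "compact (KL \<inter> d m1 -` {real m1 * e..})"
      using cKL by (intro closedin_compact[OF cKL] continuous_closedin_preimage contd) auto
    ultimately show ?thesis using compact_imp_closed compact_continuous_image[OF continuous_on_cov] by metis
  qed
  moreover have "closed Q"
  proof -
    have "Q = cov ` (KL \<inter> d m1 -` {..0})"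
    proof
      show "Q \<subseteq> cov ` (KL \<inter> d m1 -` {..0})"
      proof
        fix x assume x: "x \<in> Q"
        then obtain w where w: "w \<in> KL" "cov w = x" using PQK KL by blast
        then have "\<not> d m1 w > 0" using x inQ[of w] by simp
        then show "x \<in> cov ` (KL \<inter> d m1 -` {..0})" using w by auto
      qed
      show "cov ` (KL \<inter> d m1 -` {..0}) \<subseteq> Q"
      proof (rule image_subsetI)
        fix w assume w: "w \<in> KL \<inter> d m1 -` {..0}"
        then have "cov w \<in> K" "\<not> d m1 w > 0" unfolding KL_def by auto
        then show "cov w \<in> Q" unfolding inQ by simp
      qed
    qed
    moreover have "compact (KL \<inter> d m1 -` {..0})"
      using cKL by (intro closedin_compact[OF cKL] continuous_closedin_preimage contd) auto
    ultimately show ?thesis using compact_imp_closed compact_continuous_image[OF continuous_on_cov] by metis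
  qed
  moreover have fP: "f ` P \<subseteq> P"
  proof (rule image_subsetI)
    fix x assume x: "x \<in> P"
    then obtain w where w: "cov w = x" using PQK lift by blast
    then have wP: "cov w \<in> K" "d m1 w > 0" using x inP[of w] by simp_all
    have "d (Suc m1) w \<ge> real (Suc m1) * e" by (rule pos[OF wP]) simp
    then have "d m1 (F w) > 0" using dSuc2[of m1 w] C[OF wP(1)] big[of "Suc m1"] by linarith
    moreover have "cov (F w) \<in> K" unfolding covF using fK wP by blast
    ultimately have "cov (F w) \<in> P" unfolding inP by blast
    then show "f x \<in> P" unfolding covF w .
  qed
  moreover have fQ: "f ` Q \<subseteq> Q"
  proof (rule image_subsetI)
    fix x assume x: "x \<in> Q"
    then obtain w where w: "cov w = x" using PQK lift by blast
    then have wP: "cov w \<in> K" "\<not> d m1 w > 0" using x inQ[of w] by simp_all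
    have "d (Suc m1) w \<le> - (real (Suc m1) * e)" by (rule neg[OF wP]) simp
    then have "\<not> d m1 (F w) > 0" using dSuc2[of m1 w] C[OF wP(1)] big[of "Suc m1"] by linarith
    moreover have "cov (F w) \<in> K" unfolding covF using fK wP by blast
    ultimately have "cov (F w) \<in> Q" unfolding inQ by blast
    then show "f x \<in> Q" unfolding covF w .
  qed
  moreover have "g ` P \<subseteq> P"
  proof (rule image_subsetI)
    fix x assume x: "x \<in> P"
    then have xK: "x \<in> K" "x \<in> Ann" using PQK K by blast+
    then have "g x \<in> P \<union> Q" using gK PQK by blast
    moreover have "g x \<notin> Q"
    proof
      assume "g x \<in> Q"
      then have "f (g x) \<in> Q" using fQ by blast
      then show False using fg[OF xK(2)] x disjPQ by auto
    qed
    ultimately show "g x \<in> P" by blast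
  qed
  moreover have "g ` Q \<subseteq> Q"
  proof (rule image_subsetI)
    fix x assume x: "x \<in> Q"
    then have xK: "x \<in> K" "x \<in> Ann" using PQK K by blast+
    then have "g x \<in> P \<union> Q" using gK PQK by blast
    moreover have "g x \<notin> P"
    proof
      assume "g x \<in> P"
      then have "f (g x) \<in> P" using fP by blast
      then show False using fg[OF xK(2)] x disjPQ by auto
    qed
    ultimately show "g x \<in> Q" by blast
  qed
  moreover have "Q \<noteq> {}"
  proof -
    have "a \<in> closure (X m1)" using abc(1) m1 unfolding rho by auto
    then have "{..<c} \<inter> X m1 \<noteq> {}" using \<open>a < c\<close> open_Int_closure_eq_empty[of "{..<c}" "X m1"] by auto
    then obtain n w where nw: "n \<ge> m1" "cov w \<in> K" "ereal (rho_n F n w) < ereal c0" unfolding X_def c0 by auto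
    then have "rho_n F n w - c0 < 0" by simp
    then have "d n w < 0" using rd[of n w] nw(1) m1 by (simp add: divide_less_0_iff)
    moreover have "real n * e \<ge> 0" using e by simp
    ultimately have "\<not> d m1 w > 0" using pos[OF nw(2) _ nw(1)] by linarith
    then show ?thesis using inQ nw by blast
  qed
  moreover have "P \<noteq> {}"
  proof -
    have "b \<in> closure (X m1)" using abc(2) m1 unfolding rho by auto
    then have "{c<..} \<inter> X m1 \<noteq> {}" using \<open>c < b\<close> open_Int_closure_eq_empty[of "{c<..}" "X m1"] by auto
    then obtain n w where nw: "n \<ge> m1" "cov w \<in> K" "ereal (rho_n F n w) > ereal c0" unfolding X_def c0 by auto
    then have "rho_n F n w - c0 > 0" by simp
    then have "d n w > 0" using rd[of n w] nw(1) m1 by (simp add: zero_less_divide_iff)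
    moreover have "real n * e \<ge> 0" using e by simp
    ultimately have "d m1 w > 0" using neg[OF nw(2) _ nw(1)] by linarith
    then show ?thesis using inP nw by blast
  qed
  moreover have "\<exists>N\<ge>2. \<forall>x y. cov x \<in> P \<longrightarrow> cov y \<in> Q \<longrightarrow>
        fst ((F ^^ N) x) - fst x - (fst ((F ^^ N) y) - fst y) \<ge> t" for t
  proof -
    obtain k1 :: nat where k1: "real k1 * e > t" using reals_Archimedean3[OF e(1)] by blast
    \<comment> \<open>\<open>k1\<close> makes the difference exceed \<open>t\<close>,
      \<open>m1\<close> puts \<open>N\<close> in the range of frozen signs, and the last summand
      ensures \<open>N \<ge> 2\<close>.\<close>
    define N where "N = k1 + m1 + 2"
    have "real k1 * e \<le> real N * e" using e by (intro mult_right_mono) (auto simp: N_def)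
    then have Nt: "real N * e > t" using k1 by linarith
    have Ne: "real N * e \<ge> 0" using e by simp
    have "fst ((F ^^ N) x) - fst x - (fst ((F ^^ N) y) - fst y) \<ge> t" if "cov x \<in> P" "cov y \<in> Q" for x y
    proof -
      have "d N x \<ge> real N * e" using that(1) unfolding inP by (intro pos) (auto simp: N_def)
      moreover have "d N y \<le> - (real N * e)" using that(2) unfolding inQ by (intro neg) (auto simp: N_def)
      moreover have "fst ((F ^^ N) x) - fst x - (fst ((F ^^ N) y) - fst y) = d N x - d N y" unfolding d_def by simp
      ultimately show ?thesis using Nt Ne by linarith
    qed
    then show ?thesis by (intro exI[of _ N]) (simp add: N_def)
  qed
  ultimately show ?thesis using that disjPQ PQK by metis
qed

section \<open>Directions in which the two curves are pushed\<close>

lemma no_opposite_rotation_Inv: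
  assumes spm: "splits gm D V" and spp: "splits gp E W" and disj: "(D \<union> gm) \<inter> (E \<union> gp) = {}"
    and hD: "half (-1) h \<subseteq> D" and hE: "half 1 h \<subseteq> E" and h: "h > 0"
    and gD: "g ` (D \<union> gm) \<subseteq> D" and fE: "f ` (E \<union> gp) \<subseteq> E"
    and PQ: "closed P" "closed Q" "P \<inter> Q = {}" "P \<union> Q = Inv (D \<union> E)"
    and inv: "f ` P \<subseteq> P" "f ` Q \<subseteq> Q" "g ` P \<subseteq> P" "g ` Q \<subseteq> Q"
    and ne: "P \<noteq> {}" "Q \<noteq> {}"
    and rot: "\<And>b. \<exists>N\<ge>2. \<forall>x y. cov x \<in> P \<longrightarrow> cov y \<in> Q \<longrightarrow>
        fst ((F ^^ N) x) - fst x - (fst ((F ^^ N) y) - fst y) \<ge> b"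
  shows False
proof -
  interpret dr: drift f g F Fi D gm V E gp W 1 h
    by unfold_locales (use assms in auto)
  interpret du: drift g f Fi F E gp W D gm V "-1" h by (rule dr.drift_dual)
  have "dr.S \<inter> dr.U = Inv (D \<union> E)"
  proof
    show "dr.S \<inter> dr.U \<subseteq> Inv (D \<union> E)"
    proof
      fix x assume x: "x \<in> dr.S \<inter> dr.U"
      then have 1: "x \<in> Ann" "x \<notin> D" "x \<notin> E" "\<And>n. (f ^^ n) x \<notin> E" "\<And>n. (g ^^ n) x \<notin> D"
        unfolding dr.S_def dr.U_def by blast+
      then have "(f ^^ n) x \<notin> D" "(g ^^ n) x \<notin> E" for n
        using dr.fpowD[of x n] du.fpowD[of x n] by blast+
      then show "x \<in> Inv (D \<union> E)" using 1 unfolding Inv_def by blast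
    qed
    show "Inv (D \<union> E) \<subseteq> dr.S \<inter> dr.U"
    proof
      fix x assume x: "x \<in> Inv (D \<union> E)"
      then have 1: "x \<in> Ann" "\<And>n. (f ^^ n) x \<notin> D \<union> E" "\<And>n. (g ^^ n) x \<notin> D \<union> E" unfolding Inv_def by blast+
      have "x \<notin> D \<union> E" using 1(2)[of 0] by simp
      then show "x \<in> dr.S \<inter> dr.U" using 1 unfolding dr.S_def dr.U_def by blast
    qed
  qed
  then have PQ4: "P \<union> Q = dr.S \<inter> dr.U" using PQ(4) by simp
  show False by (rule dr.no_opposite_rotation[OF refl PQ(1-3) PQ4 inv ne rot])
qed

text \<open>Each curve is pushed to one of its sides, which leaves four cases. If \<open>f\<close>,
  or \<open>g\<close>, pushes both curves into the annulus, connectedness contradicts the splitting;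
  otherwise there is a drift towards one end.\<close>

lemma rho_set_Inv_interval:
  assumes spm: "splits gm D V" and spp: "splits gp E W" and disj: "(D \<union> gm) \<inter> (E \<union> gp) = {}"
    and hD: "half (-1) h \<subseteq> D" and hE: "half 1 h \<subseteq> E" and h: "h > 0"
    and m: "(f ` (V \<union> gm) \<subseteq> V \<and> g ` (D \<union> gm) \<subseteq> D) \<or> (f ` (D \<union> gm) \<subseteq> D \<and> g ` (V \<union> gm) \<subseteq> V)"
    and p: "(f ` (W \<union> gp) \<subseteq> W \<and> g ` (E \<union> gp) \<subseteq> E) \<or> (f ` (E \<union> gp) \<subseteq> E \<and> g ` (W \<union> gp) \<subseteq> W)"
  shows "ereal_interval (rho_set F f (Inv (D \<union> E)))"
proof (rule ccontr)
  assume gap: "\<not> ereal_interval (rho_set F f (Inv (D \<union> E)))"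
  define K where "K = Inv (D \<union> E)"
  have KA: "K \<subseteq> Ann" unfolding K_def Inv_def by blast
  have "closed K"
  proof -
    have oDE: "openin (top_of_set Ann) (D \<union> E)" using spm spp unfolding splits_def by auto
    have "K = (\<Inter>n. (Ann \<inter> (f ^^ n) -` (Ann - (D \<union> E))) \<inter> (Ann \<inter> (g ^^ n) -` (Ann - (D \<union> E))))"
    proof -
      have "(f ^^ n) x \<in> Ann" "(g ^^ n) x \<in> Ann" if "x \<in> Ann" for n x
        using annulus_lift.fAnn[OF pow that] annulus_lift.gAnn[OF pow that] by blast+
      then show ?thesis unfolding K_def Inv_def by blast
    qed
    moreover have "closed (Ann \<inter> (f ^^ n) -` (Ann - (D \<union> E)))" "closed (Ann \<inter> (g ^^ n) -` (Ann - (D \<union> E)))" for n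
      using annulus_lift.contf[OF pow, of n] annulus_lift.contg[OF pow, of n] closed_Ann closed_Ann_Diff[OF oDE]
      by (auto intro!: continuous_closed_preimage)
    ultimately show ?thesis by auto
  qed
  moreover have "bounded K"
  proof (rule bounded_Ann[OF KA, of h])
    fix x assume x: "x \<in> K"
    then have "(f ^^ 0) x \<notin> D \<union> E" unfolding K_def Inv_def by blast
    then have "x \<notin> half (-1) h" "x \<notin> half 1 h" "x \<in> Ann" using hD hE KA x by auto
    then show "\<bar>snd x\<bar> \<le> h" unfolding half_def by auto
  qed
  ultimately have "compact K" by (simp add: compact_eq_bounded_closed)
  have fK: "f ` K \<subseteq> K" "g ` K \<subseteq> K" unfolding K_def using Inv_f Inv_g by blast+
  obtain P Q where PQ: "closed P" "closed Q" "P \<inter> Q = {}" "P \<union> Q = K"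
    and inv: "f ` P \<subseteq> P" "f ` Q \<subseteq> Q" "g ` P \<subseteq> P" "g ` Q \<subseteq> Q" and ne: "P \<noteq> {}" "Q \<noteq> {}"
    and rot: "\<And>b. \<exists>N\<ge>2. \<forall>x y. cov x \<in> P \<longrightarrow> cov y \<in> Q \<longrightarrow>
        fst ((F ^^ N) x) - fst x - (fst ((F ^^ N) y) - fst y) \<ge> b"
    using rotation_split[OF \<open>compact K\<close> KA fK gap[folded K_def]] by metis
  interpret d: annulus_lift g f Fi F by (rule dual)
  have notconn: "\<not> connected K"
    using PQ ne connected_closed[of K] by blast
  consider "f ` (V \<union> gm) \<subseteq> V" "f ` (W \<union> gp) \<subseteq> W" | "g ` (V \<union> gm) \<subseteq> V" "g ` (W \<union> gp) \<subseteq> W"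
    | "g ` (D \<union> gm) \<subseteq> D" "f ` (E \<union> gp) \<subseteq> E" | "f ` (D \<union> gm) \<subseteq> D" "g ` (E \<union> gp) \<subseteq> E"
    using m p by blast
  then show False
  proof cases
    case 1
    then show False using Inv_connected[OF spm spp disj hD hE] notconn unfolding K_def by blast
  next
    case 2
    then show False using d.Inv_connected[OF spm spp disj hD hE] notconn unfolding K_def Inv_dual by blast
  next
    case 3
    show False by (rule no_opposite_rotation_Inv[OF spm spp disj hD hE h 3 PQ[unfolded K_def] inv ne rot])
  next
    case 4
    have QP: "Q \<inter> P = {}" "Q \<union> P = d.Inv (D \<union> E)" using PQ(3,4) unfolding K_def Inv_dual by blast+
    \<comment> \<open>The displacement of \<open>x\<close> under \<open>Fi ^^ N\<close> is minus the
      displacement of \<open>(Fi ^^ N) x\<close> under \<open>F ^^ N\<close>, so \<open>P\<close>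
      and \<open>Q\<close> change roles.\<close>
    have rot': "\<exists>N\<ge>2. \<forall>x y. cov x \<in> Q \<longrightarrow> cov y \<in> P \<longrightarrow>
        fst ((Fi ^^ N) x) - fst x - (fst ((Fi ^^ N) y) - fst y) \<ge> b" for b
    proof -
      obtain N where N: "N \<ge> 2" "\<forall>x y. cov x \<in> P \<longrightarrow> cov y \<in> Q \<longrightarrow>
        fst ((F ^^ N) x) - fst x - (fst ((F ^^ N) y) - fst y) \<ge> b" using rot by blast
      interpret q: annulus_lift "f ^^ N" "g ^^ N" "F ^^ N" "Fi ^^ N" by (rule pow)
      have gP: "(g ^^ n) z \<in> P" if "z \<in> P" for z n by (induction n) (use that inv(3) in auto)
      have gQ: "(g ^^ n) z \<in> Q" if "z \<in> Q" for z n by (induction n) (use that inv(4) in auto)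
      have "fst ((Fi ^^ N) x) - fst x - (fst ((Fi ^^ N) y) - fst y) \<ge> b" if xy: "cov x \<in> Q" "cov y \<in> P" for x y
      proof -
        have "cov ((Fi ^^ N) x) \<in> Q" "cov ((Fi ^^ N) y) \<in> P" unfolding q.covFi using gP gQ xy by blast+
        then have "fst ((F ^^ N) ((Fi ^^ N) y)) - fst ((Fi ^^ N) y) - (fst ((F ^^ N) ((Fi ^^ N) x)) - fst ((Fi ^^ N) x)) \<ge> b"
          using N(2) by blast
        then show ?thesis by simp
      qed
      then show ?thesis using N(1) by blast
    qed
    show False
      by (rule d.no_opposite_rotation_Inv[OF spm spp disj hD hE h 4 PQ(2,1) QP inv(4,3) inv(2,1) ne(2,1) rot'])
  qed
qed

end

section \<open>Relative position of the two curves\<close>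

theorem theoremD:
  fixes H :: "real \<Rightarrow> apt \<Rightarrow> apt" and f :: "apt \<Rightarrow> apt"
    and F :: "real \<Rightarrow> real \<times> real \<Rightarrow> real \<times> real"
    and gp gm :: "apt set"
  assumes "is_isotopy H f"
    and "is_isotopy_lift F H"
    and "essential gp" and "essential gm"
    and "free_curve f gp" and "free_curve f gm"
    and "gp \<inter> gm = {}"
    and "Theta f (closed_annulus_between gp gm) \<noteq> {}"
  shows "ereal_interval (rho_set (F 1) f (Theta f (closed_annulus_between gp gm)))"
proof -
  obtain g Fi where "annulus_lift f g (F 1) Fi" using isotopy_annulus_lift[OF assms(1,2)] .
  then interpret annulus_lift f g "F 1" Fi .
  obtain h1 where h1: "half 1 h1 \<subseteq> f ` {x \<in> Ann. 1 * snd x > 0}"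
    using isotopy_preserves_end[OF assms(1), of 1] by blast
  obtain h2 where h2: "half (-1) h2 \<subseteq> f ` {x \<in> Ann. -1 * snd x > 0}"
    using isotopy_preserves_end[OF assms(1), of "-1"] by blast

  \<comment> \<open>The image of the curve is connected and disjoint from the curve, so it lies on
    one side. The isotopy preserves both ends, hence each side meets its own image.\<close>
  have dich: "(f ` (B \<union> \<gamma>) \<subseteq> B \<and> g ` (A \<union> \<gamma>) \<subseteq> A) \<or> (f ` (A \<union> \<gamma>) \<subseteq> A \<and> g ` (B \<union> \<gamma>) \<subseteq> B)"
    if sp: "splits \<gamma> A B" and hA: "half (-1) k \<subseteq> A" and hB: "half 1 k \<subseteq> B" and con: "connected \<gamma>"
      and free: "free_curve f \<gamma>" for \<gamma> A B k
  proof -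
    have q: "A \<union> \<gamma> \<union> B = Ann" "openin (top_of_set Ann) A" "openin (top_of_set Ann) B" "A \<inter> B = {}"
      using sp unfolding splits_def by auto
    have \<gamma>A: "\<gamma> \<subseteq> Ann" using q(1) by blast
    have cf: "connected (f ` \<gamma>)" by (intro connected_continuous_image continuous_on_subset[OF contf] \<gamma>A con)
    have "f ` \<gamma> \<subseteq> Ann" using \<gamma>A fAnn by blast
    then have fAB: "f ` \<gamma> \<subseteq> A \<union> B" using q(1) free unfolding free_curve_def by blast
    have neA: "A \<inter> f ` A \<noteq> {}" by (rule end_image[OF _ h2 hA]) simp
    have neB: "B \<inter> f ` B \<noteq> {}" by (rule end_image[OF _ h1 hB]) simp
    show ?thesis
    proof (cases "f ` \<gamma> \<inter> A = {}")
      case True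
      then have "f ` \<gamma> \<subseteq> B" using fAB by blast
      then show ?thesis using free_curve_pushed[OF sp _ neA] by blast
    next
      case False
      then have "f ` \<gamma> \<subseteq> A" using connected_subset_split[OF cf fAB q(2,3,4)] by blast
      moreover have "splits \<gamma> B A" using sp splits_sym by blast
      ultimately show ?thesis using free_curve_pushed[of \<gamma> B A, OF _ _ neB] by blast
    qed
  qed

  \<comment> \<open>Here \<open>g1\<close> is the lower curve; either order of \<open>gp\<close> and
    \<open>gm\<close> is an instance.\<close>
  have main: "ereal_interval (rho_set (F 1) f (Theta f (closed_annulus_between g2 g1)))"
    if sp1: "splits g1 D V" and sp2: "splits g2 W E" and dj: "(D \<union> g1) \<inter> (E \<union> g2) = {}"
      and k1: "half (-1) k1 \<subseteq> D" "half 1 k1 \<subseteq> V" "k1 > 0" and k2: "half (-1) k2 \<subseteq> W" "half 1 k2 \<subseteq> E"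
      and con: "connected g1" "connected g2" and free: "free_curve f g1" "free_curve f g2"
    for g1 g2 D V W E k1 k2
  proof -
    define h where "h = max k1 k2"
    have h: "half (-1) h \<subseteq> D" "half 1 h \<subseteq> E" "h > 0"
      using k1 k2 half_antimono[of k1 h "-1"] half_antimono[of k2 h 1] unfolding h_def by auto
    have sp2': "splits g2 E W" using sp2 splits_sym by blast
    have d1: "(f ` (V \<union> g1) \<subseteq> V \<and> g ` (D \<union> g1) \<subseteq> D) \<or> (f ` (D \<union> g1) \<subseteq> D \<and> g ` (V \<union> g1) \<subseteq> V)"
      by (rule dich[OF sp1 k1(1,2) con(1) free(1)])
    have d2: "(f ` (W \<union> g2) \<subseteq> W \<and> g ` (E \<union> g2) \<subseteq> E) \<or> (f ` (E \<union> g2) \<subseteq> E \<and> g ` (W \<union> g2) \<subseteq> W)"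
      using dich[OF sp2 k2 con(2) free(2)] by blast
    have "Theta f (closed_annulus_between g2 g1) = Inv (D \<union> E)"
      unfolding closed_annulus_between_eq[OF sp1 sp2' dj h(1,2)]
      by (rule Theta_eq[OF sp1 sp2']) (use d1 d2 in blast)+
    then show ?thesis using rho_set_Inv_interval[OF sp1 sp2' dj h d1 d2] by simp
  qed

  obtain D V k where m: "splits gm D V" "half (-1) k \<subseteq> D" "half 1 k \<subseteq> V" "k > 0" "connected gm"
    using essential_splits[OF assms(4)] .
  obtain W E j where p: "splits gp W E" "half (-1) j \<subseteq> W" "half 1 j \<subseteq> E" "j > 0" "connected gp"
    using essential_splits[OF assms(3)] .
  have mid: "half s (max j k) \<subseteq> half s j" "half s (max j k) \<subseteq> half s k" for s
    by (rule half_antimono, simp)+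
  have low: "D \<inter> W \<noteq> {}" using half_nonempty[of "-1" "max j k"] mid[of "-1"] m(2) p(2) by blast
  have high: "V \<inter> E \<noteq> {}" using half_nonempty[of 1 "max j k"] mid[of 1] m(3) p(3) by blast
  have q: "D \<union> gm \<union> V = Ann" "openin (top_of_set Ann) D" "openin (top_of_set Ann) V" "D \<inter> V = {}"
    using m(1) unfolding splits_def by auto
  have "gp \<subseteq> Ann" using p(1) unfolding splits_def by blast
  then have gpDV: "gp \<subseteq> D \<union> V" using q(1) assms(7) by blast
  show ?thesis
  proof (cases "gp \<inter> D = {}")
    case True
    then have "gp \<subseteq> V" using gpDV by blast
    then have dj: "(D \<union> gm) \<inter> (E \<union> gp) = {}" using splits_nested[OF m(1) p(1) _ low] by blast
    show ?thesis by (rule main[OF m(1) p(1) dj m(2-4) p(2,3) m(5) p(5) assms(6,5)])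
  next
    case False
    then have "gp \<subseteq> D" using connected_subset_split[OF p(5) gpDV q(2-4)] by blast
    moreover have "splits gm V D" "splits gp E W" using m(1) p(1) splits_sym by blast+
    ultimately have "(V \<union> gm) \<inter> (W \<union> gp) = {}" using splits_nested[of gm V D gp E W] high by blast
    then have dj: "(W \<union> gp) \<inter> (V \<union> gm) = {}" by blast
    have "closed_annulus_between gp gm = closed_annulus_between gm gp"
      unfolding closed_annulus_between_def by (simp add: Un_commute)
    then show ?thesis using main[OF p(1) m(1) dj p(2-4) m(2,3) p(5) m(5) assms(5,6)] by simp
  qed
qed

end
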